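(* Let $((X_t),\mathbb{P}_\mu)$ be a stationary ergodic Markov process. (a) Suppose the Poincaré inequality $$\mathrm{Var}_\mu(g)\le c_{\mathrm{P}}\,\mathcal{E}(g,g),\qquad\forall g\in\mathbb{D}_2(\mathcal{L}),$$ holds with a finite constant $c_{\mathrm{P}}$. Then $$\|\nu-\mu\|_{TV}^2\le4c_{\mathrm{P}}\,I(\nu|\mu),\qquad\forall\nu\in M_1(\mathcal{X}).$$ In particular, for every initial probability measure $\beta\ll\mu$ with $d\beta/d\mu\in L^2(\mu)$, all $u\in b\mathcal{B}$ and all $t,r>0$, $$\mathbb{P}_\beta\Big(\frac1t\int_0^tu(X_s)\,ds-\mu(u)\ge r\Big)\le\Big\|\frac{d\beta}{d\mu}\Big\|_2\exp\Big(-\frac{t\,r^2}{c_{\mathrm{P}}\,\delta(u)^2}\Big),$$ where $\delta(u)=\sup_{x,y\in\mathcal{X}}|u(x)-u(y)|$. (b) Conversely, assume in addition that $((X_t),\mathbb{P}_\mu)$ is reversible and that $R_1=\int_0^\infty e^{-t}P_t\,dt$ is $\mu$-uniformly positive improving. If there is a left-continuous increasing function $\alpha$ such that $\alpha(r)>0$ for all $r>0$ and $$\alpha\big(\|\nu-\mu\|_{TV}\big)\le I(\nu|\mu),\qquad\forall\nu\in M_1(\mathcal{X}),$$ then the Poincaré inequality holds (with some finite constant). (c) In other words, when $d$ is the trivial metric $d(x,y)=\mathbf{1}_{x\ne y}$, in the reversible and $\mu$-uniformly positive improving case, the existence of a left-continuous increasing $\alpha$ with $\alpha(0)=0$, $\alpha(r)>0$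 for $r>0$, and $\alpha(W_1(\nu,\mu))\le I(\nu|\mu)$ for all $\nu\in M_1(\mathcal{X})$ is equivalent to the Poincaré inequality.
   Context: $\mathcal{X}$ is a complete separable metric space with Borel $\sigma$-field $\mathcal{B}$; $b\mathcal{B}$ is the space of bounded measurable real functions; $M_1(\mathcal{X})$ is the set of probability measures; $\mu(v)=\int v\,d\mu$; $\|\nu-\mu\|_{TV}=\sup_{|u|\le1}\int u\,d(\nu-\mu)$. For the trivial metric, $W_1(\nu,\mu)=\frac12\|\nu-\mu\|_{TV}$. Markov process: $(X_t)_{t\ge0}$, with laws $(\mathbb{P}_x)_{x\in\mathcal{X}}$, is an $\mathcal{X}$-valued continuous-time Markov process with invariant probability measure $\mu$ and transition semigroup $(P_t)$; $\mathbb{P}_\beta=\int\mathbb{P}_x\,\beta(dx)$. Standing assumptions: $\mu$ is ergodic (if $f\in b\mathcal{B}$ satisfies $P_tf=f$ $\mu$-a.e. for all $t\ge0$, then $f$ is constant $\mu$-a.e.); $(P_t)$ is strongly continuous on $L^2(\mu)$, with generator $\mathcal{L}$ of domain $\mathbb{D}_2(\mathcal{L})$; the form $\mathcal{E}(g,g)=\langle-\mathcal{L}g,g\rangle_\mu$, $g\in\mathbb{D}_2(\mathcal{L})$, is closable in $L^2(\mu)$, with closure $(\mathcal{E},\mathbb{D}(\mathcal{E}))$. Reversible means $(P_t)$ is symmetric on $L^2(\mu)$. $I(\nu|\mu)=\mathcal{E}(\sqrt f,\sqrt f)$ if $\nu=f\mu$ with $\sqrt f\in\mathbb{D}(\mathcal{E})$,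 and $+\infty$ otherwise. $R_1$ is $\mu$-uniformly positive improving if for every $\varepsilon>0$, $\inf\{\mu(\mathbf{1}_AR_1\mathbf{1}_B):A,B\in\mathcal{B},\ \mu(A),\mu(B)\ge\varepsilon\}>0$. "Increasing" means nondecreasing. Convention: $r^2/0=+\infty$. *)

theory Defs
  imports "HOL-Probability.Probability"
begin

section \<open>Elements of $L^2(\mu)$\<close>

text \<open>Elements of $L^2(\mu)$ are represented by square-integrable functions, not by classes;
  every notion below is invariant under modification on a \<open>\<mu>\<close>-null set.\<close>

definition L2 :: "'a measure \<Rightarrow> ('a \<Rightarrow> real) set" where
  "L2 \<mu> = {f \<in> borel_measurable \<mu>. integrable \<mu> (\<lambda>x. (f x)\<^sup>2)}"

definition L2_inner :: "'a measure \<Rightarrow> ('a \<Rightarrow> real) \<Rightarrow> ('a \<Rightarrow> real) \<Rightarrow> real" where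
  "L2_inner \<mu> f g = (\<integral>x. f x * g x \<partial>\<mu>)"

definition L2_norm :: "'a measure \<Rightarrow> ('a \<Rightarrow> real) \<Rightarrow> real" where
  "L2_norm \<mu> f = sqrt (\<integral>x. (f x)\<^sup>2 \<partial>\<mu>)"

definition Var :: "'a measure \<Rightarrow> ('a \<Rightarrow> real) \<Rightarrow> real" where
  "Var \<mu> g = (\<integral>x. (g x - (\<integral>y. g y \<partial>\<mu>))\<^sup>2 \<partial>\<mu>)"

section \<open>Generator and Dirichlet form of a semigroup on $L^2(\mu)$\<close>

definition is_generator_value ::
    "'a measure \<Rightarrow> (real \<Rightarrow> ('a \<Rightarrow> real) \<Rightarrow> 'a \<Rightarrow> real) \<Rightarrow> ('a \<Rightarrow> real) \<Rightarrow> ('a \<Rightarrow> real) \<Rightarrow> bool" where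
  "is_generator_value \<mu> T g h \<longleftrightarrow> g \<in> L2 \<mu> \<and> h \<in> L2 \<mu> \<and>
     ((\<lambda>t. L2_norm \<mu> (\<lambda>x. (T t g x - g x) / t - h x)) \<longlongrightarrow> 0) (at_right 0)"

definition gen_domain ::
    "'a measure \<Rightarrow> (real \<Rightarrow> ('a \<Rightarrow> real) \<Rightarrow> 'a \<Rightarrow> real) \<Rightarrow> ('a \<Rightarrow> real) set" where
  "gen_domain \<mu> T = {g. \<exists>h. is_generator_value \<mu> T g h}"

text \<open>The limit is unique up to \<open>\<mu>\<close>-a.e. equality; a representative is chosen.\<close>

definition generator ::
    "'a measure \<Rightarrow> (real \<Rightarrow> ('a \<Rightarrow> real) \<Rightarrow> 'a \<Rightarrow> real) \<Rightarrow> ('a \<Rightarrow> real) \<Rightarrow> 'a \<Rightarrow> real" where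
  "generator \<mu> T g = (SOME h. is_generator_value \<mu> T g h)"

definition pre_form ::
    "'a measure \<Rightarrow> (real \<Rightarrow> ('a \<Rightarrow> real) \<Rightarrow> 'a \<Rightarrow> real) \<Rightarrow> ('a \<Rightarrow> real) \<Rightarrow> real" where
  "pre_form \<mu> T g = L2_inner \<mu> (\<lambda>x. - generator \<mu> T g x) g"

definition form_Cauchy ::
    "'a measure \<Rightarrow> (real \<Rightarrow> ('a \<Rightarrow> real) \<Rightarrow> 'a \<Rightarrow> real) \<Rightarrow> (nat \<Rightarrow> 'a \<Rightarrow> real) \<Rightarrow> bool" where
  "form_Cauchy \<mu> T g \<longleftrightarrow> (\<forall>n. g n \<in> gen_domain \<mu> T) \<and>
     (\<forall>e>0. \<exists>N. \<forall>n\<ge>N. \<forall>m\<ge>N. pre_form \<mu> T (\<lambda>x. g n x - g m x) < e)"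

definition closable_form ::
    "'a measure \<Rightarrow> (real \<Rightarrow> ('a \<Rightarrow> real) \<Rightarrow> 'a \<Rightarrow> real) \<Rightarrow> bool" where
  "closable_form \<mu> T \<longleftrightarrow>
     (\<forall>g. form_Cauchy \<mu> T g \<and> (\<lambda>n. L2_norm \<mu> (g n)) \<longlonglongrightarrow> 0
        \<longrightarrow> (\<lambda>n. pre_form \<mu> T (g n)) \<longlonglongrightarrow> 0)"

definition form_approx ::
    "'a measure \<Rightarrow> (real \<Rightarrow> ('a \<Rightarrow> real) \<Rightarrow> 'a \<Rightarrow> real) \<Rightarrow> (nat \<Rightarrow> 'a \<Rightarrow> real) \<Rightarrow> ('a \<Rightarrow> real) \<Rightarrow> bool" where
  "form_approx \<mu> T g f \<longleftrightarrow> form_Cauchy \<mu> T g \<and> (\<lambda>n. L2_norm \<mu> (\<lambda>x. g n x - f x)) \<longlonglongrightarrow> 0"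

definition form_domain ::
    "'a measure \<Rightarrow> (real \<Rightarrow> ('a \<Rightarrow> real) \<Rightarrow> 'a \<Rightarrow> real) \<Rightarrow> ('a \<Rightarrow> real) set" where
  "form_domain \<mu> T = {f \<in> L2 \<mu>. \<exists>g. form_approx \<mu> T g f}"

text \<open>Diagonal of the closure; the limit does not depend on the approximating sequence
  when the form is closable.\<close>

definition dirichlet_form ::
    "'a measure \<Rightarrow> (real \<Rightarrow> ('a \<Rightarrow> real) \<Rightarrow> 'a \<Rightarrow> real) \<Rightarrow> ('a \<Rightarrow> real) \<Rightarrow> real" where
  "dirichlet_form \<mu> T f =
     (THE e. \<exists>g. form_approx \<mu> T g f \<and> (\<lambda>n. pre_form \<mu> T (g n)) \<longlonglongrightarrow> e)"

definition poincare ::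
    "'a measure \<Rightarrow> (real \<Rightarrow> ('a \<Rightarrow> real) \<Rightarrow> 'a \<Rightarrow> real) \<Rightarrow> real \<Rightarrow> bool" where
  "poincare \<mu> T c \<longleftrightarrow> 0 \<le> c \<and> (\<forall>g \<in> gen_domain \<mu> T. Var \<mu> g \<le> c * pre_form \<mu> T g)"

definition reversible ::
    "'a measure \<Rightarrow> (real \<Rightarrow> ('a \<Rightarrow> real) \<Rightarrow> 'a \<Rightarrow> real) \<Rightarrow> bool" where
  "reversible \<mu> T \<longleftrightarrow>
     (\<forall>t\<ge>0. \<forall>f \<in> L2 \<mu>. \<forall>g \<in> L2 \<mu>. L2_inner \<mu> (T t f) g = L2_inner \<mu> f (T t g))"

definition resolvent1 ::
    "(real \<Rightarrow> ('a \<Rightarrow> real) \<Rightarrow> 'a \<Rightarrow> real) \<Rightarrow> ('a \<Rightarrow> real) \<Rightarrow> 'a \<Rightarrow> real" where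
  "resolvent1 T f x = (LINT t:{0..}|lborel. exp (- t) * T t f x)"

text \<open>The infimum is taken in \<open>ereal\<close>, so that it is \<open>\<infinity>\<close> when there are no sets of measure at
  least \<open>\<epsilon>\<close> (that is, for \<open>\<epsilon> > 1\<close>).\<close>

definition uniformly_positive_improving ::
    "'a measure \<Rightarrow> (('a \<Rightarrow> real) \<Rightarrow> 'a \<Rightarrow> real) \<Rightarrow> bool" where
  "uniformly_positive_improving \<mu> R \<longleftrightarrow>
     (\<forall>\<epsilon>>0. 0 < Inf {ereal (\<integral>x. indicator A x * R (indicator B) x \<partial>\<mu>) | A B.
        A \<in> sets \<mu> \<and> B \<in> sets \<mu> \<and> measure \<mu> A \<ge> \<epsilon> \<and> measure \<mu> B \<ge> \<epsilon>})"

section \<open>Information and distances between probability measures\<close>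

definition fisher_info ::
    "'a measure \<Rightarrow> (real \<Rightarrow> ('a \<Rightarrow> real) \<Rightarrow> 'a \<Rightarrow> real) \<Rightarrow> 'a measure \<Rightarrow> ereal" where
  "fisher_info \<mu> T \<nu> =
     (let h = (\<lambda>x. sqrt (enn2real (RN_deriv \<mu> \<nu> x))) in
      if absolutely_continuous \<mu> \<nu> \<and> h \<in> form_domain \<mu> T
      then ereal (dirichlet_form \<mu> T h) else \<infinity>)"

text \<open>A constant times an information, with \<open>0 \<cdot> \<infinity> = \<infinity>\<close>: a bound by \<open>I(\<nu>|\<mu>)\<close> is void when
  \<open>I(\<nu>|\<mu>) = \<infinity>\<close>, also for the constant 0 (library multiplication has \<open>0 * \<infinity> = 0\<close>).\<close>

definition info_scale :: "real \<Rightarrow> ereal \<Rightarrow> ereal" where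
  "info_scale c I = (if I = \<infinity> then \<infinity> else ereal c * I)"

definition tv_norm :: "'a::topological_space measure \<Rightarrow> 'a measure \<Rightarrow> real" where
  "tv_norm \<nu> \<mu> = (SUP u \<in> {u \<in> borel_measurable borel. \<forall>x. \<bar>u x\<bar> \<le> 1}.
     (\<integral>x. u x \<partial>\<nu>) - (\<integral>x. u x \<partial>\<mu>))"

definition couplings :: "'a::topological_space measure \<Rightarrow> 'a measure \<Rightarrow> ('a \<times> 'a) measure set" where
  "couplings \<nu> \<mu> = {\<pi> \<in> space (prob_algebra (borel \<Otimes>\<^sub>M borel)).
     distr \<pi> borel fst = \<nu> \<and> distr \<pi> borel snd = \<mu>}"

definition W1 :: "('a \<Rightarrow> 'a \<Rightarrow> real) \<Rightarrow> 'a::topological_space measure \<Rightarrow> 'a measure \<Rightarrow> ennreal" where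
  "W1 d \<nu> \<mu> = (INF \<pi> \<in> couplings \<nu> \<mu>. \<integral>\<^sup>+z. ennreal (d (fst z) (snd z)) \<partial>\<pi>)"

definition trivial_metric :: "'a \<Rightarrow> 'a \<Rightarrow> real" where
  "trivial_metric x y = (if x = y then 0 else 1)"

definition oscillation :: "('a \<Rightarrow> real) \<Rightarrow> real" where
  "oscillation u = (SUP p. \<bar>u (fst p) - u (snd p)\<bar>)"

text \<open>$\exp(-t r^2/(c\,\delta^2))$ with $r^2/0 = +\infty$ and $e^{-\infty} = 0$.\<close>

definition deviation_bound :: "real \<Rightarrow> real \<Rightarrow> real \<Rightarrow> real \<Rightarrow> real" where
  "deviation_bound c \<delta> t r =
     (if c * \<delta>\<^sup>2 = 0 then 0 else exp (- (t * r\<^sup>2 / (c * \<delta>\<^sup>2))))"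

text \<open>Values in \<open>ereal\<close> allow the rate function to take the value \<open>\<infinity>\<close>; only its restriction
  to $[0,\infty)$ matters.\<close>

definition left_cont_increasing :: "(real \<Rightarrow> ereal) \<Rightarrow> bool" where
  "left_cont_increasing \<alpha> \<longleftrightarrow> mono_on {0..} \<alpha> \<and> (\<forall>r>0. continuous (at_left r) \<alpha>)"

section \<open>Markov processes\<close>

definition transition ::
    "('x \<Rightarrow> 'w measure) \<Rightarrow> (real \<Rightarrow> 'w \<Rightarrow> 'x) \<Rightarrow> real \<Rightarrow> ('x \<Rightarrow> real) \<Rightarrow> 'x \<Rightarrow> real" where
  "transition P X t f x = (\<integral>\<omega>. f (X t \<omega>) \<partial>P x)"

definition past_events :: "'w measure \<Rightarrow> (real \<Rightarrow> 'w \<Rightarrow> 'x::topological_space) \<Rightarrow> real \<Rightarrow> 'w set set" where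
  "past_events F X s =
     sigma_sets (space F) {X r -` A \<inter> space F | r A. 0 \<le> r \<and> r \<le> s \<and> A \<in> sets borel}"

text \<open>\<open>F\<close> carries the sample space and its \<open>\<sigma>\<close>-field only; its measure is irrelevant.
  Joint measurability of \<open>X\<close> makes the time averages measurable random variables.\<close>

locale markov_process =
  fixes F :: "'w measure"
    and P :: "'x::polish_space \<Rightarrow> 'w measure"
    and X :: "real \<Rightarrow> 'w \<Rightarrow> 'x"
  assumes kernel: "P \<in> borel \<rightarrow>\<^sub>M prob_algebra F"
    and jointly_measurable:
      "(\<lambda>(t, \<omega>). X t \<omega>) \<in> restrict_space borel {0..} \<Otimes>\<^sub>M F \<rightarrow>\<^sub>M borel"
    and start: "AE \<omega> in P x. X 0 \<omega> = x"
    and markov: "0 \<le> s \<Longrightarrow> 0 \<le> t \<Longrightarrow> E \<in> past_events F X s \<Longrightarrow> A \<in> sets borel \<Longrightarrow>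
      measure (P x) (E \<inter> X (s + t) -` A) =
      (\<integral>\<omega>. indicator E \<omega> * measure (P (X s \<omega>)) (X t -` A \<inter> space F) \<partial>P x)"

locale stationary_ergodic_markov_process =
  markov_process F P X + prob_space \<mu>
  for F :: "'w measure"
    and P :: "'x::polish_space \<Rightarrow> 'w measure"
    and X :: "real \<Rightarrow> 'w \<Rightarrow> 'x"
    and \<mu> :: "'x measure" +
  assumes sets_mu: "sets \<mu> = sets borel"
    and invariant: "0 \<le> t \<Longrightarrow> A \<in> sets borel \<Longrightarrow>
      (\<integral>x. measure (P x) (X t -` A \<inter> space F) \<partial>\<mu>) = measure \<mu> A"
    and ergodic: "f \<in> borel_measurable borel \<Longrightarrow> bounded (range f) \<Longrightarrow>
      (\<And>t. 0 \<le> t \<Longrightarrow> AE x in \<mu>. transition P X t f x = f x) \<Longrightarrow>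
      \<exists>c. AE x in \<mu>. f x = c"
    and strongly_continuous: "f \<in> L2 \<mu> \<Longrightarrow>
      ((\<lambda>t. L2_norm \<mu> (\<lambda>x. transition P X t f x - f x)) \<longlongrightarrow> 0) (at_right 0)"
    and closable: "closable_form \<mu> (transition P X)"

end

theory Submission
  imports Defs
begin

text \<open>For a normalised \<open>g\<close>, Cauchy-Schwarz gives
  \<open>(\<integral>\<bar>g\<^sup>2 - 1\<bar> d\<mu>)\<^sup>2 \<le> 4 Var g\<close>, which the Poincare inequality bounds by the closed form at
  \<open>g = sqrt (d\<nu>/d\<mu>)\<close>. For the deviation inequality, the Poincare inequality is first integrated to
  the decay \<open>Var (T t g) \<le> exp (- 2 t / c) Var g\<close>. With it, one step of length \<open>h\<close> of
  the semigroup followed by multiplication with \<open>exp (h V)\<close>, \<open>V = \<kappa> (u - \<mu> u)\<close>, has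
  squared norm at most \<open>1 + 2 h \<kappa>\<^sup>2 \<delta>\<^sup>2 c / 4 + O(h\<^sup>2)\<close>. Iterating the step bounds
  exponential moments of Riemann sums of the path, and Jensen's inequality over a random shift of
  the grid passes from Riemann sums to the integral, without continuity of paths.

  Conversely, suppose that a bounded \<open>f\<close> of mean 0 and norm 1 satisfies
  \<open>\<langle>f - T t f, f\<rangle> \<le> \<kappa> t\<close> for a small \<open>\<kappa>\<close> and some \<open>t \<le> 1\<close>. By reversibility the time average
  \<open>H\<close> of \<open>T s \<bar>f\<bar>\<close> over \<open>[0, t]\<close> is in the domain of the generator, has form at most \<open>\<kappa>\<close>,
  and is close to \<open>\<bar>f\<bar>\<close>. The information inequality, applied to the normalised \<open>H\<^sup>2 \<mu>\<close>, forces
  \<open>\<bar>f\<bar>\<close> to be close to 1, so \<open>f\<close> is close to \<open>1\<^sub>A - 1\<^sub>B\<close> with \<open>A\<close>, \<open>B\<close> the sets of both signs, each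
  of measure about 1/2. Then \<open>\<mu> (1\<^sub>A R\<^sub>1 1\<^sub>B)\<close> is small, contradicting uniform positivity. A lower
  bound \<open>\<kappa> t Var f\<close> for \<open>\<langle>f - T t f, f\<rangle>\<close> becomes the Poincare inequality as \<open>t\<close> tends to 0.\<close>

section \<open>Square-integrable functions\<close>

text \<open>The argument runs without a Feynman-Kac semigroup and without a spectral resolution;
  finite-time objects on bounded functions replace both. In the direct part the Poincare inequality
  has to act on \<open>T h g\<close>, which need not lie in the domain of the generator; this is why
  it is first turned into decay of the variance. The factor 1/4 comes from recentering u at the
  midpoint of its range, and minimising -\<kappa> t r + t \<kappa>^2 \<delta>^2 c / 4 over \<kappa>
  produces the exponent -t r^2 / (c \<delta>^2). In the converse everything is phrased through
  \<langle>f - T t f, f\<rangle>, which is defined on all of L2 and shrinks under absolute value and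
  truncation, operations that may leave the domain of the generator. Reversibility makes s \<mapsto>
  \<langle>T s f, f\<rangle> convex. This bounds the form of a time average, and it lets smallness
  at one single time t control all times, so that it can be integrated against exp (- s) in the
  resolvent.\<close>

text \<open>The discriminant of a nonnegative quadratic polynomial, isolated because Cauchy-Schwarz
  or the triangle inequality is derived from it for three forms: the inner product,
  \<open>pre_form\<close> and \<open>time_form\<close>.\<close>

lemma sqrt_triangle_of_nonneg_quadratic:
  fixes a b c :: real
  assumes nonneg: "\<And>s. 0 \<le> a + s * b + s\<^sup>2 * c"
  shows "b\<^sup>2 \<le> 4 * a * c" "sqrt (a + b + c) \<le> sqrt a + sqrt c"
proof -
  have a: "0 \<le> a" using nonneg[of 0] by simp
  have c: "0 \<le> c"
  proof (rule ccontr)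
    assume "\<not> 0 \<le> c"
    then have c0: "c < 0" by simp
    \<comment> \<open>Chosen so that s * c = -(\<bar>b\<bar> + a + 1 - c) and s \<ge> 1: then b + s
      * c \<le> -(a + 1), and the polynomial is at most -1 at s.\<close>
    define s where "s = (\<bar>b\<bar> + a + 1 - c) / (- c)"
    have s1: "1 \<le> s" using c0 a by (simp add: s_def field_simps)
    have "k / (- c) * c = - k" for k using c0 by simp
    from this[of "\<bar>b\<bar> + a + 1 - c"] have sc: "s * c = - (\<bar>b\<bar> + a + 1 - c)" by (simp only: s_def)
    have "a + s * b + s\<^sup>2 * c = a + s * (b + s * c)"
      by (simp add: power2_eq_square algebra_simps)
    also have "\<dots> = a + s * (b - (\<bar>b\<bar> + a + 1 - c))" by (simp add: sc)
    also have "\<dots> \<le> a + s * (- (a + 1))"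
      using s1 c0 by (intro add_left_mono mult_left_mono) auto
    also have "\<dots> \<le> a + 1 * (- (a + 1))"
      using s1 a by (intro add_left_mono mult_right_mono_neg) auto
    finally show False using nonneg[of s] by simp
  qed
  show bb: "b\<^sup>2 \<le> 4 * a * c"
  proof (cases "c = 0")
    case True
    have "b = 0"
    proof (rule ccontr)
      assume "b \<noteq> 0"
      then show False using nonneg[of "- (a + 1) / b"] True by simp
    qed
    with True show ?thesis by simp
  next
    case False
    with c have c: "0 < c" by simp
    have "0 \<le> a + (- b / (2 * c)) * b + (- b / (2 * c))\<^sup>2 * c" by (rule nonneg)
    also have "\<dots> = (4 * a * c - b\<^sup>2) / (4 * c)"
      using c by (simp add: field_simps power2_eq_square)
    finally show ?thesis using c by (simp add: zero_le_divide_iff)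
  qed
  have "b \<le> \<bar>b\<bar>" by simp
  also have "\<bar>b\<bar> = sqrt (b\<^sup>2)" by simp
  also have "\<dots> \<le> sqrt (4 * a * c)" using bb by (rule real_sqrt_le_mono)
  also have "\<dots> = 2 * (sqrt a * sqrt c)" by (simp add: real_sqrt_mult)
  finally have "a + b + c \<le> (sqrt a + sqrt c)\<^sup>2"
    using a c by (simp add: power2_sum)
  then show "sqrt (a + b + c) \<le> sqrt a + sqrt c"
    using a c by (intro real_le_lsqrt) auto
qed

section \<open>Algebra, inner product and norm of square-integrable functions\<close>

lemma L2_measurable [measurable_dest]: "f \<in> L2 M \<Longrightarrow> f \<in> borel_measurable M"
  by (simp add: L2_def)

lemma L2_square_integrable: "f \<in> L2 M \<Longrightarrow> integrable M (\<lambda>x. (f x)\<^sup>2)"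
  by (simp add: L2_def)

lemma L2_mult_integrable:
  assumes [measurable]: "f \<in> L2 M" "g \<in> L2 M"
  shows "integrable M (\<lambda>x. f x * g x)"
proof (rule Bochner_Integration.integrable_bound)
  show "integrable M (\<lambda>x. (f x)\<^sup>2 + (g x)\<^sup>2)"
    using assms by (intro Bochner_Integration.integrable_add L2_square_integrable)
  show "AE x in M. norm (f x * g x) \<le> norm ((f x)\<^sup>2 + (g x)\<^sup>2)"
  proof (rule AE_I2)
    fix x
    have "2 * (\<bar>f x\<bar> * \<bar>g x\<bar>) \<le> (f x)\<^sup>2 + (g x)\<^sup>2"
      using sum_squares_bound[of "\<bar>f x\<bar>" "\<bar>g x\<bar>"] by simp
    moreover have "0 \<le> \<bar>f x\<bar> * \<bar>g x\<bar>" by simp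
    ultimately have "\<bar>f x\<bar> * \<bar>g x\<bar> \<le> (f x)\<^sup>2 + (g x)\<^sup>2" by linarith
    then show "norm (f x * g x) \<le> norm ((f x)\<^sup>2 + (g x)\<^sup>2)"
      by (simp add: abs_mult)
  qed
qed measurable

lemma L2_scale: "f \<in> L2 M \<Longrightarrow> (\<lambda>x. c * f x) \<in> L2 M"
  by (auto simp: L2_def power_mult_distrib)

lemma L2_divide: "f \<in> L2 M \<Longrightarrow> (\<lambda>x. f x / c) \<in> L2 M"
  by (auto simp: L2_def power_divide)

lemma L2_uminus: "f \<in> L2 M \<Longrightarrow> (\<lambda>x. - f x) \<in> L2 M"
  by (auto simp: L2_def)

lemma L2_add:
  assumes "f \<in> L2 M" "g \<in> L2 M"
  shows "(\<lambda>x. f x + g x) \<in> L2 M"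
  using assms L2_mult_integrable[OF assms]
  by (auto simp: L2_def power2_sum mult.assoc)

lemma L2_diff:
  assumes "f \<in> L2 M" "g \<in> L2 M"
  shows "(\<lambda>x. f x - g x) \<in> L2 M"
  using L2_add[OF assms(1) L2_uminus[OF assms(2)]] by simp

lemma L2_abs: "f \<in> L2 M \<Longrightarrow> (\<lambda>x. \<bar>f x\<bar>) \<in> L2 M"
  by (auto simp: L2_def)

lemma L2_cong_AE:
  assumes "f \<in> L2 M" and [measurable]: "g \<in> borel_measurable M" and "AE x in M. f x = g x"
  shows "g \<in> L2 M"
proof -
  have [measurable]: "f \<in> borel_measurable M" using assms(1) by (rule L2_measurable)
  have "integrable M (\<lambda>x. (g x)\<^sup>2) \<longleftrightarrow> integrable M (\<lambda>x. (f x)\<^sup>2)"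
    using assms(3) by (intro integrable_cong_AE) auto
  with assms show ?thesis by (simp add: L2_def)
qed

lemma L2_norm_cong_AE:
  assumes [measurable]: "f \<in> borel_measurable M" "g \<in> borel_measurable M"
    and "AE x in M. f x = g x"
  shows "L2_norm M f = L2_norm M g"
proof -
  have "(\<integral>x. (f x)\<^sup>2 \<partial>M) = (\<integral>x. (g x)\<^sup>2 \<partial>M)"
    using assms(3) by (intro integral_cong_AE) auto
  then show ?thesis by (simp add: L2_norm_def)
qed

lemma L2_norm_nonneg [simp]: "0 \<le> L2_norm M f"
  by (simp add: L2_norm_def)

lemma L2_norm_power2: "(L2_norm M f)\<^sup>2 = (\<integral>x. (f x)\<^sup>2 \<partial>M)"
  by (simp add: L2_norm_def)

lemma L2_norm_scale: "L2_norm M (\<lambda>x. c * f x) = \<bar>c\<bar> * L2_norm M f"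
  by (simp add: L2_norm_def power_mult_distrib real_sqrt_mult)

lemma L2_norm_minus_commute: "L2_norm M (\<lambda>x. f x - g x) = L2_norm M (\<lambda>x. g x - f x)"
  by (simp add: L2_norm_def power2_commute)

lemma L2_norm_abs [simp]: "L2_norm M (\<lambda>x. \<bar>f x\<bar>) = L2_norm M f"
  by (simp add: L2_norm_def)

lemma L2_inner_commute: "L2_inner M f g = L2_inner M g f"
  by (simp add: L2_inner_def mult.commute)

lemma L2_inner_scale: "L2_inner M (\<lambda>x. c * f x) g = c * L2_inner M f g"
  by (simp add: L2_inner_def mult.assoc)

lemma L2_inner_uminus: "L2_inner M (\<lambda>x. - f x) g = - L2_inner M f g"
  by (simp add: L2_inner_def)

lemma L2_inner_self: "L2_inner M f f = (L2_norm M f)\<^sup>2"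
  unfolding L2_norm_power2 L2_inner_def by (simp add: power2_eq_square)

lemma L2_inner_add:
  assumes "f \<in> L2 M" "g \<in> L2 M" "k \<in> L2 M"
  shows "L2_inner M (\<lambda>x. f x + g x) k = L2_inner M f k + L2_inner M g k"
  using assms by (simp add: L2_inner_def distrib_right L2_mult_integrable)

lemma L2_inner_diff:
  assumes "f \<in> L2 M" "g \<in> L2 M" "k \<in> L2 M"
  shows "L2_inner M (\<lambda>x. f x - g x) k = L2_inner M f k - L2_inner M g k"
  using assms by (simp add: L2_inner_def left_diff_distrib L2_mult_integrable)

lemma L2_inner_add_right:
  assumes "f \<in> L2 M" "g \<in> L2 M" "k \<in> L2 M"
  shows "L2_inner M k (\<lambda>x. f x + g x) = L2_inner M k f + L2_inner M k g"
  using assms by (simp add: L2_inner_def distrib_left L2_mult_integrable)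

lemma L2_inner_diff_right:
  assumes "f \<in> L2 M" "g \<in> L2 M" "k \<in> L2 M"
  shows "L2_inner M k (\<lambda>x. f x - g x) = L2_inner M k f - L2_inner M k g"
  using assms by (simp add: L2_inner_def right_diff_distrib L2_mult_integrable)

lemma L2_inner_cong_AE:
  assumes [measurable]: "f \<in> borel_measurable M" "f' \<in> borel_measurable M" "g \<in> borel_measurable M"
    and "AE x in M. f x = f' x"
  shows "L2_inner M f g = L2_inner M f' g"
  unfolding L2_inner_def using assms(4) by (intro integral_cong_AE) auto

lemma L2_norm_add_power2:
  assumes "f \<in> L2 M" "g \<in> L2 M"
  shows "(L2_norm M (\<lambda>x. f x + g x))\<^sup>2 = (L2_norm M f)\<^sup>2 + 2 * L2_inner M f g + (L2_norm M g)\<^sup>2"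
  using assms
  by (simp add: L2_inner_self[symmetric] L2_inner_add L2_inner_add_right L2_add L2_inner_commute[of M g f])

lemma L2_norm_diff_power2:
  assumes "f \<in> L2 M" "g \<in> L2 M"
  shows "(L2_norm M (\<lambda>x. f x - g x))\<^sup>2 = (L2_norm M f)\<^sup>2 - 2 * L2_inner M f g + (L2_norm M g)\<^sup>2"
  using assms
  by (simp add: L2_inner_self[symmetric] L2_inner_diff L2_inner_diff_right L2_diff L2_inner_commute[of M g f])

lemma
  assumes f: "f \<in> L2 M" and g: "g \<in> L2 M"
  shows L2_Cauchy_Schwarz_power2: "(L2_inner M f g)\<^sup>2 \<le> (L2_norm M f)\<^sup>2 * (L2_norm M g)\<^sup>2"
    and L2_norm_triangle: "L2_norm M (\<lambda>x. f x + g x) \<le> L2_norm M f + L2_norm M g"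
proof -
  have q: "0 \<le> (L2_norm M f)\<^sup>2 + s * (2 * L2_inner M f g) + s\<^sup>2 * (L2_norm M g)\<^sup>2" for s
  proof -
    have "(L2_norm M (\<lambda>x. f x + s * g x))\<^sup>2
        = (L2_norm M f)\<^sup>2 + s * (2 * L2_inner M f g) + s\<^sup>2 * (L2_norm M g)\<^sup>2"
      using L2_norm_add_power2[OF f L2_scale[OF g, of s]]
        L2_inner_scale[of M s g f] by (simp add: L2_norm_scale power_mult_distrib L2_inner_commute)
    then show ?thesis by (metis zero_le_power2)
  qed
  show "(L2_inner M f g)\<^sup>2 \<le> (L2_norm M f)\<^sup>2 * (L2_norm M g)\<^sup>2"
    using sqrt_triangle_of_nonneg_quadratic(1)[OF q] by (simp add: power_mult_distrib)
  have "sqrt ((L2_norm M (\<lambda>x. f x + g x))\<^sup>2) \<le> sqrt ((L2_norm M f)\<^sup>2) + sqrt ((L2_norm M g)\<^sup>2)"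
    using sqrt_triangle_of_nonneg_quadratic(2)[OF q] by (simp add: L2_norm_add_power2[OF f g])
  then show "L2_norm M (\<lambda>x. f x + g x) \<le> L2_norm M f + L2_norm M g" by simp
qed

lemma L2_Cauchy_Schwarz:
  assumes "f \<in> L2 M" "g \<in> L2 M"
  shows "\<bar>L2_inner M f g\<bar> \<le> L2_norm M f * L2_norm M g"
  using L2_Cauchy_Schwarz_power2[OF assms]
  by (metis L2_norm_nonneg abs_le_square_iff abs_mult abs_of_nonneg power_mult_distrib)

lemma L2_norm_triangle3:
  assumes "f \<in> L2 M" "g \<in> L2 M" "k \<in> L2 M"
  shows "L2_norm M (\<lambda>x. f x - k x) \<le> L2_norm M (\<lambda>x. f x - g x) + L2_norm M (\<lambda>x. g x - k x)"
  using L2_norm_triangle[OF L2_diff[OF assms(1,2)] L2_diff[OF assms(2,3)]] by simp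

lemma L2_norm_diff_le:
  assumes "f \<in> L2 M" "g \<in> L2 M"
  shows "\<bar>L2_norm M f - L2_norm M g\<bar> \<le> L2_norm M (\<lambda>x. f x - g x)"
  using L2_norm_triangle[OF L2_diff[OF assms] assms(2)] L2_norm_triangle[OF L2_diff[OF assms(2,1)] assms(1)]
  by (simp add: L2_norm_minus_commute[of M f g] abs_le_iff)

lemma L2_norm_eq_0_iff:
  assumes "f \<in> L2 M"
  shows "L2_norm M f = 0 \<longleftrightarrow> (AE x in M. f x = 0)"
  using integral_nonneg_eq_0_iff_AE[OF L2_square_integrable[OF assms]] by (simp add: L2_norm_def)

section \<open>Means and variances under finite and probability measures\<close>

context finite_measure
begin

lemma L2_bounded:
  assumes [measurable]: "f \<in> borel_measurable M" and "\<And>x. \<bar>f x\<bar> \<le> B"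
  shows "f \<in> L2 M"
proof -
  have "integrable M (\<lambda>x. (f x)\<^sup>2)"
  proof (rule integrable_const_bound)
    have "(f x)\<^sup>2 \<le> B\<^sup>2" for x using power_mono[OF assms(2)[of x], of 2] by simp
    then show "AE x in M. norm ((f x)\<^sup>2) \<le> B\<^sup>2" by simp
  qed measurable
  then show ?thesis by (simp add: L2_def)
qed

lemma L2_const: "(\<lambda>x. c) \<in> L2 M"
  by (rule L2_bounded[of _ "\<bar>c\<bar>"]) auto

lemma L2_integrable: "f \<in> L2 M \<Longrightarrow> integrable M f"
  using L2_mult_integrable[OF _ L2_const, of f 1] by simp

end

context prob_space
begin

lemma L2_norm_const: "L2_norm M (\<lambda>x. c) = \<bar>c\<bar>"
  by (simp add: L2_norm_def prob_space)

lemma abs_integral_le_L2_norm: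
  assumes "f \<in> L2 M"
  shows "\<bar>\<integral>x. f x \<partial>M\<bar> \<le> L2_norm M f"
  using L2_Cauchy_Schwarz[OF assms L2_const[of 1]] by (simp add: L2_inner_def L2_norm_const)

lemma integral_power2_le:
  assumes "f \<in> L2 M"
  shows "(\<integral>x. f x \<partial>M)\<^sup>2 \<le> (\<integral>x. (f x)\<^sup>2 \<partial>M)"
  using abs_integral_le_L2_norm[OF assms]
  by (metis L2_norm_nonneg L2_norm_power2 abs_le_square_iff abs_of_nonneg)

lemma Var_eq:
  assumes "f \<in> L2 M"
  shows "Var M f = (L2_norm M f)\<^sup>2 - (\<integral>x. f x \<partial>M)\<^sup>2"
proof -
  let ?m = "\<integral>x. f x \<partial>M"
  have "Var M f = (L2_norm M (\<lambda>x. f x - ?m))\<^sup>2"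
    by (simp add: Var_def L2_norm_power2)
  also have "\<dots> = (L2_norm M f)\<^sup>2 - 2 * L2_inner M f (\<lambda>x. ?m) + (L2_norm M (\<lambda>x. ?m))\<^sup>2"
    by (rule L2_norm_diff_power2[OF assms L2_const])
  also have "L2_inner M f (\<lambda>x. ?m) = ?m * ?m" by (simp add: L2_inner_def)
  finally show ?thesis by (simp add: L2_norm_const power2_eq_square)
qed

lemma Var_nonneg: "0 \<le> Var M f"
  by (simp add: Var_def)

text \<open>The norm and the mean are both 1-Lipschitz for the L2 norm. This carries variance bounds
  to the closure of the form and from truncations to unbounded functions.\<close>

lemma Var_tendsto:
  assumes "\<And>n. g n \<in> L2 M" "f \<in> L2 M" and lim: "(\<lambda>n. L2_norm M (\<lambda>x. g n x - f x)) \<longlonglongrightarrow> 0"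
  shows "(\<lambda>n. Var M (g n)) \<longlonglongrightarrow> Var M f"
proof -
  have "(\<lambda>n. L2_norm M (g n) - L2_norm M f) \<longlonglongrightarrow> 0"
    using L2_norm_diff_le[OF assms(1,2)] by (intro Lim_null_comparison[OF _ lim]) auto
  then have 1: "(\<lambda>n. L2_norm M (g n)) \<longlonglongrightarrow> L2_norm M f" by (rule LIM_zero_cancel)
  have "(\<lambda>n. (\<integral>x. g n x \<partial>M) - (\<integral>x. f x \<partial>M)) \<longlonglongrightarrow> 0"
  proof (rule Lim_null_comparison[OF _ lim], rule always_eventually, rule allI)
    fix n
    show "norm ((\<integral>x. g n x \<partial>M) - (\<integral>x. f x \<partial>M)) \<le> L2_norm M (\<lambda>x. g n x - f x)"
      using abs_integral_le_L2_norm[OF L2_diff[OF assms(1,2)], of n]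
      by (simp add: L2_integrable assms)
  qed
  then have 2: "(\<lambda>n. \<integral>x. g n x \<partial>M) \<longlonglongrightarrow> (\<integral>x. f x \<partial>M)" by (rule LIM_zero_cancel)
  have "(\<lambda>n. (L2_norm M (g n))\<^sup>2 - (\<integral>x. g n x \<partial>M)\<^sup>2) \<longlonglongrightarrow> (L2_norm M f)\<^sup>2 - (\<integral>x. f x \<partial>M)\<^sup>2"
    by (intro tendsto_intros 1 2)
  then show ?thesis by (simp add: Var_eq assms)
qed

text \<open>Cauchy-Schwarz applied to \<open>\<bar>f\<^sup>2 - q\<^sup>2\<bar> = \<bar>\<bar>f\<bar> - q\<bar> * (\<bar>f\<bar> + q)\<close>.\<close>

lemma integral_abs_square_diff_le:
  assumes f: "f \<in> L2 M"
  shows "(\<integral>x. \<bar>(f x)\<^sup>2 - (L2_norm M f)\<^sup>2\<bar> \<partial>M)\<^sup>2 \<le> 4 * (L2_norm M f)\<^sup>2 * Var M f"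
proof -
  define q where "q = L2_norm M f"
  define a where "a = (\<integral>x. \<bar>f x\<bar> \<partial>M)"
  have fa: "(\<lambda>x. \<bar>f x\<bar>) \<in> L2 M" by (rule L2_abs[OF f])
  have fm: "(\<lambda>x. \<bar>\<bar>f x\<bar> - q\<bar>) \<in> L2 M" and fp: "(\<lambda>x. \<bar>f x\<bar> + q) \<in> L2 M"
    by (intro L2_abs L2_diff L2_add f L2_const)+
  have "q \<ge> 0" by (simp add: q_def)
  then have "\<bar>(f x)\<^sup>2 - q\<^sup>2\<bar> = \<bar>\<bar>f x\<bar> - q\<bar> * (\<bar>f x\<bar> + q)" for x
    using abs_mult[of "\<bar>f x\<bar> - q" "\<bar>f x\<bar> + q"] by (simp add: algebra_simps power2_eq_square)
  then have "(\<integral>x. \<bar>(f x)\<^sup>2 - q\<^sup>2\<bar> \<partial>M) = L2_inner M (\<lambda>x. \<bar>\<bar>f x\<bar> - q\<bar>) (\<lambda>x. \<bar>f x\<bar> + q)"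
    by (simp add: L2_inner_def)
  then have "(\<integral>x. \<bar>(f x)\<^sup>2 - q\<^sup>2\<bar> \<partial>M)\<^sup>2
      \<le> (L2_norm M (\<lambda>x. \<bar>f x\<bar> - q))\<^sup>2 * (L2_norm M (\<lambda>x. \<bar>f x\<bar> + q))\<^sup>2"
    using L2_Cauchy_Schwarz_power2[OF fm fp] by simp
  also have "\<dots> = (2 * q\<^sup>2 - 2 * q * a) * (2 * q\<^sup>2 + 2 * q * a)"
  proof -
    have "L2_inner M (\<lambda>x. \<bar>f x\<bar>) (\<lambda>x. q) = a * q" by (simp add: L2_inner_def a_def)
    then have "(L2_norm M (\<lambda>x. \<bar>f x\<bar> - q))\<^sup>2 = 2 * q\<^sup>2 - 2 * q * a"
      "(L2_norm M (\<lambda>x. \<bar>f x\<bar> + q))\<^sup>2 = 2 * q\<^sup>2 + 2 * q * a"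
      using L2_norm_diff_power2[OF fa L2_const[of q]] L2_norm_add_power2[OF fa L2_const[of q]]
      by (simp_all add: L2_norm_const flip: q_def)
    then show ?thesis by (simp only:)
  qed
  also have "\<dots> = 4 * q\<^sup>2 * (q\<^sup>2 - a\<^sup>2)" by (simp add: algebra_simps power2_eq_square)
  \<comment> \<open>The bracket q^2 - a^2 is the variance of \<bar>f\<bar>, which is at most that of
    f because \<bar>\<mu> f\<bar> \<le> \<mu> \<bar>f\<bar>.\<close>
  also have "\<dots> \<le> 4 * q\<^sup>2 * (q\<^sup>2 - (\<integral>x. f x \<partial>M)\<^sup>2)"
  proof -
    have "\<bar>\<integral>x. f x \<partial>M\<bar> \<le> a" unfolding a_def by (rule integral_abs_bound)
    then have "(\<integral>x. f x \<partial>M)\<^sup>2 \<le> a\<^sup>2" by (metis abs_ge_zero abs_le_square_iff abs_of_nonneg order_trans)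
    then show ?thesis by (intro mult_left_mono) auto
  qed
  finally show ?thesis by (simp add: Var_eq[OF f] q_def)
qed

end

section \<open>Transition kernels\<close>

context markov_process
begin

abbreviation T :: "real \<Rightarrow> ('x \<Rightarrow> real) \<Rightarrow> 'x \<Rightarrow> real" where
  "T \<equiv> transition P X"

text \<open>Negative times are sent to \<open>0\<close>, which makes the kernel jointly measurable on the whole line.\<close>

definition K :: "real \<Rightarrow> 'x \<Rightarrow> 'x measure" where
  "K t x = distr (P x) borel (X (max 0 t))"

lemma
  shows prob_space_P: "prob_space (P x)" and sets_P [measurable_cong, simp]: "sets (P x) = sets F"
  using measurable_space[OF kernel, of x] by (auto simp: space_prob_algebra)

lemma space_P [simp]: "space (P x) = space F"
  by (rule sets_eq_imp_space_eq) simp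

lemma measurable_P [measurable]: "P \<in> borel \<rightarrow>\<^sub>M subprob_algebra F"
  by (rule measurable_prob_algebraD[OF kernel])

lemma measurable_X_pair [measurable]:
  "(\<lambda>(t, \<omega>). X (max 0 t) \<omega>) \<in> borel \<Otimes>\<^sub>M F \<rightarrow>\<^sub>M borel"
proof -
  have 0: "(\<lambda>t::real. max 0 t) \<in> borel \<rightarrow>\<^sub>M restrict_space borel {0..}"
    by (rule measurable_restrict_space2) auto
  have 1: "(\<lambda>p. max 0 (fst p)) \<in> borel \<Otimes>\<^sub>M F \<rightarrow>\<^sub>M restrict_space borel {0::real..}"
    using measurable_compose[OF measurable_fst 0] .
  have "(\<lambda>p. (max 0 (fst p), snd p)) \<in> borel \<Otimes>\<^sub>M F \<rightarrow>\<^sub>M restrict_space borel {0::real..} \<Otimes>\<^sub>M F"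
    using 1 measurable_snd by (rule measurable_Pair)
  from measurable_compose[OF this jointly_measurable]
  show ?thesis by (simp add: case_prod_unfold)
qed

lemma measurable_X_pair': "(\<lambda>p. X (max 0 (fst p)) (snd p)) \<in> borel \<Otimes>\<^sub>M F \<rightarrow>\<^sub>M borel"
  using measurable_X_pair by (simp add: case_prod_unfold)

lemma measurable_X_max [measurable]: "X (max 0 t) \<in> F \<rightarrow>\<^sub>M borel"
  using measurable_compose[OF measurable_Pair1'[of t borel F] measurable_X_pair'] by simp

lemma measurable_X: "0 \<le> t \<Longrightarrow> X t \<in> F \<rightarrow>\<^sub>M borel"
  using measurable_X_max[of t] by simp

lemma measurable_K_pair [measurable]: "(\<lambda>(t, x). K t x) \<in> borel \<Otimes>\<^sub>M borel \<rightarrow>\<^sub>M prob_algebra borel"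
  unfolding K_def case_prod_unfold
proof (rule measurable_distr_prob_space2[where M=F])
  show "(\<lambda>p. P (snd p)) \<in> borel \<Otimes>\<^sub>M borel \<rightarrow>\<^sub>M prob_algebra F"
    using measurable_compose[OF measurable_snd kernel] .
  have "(\<lambda>q. (fst (fst q), snd q)) \<in> (borel \<Otimes>\<^sub>M borel) \<Otimes>\<^sub>M F \<rightarrow>\<^sub>M borel \<Otimes>\<^sub>M F"
    by measurable
  from measurable_compose[OF this measurable_X_pair']
  show "(\<lambda>(p, \<omega>). X (max 0 (fst p)) \<omega>) \<in> (borel \<Otimes>\<^sub>M borel) \<Otimes>\<^sub>M F \<rightarrow>\<^sub>M borel"
    by (simp add: case_prod_unfold)
qed

lemma measurable_K_prob: "K t \<in> borel \<rightarrow>\<^sub>M prob_algebra borel"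
  using measurable_compose[OF measurable_Pair1'[of t borel borel] measurable_K_pair] by simp

lemma measurable_K [measurable]: "K t \<in> borel \<rightarrow>\<^sub>M subprob_algebra borel"
  by (rule measurable_prob_algebraD[OF measurable_K_prob])

lemma prob_space_K: "prob_space (K t x)" and sets_K [measurable_cong, simp]: "sets (K t x) = sets borel"
  using measurable_space[OF measurable_K_prob, of x t] by (auto simp: space_prob_algebra)

lemma space_K [simp]: "space (K t x) = UNIV"
  using sets_eq_imp_space_eq[OF sets_K] by simp

lemma T_eq_K: "0 \<le> t \<Longrightarrow> f \<in> borel_measurable borel \<Longrightarrow> T t f x = (\<integral>y. f y \<partial>K t x)"
  using measurable_X[of t] by (simp add: transition_def K_def integral_distr)

lemma nn_integral_K:
  "0 \<le> t \<Longrightarrow> f \<in> borel_measurable borel \<Longrightarrow> (\<integral>\<^sup>+y. f y \<partial>K t x) = (\<integral>\<^sup>+\<omega>. f (X t \<omega>) \<partial>P x)"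
  using measurable_X[of t] by (simp add: K_def nn_integral_distr)

lemma emeasure_K:
  "0 \<le> t \<Longrightarrow> A \<in> sets borel \<Longrightarrow> emeasure (K t x) A = emeasure (P x) (X t -` A \<inter> space F)"
  using measurable_X[of t] by (simp add: K_def emeasure_distr)

lemma K_0: "K 0 x = return borel x"
proof (rule measure_eqI)
  fix A assume "A \<in> sets (K 0 x)"
  then have A [measurable]: "A \<in> sets borel" by simp
  interpret prob_space "P x" by (rule prob_space_P)
  have [measurable]: "X 0 \<in> F \<rightarrow>\<^sub>M borel" by (rule measurable_X) simp
  have "emeasure (K 0 x) A = (\<integral>\<^sup>+\<omega>. indicator A (X 0 \<omega>) \<partial>P x)"
    using nn_integral_K[of 0 "indicator A" x] by simp
  also have "\<dots> = (\<integral>\<^sup>+\<omega>. indicator A x \<partial>P x)"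
    using start[of x] by (intro nn_integral_cong_AE) auto
  finally show "emeasure (K 0 x) A = emeasure (return borel x) A"
    by (simp add: emeasure_space_1[unfolded space_P])
qed simp

section \<open>The Markov property for functionals of the past\<close>

text \<open>\<open>past_events\<close> is a bare family of sets. As a measure space it supports
  measurable functions of the past and induction over them.\<close>

definition past :: "real \<Rightarrow> 'w measure" where
  "past s = sigma (space F) {X r -` A \<inter> space F | r A. 0 \<le> r \<and> r \<le> s \<and> A \<in> sets borel}"

lemma space_past [simp]: "space (past s) = space F"
  by (simp add: past_def space_measure_of_conv)

lemma sets_past: "sets (past s) = past_events F X s"
  unfolding past_def past_events_def by (rule sets_measure_of) auto

lemma X_measurable_past: "0 \<le> r \<Longrightarrow> r \<le> s \<Longrightarrow> X r \<in> past s \<rightarrow>\<^sub>M borel"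
  by (rule measurableI) (auto simp: sets_past past_events_def intro!: sigma_sets.Basic)

lemma sets_past_subset: "sets (past s) \<subseteq> sets F"
  unfolding sets_past past_events_def
  by (rule sets.sigma_sets_subset) (auto intro!: measurable_sets measurable_X)

lemma measurable_past_imp: "f \<in> past s \<rightarrow>\<^sub>M N \<Longrightarrow> f \<in> F \<rightarrow>\<^sub>M N"
  using sets_past_subset by (auto simp: measurable_def)

text \<open>The axiom \<open>markov\<close> rewritten with nonnegative integrals and the kernel
  \<open>K\<close>, the form in which it can be fed into uniqueness of measures and monotone
  limits.\<close>

lemma markov_indicator:
  assumes s: "0 \<le> s" and t: "0 \<le> t" and E: "E \<in> sets (past s)" and A: "A \<in> sets borel"
  shows "(\<integral>\<^sup>+\<omega>. indicator E \<omega> * indicator A (X (s + t) \<omega>) \<partial>P x) =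
    (\<integral>\<^sup>+\<omega>. indicator E \<omega> * emeasure (K t (X s \<omega>)) A \<partial>P x)"
proof -
  interpret prob_space "P x" by (rule prob_space_P)
  have EF [measurable]: "E \<in> sets F" using E sets_past_subset by auto
  have Xs [measurable]: "X s \<in> F \<rightarrow>\<^sub>M borel" "X (s + t) \<in> F \<rightarrow>\<^sub>M borel"
    using s t by (auto intro!: measurable_X)
  note [measurable] = A
  have sub: "E \<inter> X (s + t) -` A = E \<inter> (X (s + t) -` A \<inter> space F)"
    using sets.sets_into_space[OF EF] by auto
  have m: "measure (P y) (X t -` A \<inter> space F) = measure (K t y) A" for y
    using emeasure_K[OF t A, of y] by (simp add: measure_def)
  have [measurable]: "(\<lambda>y. measure (K t y) A) \<in> borel_measurable borel"
    using A by measurable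
  have "(\<integral>\<^sup>+\<omega>. indicator E \<omega> * indicator A (X (s + t) \<omega>) \<partial>P x)
      = (\<integral>\<^sup>+\<omega>. indicator (E \<inter> (X (s + t) -` A \<inter> space F)) \<omega> \<partial>P x)"
    by (intro nn_integral_cong) (auto simp: indicator_def)
  also have "\<dots> = emeasure (P x) (E \<inter> (X (s + t) -` A \<inter> space F))"
    by (rule nn_integral_indicator) measurable
  also have "\<dots> = ennreal (measure (P x) (E \<inter> X (s + t) -` A))"
    by (simp add: emeasure_eq_measure sub)
  also have "\<dots> = ennreal (\<integral>\<omega>. indicator E \<omega> * measure (K t (X s \<omega>)) A \<partial>P x)"
    using markov[OF s t _ A, of E x] E by (simp add: sets_past m)
  also have "\<dots> = (\<integral>\<^sup>+\<omega>. ennreal (indicator E \<omega> * measure (K t (X s \<omega>)) A) \<partial>P x)"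
  proof (rule nn_integral_eq_integral[symmetric])
    have "norm (indicator E \<omega> * measure (K t (X s \<omega>)) A) \<le> 1" for \<omega>
      using prob_space.prob_le_1[OF prob_space_K, of t "X s \<omega>" A]
      by (auto simp: indicator_def)
    then show "integrable (P x) (\<lambda>\<omega>. indicator E \<omega> * measure (K t (X s \<omega>)) A)"
      by (intro integrable_const_bound[of _ 1]) auto
  qed (auto simp: indicator_def)
  also have "\<dots> = (\<integral>\<^sup>+\<omega>. indicator E \<omega> * emeasure (K t (X s \<omega>)) A \<partial>P x)"
  proof (intro nn_integral_cong)
    fix \<omega>
    interpret K: prob_space "K t (X s \<omega>)" by (rule prob_space_K)
    show "ennreal (indicator E \<omega> * measure (K t (X s \<omega>)) A) = indicator E \<omega> * emeasure (K t (X s \<omega>)) A"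
      by (simp add: K.emeasure_eq_measure indicator_def)
  qed
  finally show ?thesis .
qed

text \<open>The Markov property for the sure event, integrated under \<open>P x\<close>.\<close>

lemma Chapman_Kolmogorov:
  assumes s: "0 \<le> s" and t: "0 \<le> t"
  shows "K s x \<bind> K t = K (s + t) x"
proof (rule measure_eqI)
  show "sets (K s x \<bind> K t) = sets (K (s + t) x)"
    by (subst sets_bind[where N=borel]) (auto intro: measurable_K[THEN measurable_space])
  fix A assume "A \<in> sets (K s x \<bind> K t)"
  then have A [measurable]: "A \<in> sets borel"
    by (subst (asm) sets_bind[where N=borel]) (auto intro: measurable_K[THEN measurable_space])
  have [measurable]: "(\<lambda>y. emeasure (K t y) A) \<in> borel_measurable borel"
    using measurable_K A by measurable
  have "emeasure (K s x \<bind> K t) A = (\<integral>\<^sup>+y. emeasure (K t y) A \<partial>K s x)"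
    by (rule emeasure_bind[where N=borel]) (auto cong: measurable_cong_sets)
  also have "\<dots> = (\<integral>\<^sup>+\<omega>. emeasure (K t (X s \<omega>)) A \<partial>P x)"
    by (rule nn_integral_K[OF s]) measurable
  also have "\<dots> = (\<integral>\<^sup>+\<omega>. indicator (space F) \<omega> * emeasure (K t (X s \<omega>)) A \<partial>P x)"
    by (intro nn_integral_cong) auto
  also have "\<dots> = (\<integral>\<^sup>+\<omega>. indicator (space F) \<omega> * indicator A (X (s + t) \<omega>) \<partial>P x)"
    by (rule markov_indicator[OF s t _ A, symmetric]) (metis sets.top space_past)
  also have "\<dots> = (\<integral>\<^sup>+\<omega>. indicator A (X (s + t) \<omega>) \<partial>P x)"
    by (intro nn_integral_cong) auto
  also have "\<dots> = emeasure (K (s + t) x) A"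
    using nn_integral_K[of "s + t" "indicator A" x] s t by simp
  finally show "emeasure (K s x \<bind> K t) A = emeasure (K (s + t) x) A" .
qed

text \<open>Restricting \<open>P x\<close> to E turns both sides into integrals of g against image
  measures. These two measures agree on sets by \<open>markov_indicator\<close>, so the identity
  holds for every nonnegative measurable g at once.\<close>

lemma markov_event:
  assumes s: "0 \<le> s" and t: "0 \<le> t" and E: "E \<in> sets (past s)" and g [measurable]: "g \<in> borel_measurable borel"
  shows "(\<integral>\<^sup>+\<omega>. indicator E \<omega> * g (X (s + t) \<omega>) \<partial>P x) =
    (\<integral>\<^sup>+\<omega>. indicator E \<omega> * (\<integral>\<^sup>+y. g y \<partial>K t (X s \<omega>)) \<partial>P x)"
proof -
  have EF [measurable]: "E \<in> sets F" using E sets_past_subset by auto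
  have Xs [measurable]: "X s \<in> F \<rightarrow>\<^sub>M borel" "X (s + t) \<in> F \<rightarrow>\<^sub>M borel"
    using s t by (auto intro!: measurable_X)
  let ?D = "density (P x) (indicator E)"
  have D [measurable_cong]: "sets ?D = sets F" by simp
  have Ks: "K t \<in> distr ?D borel (X s) \<rightarrow>\<^sub>M subprob_algebra borel"
    by (simp cong: measurable_cong_sets)
  have eq: "distr ?D borel (X (s + t)) = distr ?D borel (X s) \<bind> K t"
  proof (rule measure_eqI)
    show "sets (distr ?D borel (X (s + t))) = sets (distr ?D borel (X s) \<bind> K t)"
      by (subst sets_bind[where N=borel]) auto
    fix A assume "A \<in> sets (distr ?D borel (X (s + t)))"
    then have A [measurable]: "A \<in> sets borel" by simp
    have [measurable]: "(\<lambda>y. emeasure (K t y) A) \<in> borel_measurable borel"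
      using measurable_K A by measurable
    have "emeasure (distr ?D borel (X (s + t))) A = (\<integral>\<^sup>+y. indicator A y \<partial>distr ?D borel (X (s + t)))"
      by simp
    also have "\<dots> = (\<integral>\<^sup>+\<omega>. indicator E \<omega> * indicator A (X (s + t) \<omega>) \<partial>P x)"
      by (subst nn_integral_distr) (auto simp: nn_integral_density)
    also have "\<dots> = (\<integral>\<^sup>+\<omega>. indicator E \<omega> * emeasure (K t (X s \<omega>)) A \<partial>P x)"
      by (rule markov_indicator[OF s t E A])
    also have "\<dots> = (\<integral>\<^sup>+y. emeasure (K t y) A \<partial>distr ?D borel (X s))"
      by (subst nn_integral_distr) (auto simp: nn_integral_density)
    also have "\<dots> = emeasure (distr ?D borel (X s) \<bind> K t) A"
      by (rule emeasure_bind[symmetric, where N=borel]) (auto cong: measurable_cong_sets)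
    finally show "emeasure (distr ?D borel (X (s + t))) A = emeasure (distr ?D borel (X s) \<bind> K t) A" .
  qed
  have [measurable]: "(\<lambda>y. \<integral>\<^sup>+z. g z \<partial>K t y) \<in> borel_measurable borel"
    by (rule nn_integral_measurable_subprob_algebra2[where N=borel]) measurable
  have "(\<integral>\<^sup>+\<omega>. indicator E \<omega> * g (X (s + t) \<omega>) \<partial>P x) = (\<integral>\<^sup>+y. g y \<partial>distr ?D borel (X (s + t)))"
    by (subst nn_integral_distr) (auto simp: nn_integral_density)
  also have "\<dots> = (\<integral>\<^sup>+y. \<integral>\<^sup>+z. g z \<partial>K t y \<partial>distr ?D borel (X s))"
    unfolding eq by (rule nn_integral_bind[where B=borel, OF g Ks])
  also have "\<dots> = (\<integral>\<^sup>+\<omega>. indicator E \<omega> * (\<integral>\<^sup>+y. g y \<partial>K t (X s \<omega>)) \<partial>P x)"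
    by (subst nn_integral_distr) (auto simp: nn_integral_density)
  finally show ?thesis .
qed

text \<open>The second extension, from events E to nonnegative functionals \<Phi> of the past, by
  approximation with simple functions. Values in \<open>ennreal\<close> make monotone limits
  available without any integrability.\<close>

lemma markov_nn_integral:
  assumes s: "0 \<le> s" and t: "0 \<le> t" and g [measurable]: "g \<in> borel_measurable borel"
    and \<Phi>: "\<Phi> \<in> borel_measurable (past s)"
  shows "(\<integral>\<^sup>+\<omega>. \<Phi> \<omega> * g (X (s + t) \<omega>) \<partial>P x) =
    (\<integral>\<^sup>+\<omega>. \<Phi> \<omega> * (\<integral>\<^sup>+y. g y \<partial>K t (X s \<omega>)) \<partial>P x)"
proof -
  have Xs [measurable]: "X s \<in> F \<rightarrow>\<^sub>M borel" "X (s + t) \<in> F \<rightarrow>\<^sub>M borel"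
    using s t by (auto intro!: measurable_X)
  have [measurable]: "(\<lambda>y. \<integral>\<^sup>+z. g z \<partial>K t y) \<in> borel_measurable borel"
    by (rule nn_integral_measurable_subprob_algebra2[where N=borel]) measurable
  have past_F: "f \<in> borel_measurable F" if "f \<in> borel_measurable (past s)" for f :: "'w \<Rightarrow> ennreal"
    using that by (rule measurable_past_imp)
  show ?thesis
    using \<Phi>
  proof (induction \<Phi> rule: borel_measurable_induct)
    case (cong f g')
    then have eq: "f \<omega> = g' \<omega>" if "\<omega> \<in> space F" for \<omega> using that by simp
    have "(\<integral>\<^sup>+\<omega>. g' \<omega> * g (X (s + t) \<omega>) \<partial>P x) = (\<integral>\<^sup>+\<omega>. f \<omega> * g (X (s + t) \<omega>) \<partial>P x)"
      by (intro nn_integral_cong) (simp add: eq)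
    moreover have "(\<integral>\<^sup>+\<omega>. g' \<omega> * (\<integral>\<^sup>+y. g y \<partial>K t (X s \<omega>)) \<partial>P x)
        = (\<integral>\<^sup>+\<omega>. f \<omega> * (\<integral>\<^sup>+y. g y \<partial>K t (X s \<omega>)) \<partial>P x)"
      by (intro nn_integral_cong) (simp add: eq)
    ultimately show ?case using cong.IH by simp
  next
    case (set A)
    then show ?case by (intro markov_event s t g)
  next
    case (mult u c)
    note [measurable] = past_F[OF mult.hyps(2)]
    show ?case using mult.IH by (simp add: mult.assoc nn_integral_cmult)
  next
    case (add u v)
    note [measurable] = past_F[OF add.hyps(1)] past_F[OF add.hyps(3)]
    show ?case using add.IH by (simp add: distrib_right nn_integral_add)
  next
    case (seq U)
    note [measurable] = past_F[OF seq.hyps(1)]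
    have SUP: "(\<integral>\<^sup>+\<omega>. (SUP i. U i) \<omega> * h \<omega> \<partial>P x) = (SUP i. \<integral>\<^sup>+\<omega>. U i \<omega> * h \<omega> \<partial>P x)"
      if [measurable]: "h \<in> borel_measurable F" for h
    proof -
      have "(\<integral>\<^sup>+\<omega>. (SUP i. U i) \<omega> * h \<omega> \<partial>P x) = (\<integral>\<^sup>+\<omega>. (SUP i. U i \<omega> * h \<omega>) \<partial>P x)"
        by (simp add: SUP_mult_right_ennreal image_comp)
      also have "\<dots> = (SUP i. \<integral>\<^sup>+\<omega>. U i \<omega> * h \<omega> \<partial>P x)"
        using seq.hyps(3) by (intro nn_integral_monotone_convergence_SUP)
          (auto simp: incseq_def le_fun_def intro!: mult_right_mono)
      finally show ?thesis .
    qed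
    have 1: "(\<lambda>\<omega>. g (X (s + t) \<omega>)) \<in> borel_measurable F"
      and 2: "(\<lambda>\<omega>. \<integral>\<^sup>+y. g y \<partial>K t (X s \<omega>)) \<in> borel_measurable F" by measurable
    show ?case by (simp only: SUP[OF 1] SUP[OF 2] seq.IH)
  qed
qed

section \<open>Products along a grid of times: the discrete Feynman-Kac formula\<close>

definition nn_step :: "('x \<Rightarrow> ennreal) \<Rightarrow> real \<Rightarrow> ('x \<Rightarrow> ennreal) \<Rightarrow> 'x \<Rightarrow> ennreal" where
  "nn_step v h g x = v x * (\<integral>\<^sup>+y. g y \<partial>K h x)"

lemma measurable_nn_integral_K [measurable]:
  assumes [measurable]: "g \<in> borel_measurable borel"
  shows "(\<lambda>x. \<integral>\<^sup>+y. g y \<partial>K h x) \<in> borel_measurable borel"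
  by (rule nn_integral_measurable_subprob_algebra2[where N=borel]) measurable

lemma measurable_nn_step [measurable]:
  assumes [measurable]: "v \<in> borel_measurable borel" "g \<in> borel_measurable borel"
  shows "nn_step v h g \<in> borel_measurable borel"
  unfolding nn_step_def[abs_def] by measurable

text \<open>Conditioning on the past up to time s + n h absorbs the last transition and the last
  factor into \<open>nn_step v h g\<close>; the induction therefore runs over all g. The starting
  time s is kept free because it later becomes the random shift of the grid.\<close>

lemma nn_integral_product_path:
  assumes s: "0 \<le> s" and h: "0 \<le> h" and [measurable]: "v \<in> borel_measurable borel"
    and g: "g \<in> borel_measurable borel"
  shows "(\<integral>\<^sup>+\<omega>. (\<Prod>k<n. v (X (s + real k * h) \<omega>)) * g (X (s + real n * h) \<omega>) \<partial>P x)
    = (\<integral>\<^sup>+y. (nn_step v h ^^ n) g y \<partial>K s x)"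
  using g
proof (induction n arbitrary: g)
  case 0
  then show ?case using nn_integral_K[OF s] by simp
next
  case (Suc n)
  note [measurable] = Suc.prems
  let ?\<Phi> = "\<lambda>\<omega>. \<Prod>k<Suc n. v (X (s + real k * h) \<omega>)"
  let ?r = "s + real n * h"
  have r: "0 \<le> ?r" using s h by simp
  have [measurable]: "?\<Phi> \<in> borel_measurable (past ?r)"
  proof (rule borel_measurable_prod_ennreal)
    fix k assume "k \<in> {..<Suc n}"
    then have "real k * h \<le> real n * h" using h by (intro mult_right_mono) auto
    then have [measurable]: "X (s + real k * h) \<in> past ?r \<rightarrow>\<^sub>M borel"
      using s h by (intro X_measurable_past) auto
    show "(\<lambda>\<omega>. v (X (s + real k * h) \<omega>)) \<in> borel_measurable (past ?r)" by measurable
  qed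
  have "(\<integral>\<^sup>+\<omega>. ?\<Phi> \<omega> * g (X (s + real (Suc n) * h) \<omega>) \<partial>P x)
      = (\<integral>\<^sup>+\<omega>. ?\<Phi> \<omega> * g (X (?r + h) \<omega>) \<partial>P x)"
    by (simp add: algebra_simps)
  also have "\<dots> = (\<integral>\<^sup>+\<omega>. ?\<Phi> \<omega> * (\<integral>\<^sup>+y. g y \<partial>K h (X ?r \<omega>)) \<partial>P x)"
    by (rule markov_nn_integral[OF r h]) measurable
  also have "\<dots> = (\<integral>\<^sup>+\<omega>. (\<Prod>k<n. v (X (s + real k * h) \<omega>)) * nn_step v h g (X ?r \<omega>) \<partial>P x)"
    by (simp add: nn_step_def mult.assoc)
  also have "\<dots> = (\<integral>\<^sup>+y. (nn_step v h ^^ n) (nn_step v h g) y \<partial>K s x)"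
    by (rule Suc.IH) measurable
  finally show ?case by (simp add: funpow_swap1)
qed

end

section \<open>The semigroup on bounded and on square-integrable functions\<close>

text \<open>On this class the semigroup is linear and satisfies the semigroup law at every point,
  without exceptional null sets. Most of the analysis is carried out here and then extended to L2 by
  averaging or truncation.\<close>

definition bounded_borel :: "('x::topological_space \<Rightarrow> real) set" where
  "bounded_borel = {f \<in> borel_measurable borel. \<exists>B. \<forall>x. \<bar>f x\<bar> \<le> B}"

lemma bounded_borelI:
  "f \<in> borel_measurable borel \<Longrightarrow> (\<And>x. \<bar>f x\<bar> \<le> B) \<Longrightarrow> f \<in> bounded_borel"
  by (auto simp: bounded_borel_def)

lemma bounded_borel_measurable [measurable_dest]: "f \<in> bounded_borel \<Longrightarrow> f \<in> borel_measurable borel"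
  by (simp add: bounded_borel_def)

lemma bounded_borelD:
  assumes "f \<in> bounded_borel"
  shows "\<exists>B\<ge>0. \<forall>x. \<bar>f x\<bar> \<le> B"
proof -
  obtain B where B: "\<And>x. \<bar>f x\<bar> \<le> B" using assms by (auto simp: bounded_borel_def)
  moreover have "0 \<le> B" using B[of undefined] by (meson abs_ge_zero order_trans)
  ultimately show ?thesis by blast
qed

lemma bounded_borel_const [simp]: "(\<lambda>x. c) \<in> bounded_borel"
  by (rule bounded_borelI[of _ "\<bar>c\<bar>"]) auto

lemma bounded_borel_add:
  assumes "f \<in> bounded_borel" "g \<in> bounded_borel"
  shows "(\<lambda>x. f x + g x) \<in> bounded_borel"
proof -
  note [measurable] = assms
  obtain B C where "\<And>x. \<bar>f x\<bar> \<le> B" "\<And>x. \<bar>g x\<bar> \<le> C"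
    using assms[THEN bounded_borelD] by blast
  then have "\<bar>f x + g x\<bar> \<le> B + C" for x by (meson abs_triangle_ineq add_mono order_trans)
  then show ?thesis by (rule bounded_borelI[rotated]) measurable
qed

lemma bounded_borel_mult:
  assumes "f \<in> bounded_borel" "g \<in> bounded_borel"
  shows "(\<lambda>x. f x * g x) \<in> bounded_borel"
proof -
  note [measurable] = assms
  obtain B C where "0 \<le> B" "\<And>x. \<bar>f x\<bar> \<le> B" "\<And>x. \<bar>g x\<bar> \<le> C"
    using assms[THEN bounded_borelD] by blast
  then have "\<bar>f x * g x\<bar> \<le> B * C" for x by (simp add: abs_mult mult_mono)
  then show ?thesis by (rule bounded_borelI[rotated]) measurable
qed

lemma bounded_borel_scale: "f \<in> bounded_borel \<Longrightarrow> (\<lambda>x. c * f x) \<in> bounded_borel"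
  by (rule bounded_borel_mult) auto

lemma bounded_borel_uminus: "f \<in> bounded_borel \<Longrightarrow> (\<lambda>x. - f x) \<in> bounded_borel"
  using bounded_borel_scale[of f "-1"] by simp

lemma bounded_borel_diff:
  "f \<in> bounded_borel \<Longrightarrow> g \<in> bounded_borel \<Longrightarrow> (\<lambda>x. f x - g x) \<in> bounded_borel"
  using bounded_borel_add[OF _ bounded_borel_uminus[of g], of f] by simp

lemma bounded_borel_divide: "f \<in> bounded_borel \<Longrightarrow> (\<lambda>x. f x / c) \<in> bounded_borel"
  using bounded_borel_scale[of f "1 / c"] by simp

lemma bounded_borel_abs: "f \<in> bounded_borel \<Longrightarrow> (\<lambda>x. \<bar>f x\<bar>) \<in> bounded_borel"
  by (auto simp: bounded_borel_def)

lemma bounded_borel_power2: "f \<in> bounded_borel \<Longrightarrow> (\<lambda>x. (f x)\<^sup>2) \<in> bounded_borel"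
  using bounded_borel_mult[of f f] by (simp add: power2_eq_square)

lemma bounded_borel_indicator: "A \<in> sets borel \<Longrightarrow> indicator A \<in> bounded_borel"
  by (rule bounded_borelI[of _ 1]) (auto simp: indicator_def)

context markov_process
begin

lemma integrable_K: "f \<in> bounded_borel \<Longrightarrow> integrable (K t x) f"
proof -
  assume f: "f \<in> bounded_borel"
  note [measurable] = f
  interpret K: prob_space "K t x" by (rule prob_space_K)
  obtain B where "0 \<le> B" "\<And>x. \<bar>f x\<bar> \<le> B" using bounded_borelD[OF f] by blast
  then show ?thesis by (intro K.integrable_const_bound[of _ B]) auto
qed

lemma measurable_integral_K [measurable]:
  fixes f :: "'x \<Rightarrow> real"
  assumes [measurable]: "f \<in> borel_measurable borel"
  shows "(\<lambda>(t, x). \<integral>y. f y \<partial>K t x) \<in> borel_measurable (borel \<Otimes>\<^sub>M borel)"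
  using measurable_compose[OF measurable_prob_algebraD[OF measurable_K_pair]
      integral_measurable_subprob_algebra[OF assms]]
  by (simp add: case_prod_unfold)

lemma T_measurable_pair:
  assumes "f \<in> borel_measurable borel"
  shows "(\<lambda>(t, x). T (max 0 t) f x) \<in> borel_measurable (borel \<Otimes>\<^sub>M borel)"
proof -
  have "(\<lambda>p. (max (0::real) (fst p), snd p)) \<in> borel \<Otimes>\<^sub>M borel \<rightarrow>\<^sub>M borel \<Otimes>\<^sub>M (borel :: 'x measure)"
    by measurable
  from measurable_compose[OF this measurable_integral_K[OF assms]]
  show ?thesis by (simp add: T_eq_K assms case_prod_unfold)
qed

lemma T_measurable:
  assumes "0 \<le> t" "f \<in> borel_measurable borel"
  shows "T t f \<in> borel_measurable borel"
  using measurable_compose[OF measurable_Pair1'[of t borel borel] T_measurable_pair[OF assms(2)]] assms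
  by simp

lemma T_const: "0 \<le> t \<Longrightarrow> T t (\<lambda>x. c) x = c"
  using prob_space.prob_space[OF prob_space_K, of t x] by (simp add: T_eq_K)

lemma abs_T_le:
  assumes "0 \<le> t" and [measurable]: "f \<in> borel_measurable borel" and "\<And>x. \<bar>f x\<bar> \<le> B"
  shows "\<bar>T t f x\<bar> \<le> B"
proof -
  interpret K: prob_space "K t x" by (rule prob_space_K)
  have "integrable (K t x) f" using assms by (intro integrable_K bounded_borelI)
  then have "\<bar>\<integral>y. f y \<partial>K t x\<bar> \<le> (\<integral>y. B \<partial>K t x)"
    using assms(3) by (intro order_trans[OF integral_abs_bound] integral_mono) auto
  then show ?thesis using assms K.prob_space by (simp add: T_eq_K)
qed

lemma T_bounded_borel:
  assumes "0 \<le> t" "f \<in> bounded_borel"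
  shows "T t f \<in> bounded_borel"
proof -
  obtain B where B: "\<And>x. \<bar>f x\<bar> \<le> B" using bounded_borelD[OF assms(2)] by blast
  note fm = bounded_borel_measurable[OF assms(2)]
  have "\<bar>T t f x\<bar> \<le> B" for x by (rule abs_T_le[OF assms(1) fm B])
  then show ?thesis by (rule bounded_borelI[OF T_measurable[OF assms(1) fm]])
qed

lemma
  assumes "0 \<le> t" "f \<in> bounded_borel" "g \<in> bounded_borel"
  shows T_add: "T t (\<lambda>x. f x + g x) x = T t f x + T t g x"
    and T_diff: "T t (\<lambda>x. f x - g x) x = T t f x - T t g x"
  using assms
  by (simp_all add: T_eq_K bounded_borel_measurable integrable_K)

lemma T_scale:
  assumes "0 \<le> t" "f \<in> borel_measurable borel"
  shows "T t (\<lambda>x. c * f x) x = c * T t f x"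
  using assms by (simp add: T_eq_K)

lemma T_0:
  assumes "f \<in> borel_measurable borel"
  shows "T 0 f x = f x"
  using assms by (simp add: T_eq_K K_0 integral_return)

lemma T_T:
  assumes "0 \<le> s" "0 \<le> t" "f \<in> bounded_borel"
  shows "T s (T t f) x = T (s + t) f x"
proof -
  interpret K: prob_space "K s x" by (rule prob_space_K)
  note [measurable] = bounded_borel_measurable[OF assms(3)]
  obtain B where B: "0 \<le> B" "\<And>x. \<bar>f x\<bar> \<le> B" using bounded_borelD[OF assms(3)] by blast
  have "T (s + t) f x = (\<integral>y. f y \<partial>(K s x \<bind> K t))"
    using assms by (simp add: T_eq_K Chapman_Kolmogorov)
  also have "\<dots> = (\<integral>y. \<integral>z. f z \<partial>K t y \<partial>K s x)"
    by (rule integral_bind[where K=borel and B=B and B'=1])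
      (auto simp: B prob_space.emeasure_space_1[OF prob_space_K, unfolded space_K]
         K.finite_measure_axioms cong: measurable_cong_sets)
  also have "\<dots> = T s (T t f) x"
    using assms by (simp add: T_eq_K T_measurable)
  finally show ?thesis ..
qed

end

section \<open>Invariance of \<mu> and the semigroup on L2\<close>

context stationary_ergodic_markov_process
begin

lemma sets_mu' [measurable_cong, simp]: "sets \<mu> = sets borel"
  by (rule sets_mu)

lemma space_mu [simp]: "space \<mu> = UNIV"
  using sets_eq_imp_space_eq[OF sets_mu] by simp

lemma borel_measurable_mu [simp]: "borel_measurable \<mu> = borel_measurable borel"
  by (rule measurable_cong_sets) simp_all

lemma L2_borel: "f \<in> L2 \<mu> \<Longrightarrow> f \<in> borel_measurable borel"
  using L2_measurable[of f \<mu>] by simp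

lemma bounded_borel_L2:
  assumes "f \<in> bounded_borel"
  shows "f \<in> L2 \<mu>"
proof -
  obtain B where "0 \<le> B" "\<And>x. \<bar>f x\<bar> \<le> B" using bounded_borelD[OF assms] by blast
  then show ?thesis using bounded_borel_measurable[OF assms] by (intro L2_bounded[of _ B]) simp_all
qed

lemma bounded_borel_integrable: "f \<in> bounded_borel \<Longrightarrow> integrable \<mu> f"
  by (rule L2_integrable[OF bounded_borel_L2])

lemma measurable_K_mu: "K t \<in> \<mu> \<rightarrow>\<^sub>M subprob_algebra borel"
  using measurable_K by (simp cong: measurable_cong_sets)

lemma bind_K:
  assumes t: "0 \<le> t"
  shows "\<mu> \<bind> K t = \<mu>"
proof (rule measure_eqI)
  show "sets (\<mu> \<bind> K t) = sets \<mu>" by (subst sets_bind[where N=borel]) auto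
  fix A assume "A \<in> sets (\<mu> \<bind> K t)"
  then have A [measurable]: "A \<in> sets borel" by (subst (asm) sets_bind[where N=borel]) auto
  have [measurable]: "(\<lambda>x. measure (K t x) A) \<in> borel_measurable borel"
    using measurable_K A by measurable
  have "emeasure (\<mu> \<bind> K t) A = (\<integral>\<^sup>+x. emeasure (K t x) A \<partial>\<mu>)"
    by (rule emeasure_bind[where N=borel]) (auto intro: measurable_K_mu)
  also have "\<dots> = (\<integral>\<^sup>+x. ennreal (measure (K t x) A) \<partial>\<mu>)"
    by (intro nn_integral_cong finite_measure.emeasure_eq_measure prob_space.finite_measure prob_space_K)
  also have "\<dots> = ennreal (\<integral>x. measure (K t x) A \<partial>\<mu>)"
    by (intro nn_integral_eq_integral integrable_const_bound[of _ 1])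
      (auto intro: prob_space.prob_le_1 prob_space_K)
  also have "(\<integral>x. measure (K t x) A \<partial>\<mu>) = measure \<mu> A"
    using invariant[OF t A] emeasure_K[OF t A] by (simp add: measure_def)
  finally show "emeasure (\<mu> \<bind> K t) A = emeasure \<mu> A"
    by (simp add: emeasure_eq_measure)
qed

lemma nn_integral_invariant:
  assumes "0 \<le> t" "f \<in> borel_measurable borel"
  shows "(\<integral>\<^sup>+x. \<integral>\<^sup>+y. f y \<partial>K t x \<partial>\<mu>) = (\<integral>\<^sup>+x. f x \<partial>\<mu>)"
  using nn_integral_bind[OF assms(2) measurable_K_mu, of t] bind_K[OF assms(1)] by simp

text \<open>Invariance gives the statement for nonnegative functions, and f is split into its
  positive and negative parts. Integrability under the kernel holds only \<mu>-a.e.; elsewhere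
  \<open>T t f x\<close> takes the default value 0 of the integral, so linearity of
  \<open>T t\<close> can be used only a.e.\<close>

lemma
  assumes t: "0 \<le> t" and f: "integrable \<mu> f"
  shows AE_integrable_K: "AE x in \<mu>. integrable (K t x) f"
    and integrable_T: "integrable \<mu> (T t f)"
    and integral_T: "(\<integral>x. T t f x \<partial>\<mu>) = (\<integral>x. f x \<partial>\<mu>)"
proof -
  have [measurable]: "f \<in> borel_measurable borel" using borel_measurable_integrable[OF f] by simp
  have nn: "(\<integral>\<^sup>+x. \<integral>\<^sup>+y. ennreal (norm (g y)) \<partial>K t x \<partial>\<mu>) < \<infinity>" if "integrable \<mu> g" for g :: "'x \<Rightarrow> real"
  proof -
    have [measurable]: "g \<in> borel_measurable borel" using borel_measurable_integrable[OF that] by simp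
    show ?thesis
      using that nn_integral_invariant[OF t, of "\<lambda>y. ennreal (norm (g y))"]
      by (simp add: integrable_iff_bounded)
  qed
  have fin: "AE x in \<mu>. (\<integral>\<^sup>+y. ennreal (norm (f y)) \<partial>K t x) \<noteq> \<infinity>"
    using nn[OF f] by (intro nn_integral_PInf_AE) (auto simp: less_top)
  then show AE: "AE x in \<mu>. integrable (K t x) f"
    by eventually_elim (auto simp: integrable_iff_bounded less_top)
  have Tm [measurable]: "T t g \<in> borel_measurable borel" if "g \<in> borel_measurable borel" for g
    using T_measurable[OF t that] .
  have pos: "integrable \<mu> (T t g) \<and> (\<integral>x. T t g x \<partial>\<mu>) = (\<integral>x. g x \<partial>\<mu>)"
    if g: "integrable \<mu> g" and g0: "\<And>x. 0 \<le> g x" and AEg: "AE x in \<mu>. integrable (K t x) g" for g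
  proof -
    have [measurable]: "g \<in> borel_measurable borel" using borel_measurable_integrable[OF g] by simp
    have "(\<integral>\<^sup>+x. ennreal (T t g x) \<partial>\<mu>) = (\<integral>\<^sup>+x. \<integral>\<^sup>+y. ennreal (g y) \<partial>K t x \<partial>\<mu>)"
      using AEg by (intro nn_integral_cong_AE) (auto simp: T_eq_K t g0 nn_integral_eq_integral)
    also have "\<dots> = (\<integral>\<^sup>+x. ennreal (g x) \<partial>\<mu>)" by (rule nn_integral_invariant[OF t]) measurable
    also have "\<dots> = ennreal (\<integral>x. g x \<partial>\<mu>)" using g g0 by (simp add: nn_integral_eq_integral)
    finally have eq: "(\<integral>\<^sup>+x. ennreal (T t g x) \<partial>\<mu>) = ennreal (\<integral>x. g x \<partial>\<mu>)" .
    have T0: "0 \<le> T t g x" for x by (simp add: T_eq_K t g0)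
    have "integrable \<mu> (T t g)"
      using eq by (intro integrableI_nonneg) (auto simp: T0)
    moreover from this have "(\<integral>x. T t g x \<partial>\<mu>) = (\<integral>x. g x \<partial>\<mu>)"
      using eq g0 T0 by (simp add: nn_integral_eq_integral ennreal_inj)
    ultimately show ?thesis ..
  qed
  define fp fm where "fp = (\<lambda>x. max 0 (f x))" and "fm = (\<lambda>x. max 0 (- f x))"
  have p: "integrable \<mu> fp" "integrable \<mu> fm" using f by (auto simp: fp_def fm_def)
  have AEp: "AE x in \<mu>. integrable (K t x) fp" "AE x in \<mu>. integrable (K t x) fm"
    using AE by (eventually_elim, auto simp: fp_def fm_def)+
  have P: "integrable \<mu> (T t fp) \<and> (\<integral>x. T t fp x \<partial>\<mu>) = (\<integral>x. fp x \<partial>\<mu>)"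
    by (rule pos[OF p(1) _ AEp(1)]) (simp add: fp_def)
  have N: "integrable \<mu> (T t fm) \<and> (\<integral>x. T t fm x \<partial>\<mu>) = (\<integral>x. fm x \<partial>\<mu>)"
    by (rule pos[OF p(2) _ AEp(2)]) (simp add: fm_def)
  have [measurable]: "fp \<in> borel_measurable borel" "fm \<in> borel_measurable borel"
    by (simp_all add: fp_def fm_def)
  have fdec: "f = (\<lambda>x. fp x - fm x)" by (auto simp: fp_def fm_def)
  have Tdec: "AE x in \<mu>. T t fp x - T t fm x = T t f x"
    using AEp by eventually_elim (simp add: T_eq_K t, simp add: fdec)
  have "integrable \<mu> (\<lambda>x. T t fp x - T t fm x)" using P N by simp
  then show "integrable \<mu> (T t f)"
    using Tdec by (subst integrable_cong_AE[of _ _ "\<lambda>x. T t fp x - T t fm x"]) auto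
  have "(\<integral>x. T t f x \<partial>\<mu>) = (\<integral>x. T t fp x - T t fm x \<partial>\<mu>)"
    using Tdec by (intro integral_cong_AE) auto
  also have "\<dots> = (\<integral>x. fp x \<partial>\<mu>) - (\<integral>x. fm x \<partial>\<mu>)" using P N by simp
  also have "\<dots> = (\<integral>x. f x \<partial>\<mu>)" using p by (subst fdec) simp
  finally show "(\<integral>x. T t f x \<partial>\<mu>) = (\<integral>x. f x \<partial>\<mu>)" .
qed

lemma AE_L2_K:
  assumes "0 \<le> t" "f \<in> L2 \<mu>"
  shows "AE x in \<mu>. f \<in> L2 (K t x)"
proof -
  have "f \<in> borel_measurable borel" using assms L2_borel by auto
  then have "f \<in> borel_measurable (K t x)" for x by (simp cong: measurable_cong_sets)
  then show ?thesis
    using AE_integrable_K[OF assms(1) L2_square_integrable[OF assms(2)]] by (auto simp: L2_def)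
qed

text \<open>Jensen's inequality under each kernel gives (T t f)^2 \<le> T t (f^2) a.e., and the
  right side has the same integral as f^2 by invariance.\<close>

lemma
  assumes t: "0 \<le> t" and f: "f \<in> L2 \<mu>"
  shows T_L2: "T t f \<in> L2 \<mu>" and T_contraction: "L2_norm \<mu> (T t f) \<le> L2_norm \<mu> f"
proof -
  have fm [measurable]: "f \<in> borel_measurable borel" using f by (rule L2_borel)
  have Tm [measurable]: "T t f \<in> borel_measurable borel" "T t (\<lambda>x. (f x)\<^sup>2) \<in> borel_measurable borel"
    by (intro T_measurable t; measurable)+
  have f2: "integrable \<mu> (\<lambda>x. (f x)\<^sup>2)" using f by (rule L2_square_integrable)
  have le: "AE x in \<mu>. (T t f x)\<^sup>2 \<le> T t (\<lambda>x. (f x)\<^sup>2) x"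
    using AE_L2_K[OF t f]
  proof eventually_elim
    case (elim x)
    then show ?case
      using prob_space.integral_power2_le[OF prob_space_K elim] by (simp add: T_eq_K t)
  qed
  have int: "integrable \<mu> (\<lambda>x. (T t f x)\<^sup>2)"
    using le by (intro Bochner_Integration.integrable_bound[OF integrable_T[OF t f2]]) auto
  then show "T t f \<in> L2 \<mu>" by (simp add: L2_def)
  have "(\<integral>x. (T t f x)\<^sup>2 \<partial>\<mu>) \<le> (\<integral>x. T t (\<lambda>x. (f x)\<^sup>2) x \<partial>\<mu>)"
    using le int integrable_T[OF t f2] by (intro integral_mono_AE)
  also have "\<dots> = (\<integral>x. (f x)\<^sup>2 \<partial>\<mu>)" by (rule integral_T[OF t f2])
  finally show "L2_norm \<mu> (T t f) \<le> L2_norm \<mu> f" by (simp add: L2_norm_def)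
qed

lemma AE_T_linear:
  assumes t: "0 \<le> t" and f: "f \<in> L2 \<mu>" and g: "g \<in> L2 \<mu>"
  shows "AE x in \<mu>. T t (\<lambda>x. a * f x + b * g x) x = a * T t f x + b * T t g x"
  using AE_integrable_K[OF t L2_integrable[OF f]] AE_integrable_K[OF t L2_integrable[OF g]]
  by eventually_elim (simp add: T_eq_K t L2_borel f g)

text \<open>The Dirichlet form at a finite time: divided by t it tends to \<open>pre_form\<close> as
  t tends to 0. Unlike \<open>pre_form\<close> it makes sense for every f in L2, in particular for
  \<bar>f\<bar> and for truncations.\<close>

definition time_form :: "real \<Rightarrow> ('x \<Rightarrow> real) \<Rightarrow> real" where
  "time_form t f = L2_inner \<mu> (\<lambda>x. f x - T t f x) f"

lemma time_form_eq:
  assumes "0 \<le> t" "f \<in> L2 \<mu>"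
  shows "time_form t f = (L2_norm \<mu> f)\<^sup>2 - L2_inner \<mu> (T t f) f"
  using assms by (simp add: time_form_def L2_inner_diff T_L2 flip: L2_inner_self)

text \<open>By invariance \<open>time_form t f\<close> is half the mean of \<open>(f (X t) - f (X 0))\<^sup>2\<close>.\<close>

lemma time_form_contraction:
  assumes t: "0 \<le> t" and f: "f \<in> L2 \<mu>" and g: "g \<in> L2 \<mu>"
    and le: "\<And>x y. \<bar>f x - f y\<bar> \<le> \<bar>g x - g y\<bar>"
  shows "time_form t f \<le> time_form t g"
proof -
  \<comment> \<open>The integral of (f y - f x)^2 under \<open>K t x\<close> with the square
    expanded, so that each term is separately \<mu>-integrable and its mean is computed by
    invariance.\<close>
  define G where "G f x = T t (\<lambda>x. (f x)\<^sup>2) x - 2 * (T t f x * f x) + (f x)\<^sup>2" for f x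
  have G: "integrable \<mu> (G f)" "(\<integral>x. G f x \<partial>\<mu>) = 2 * time_form t f"
    "AE x in \<mu>. integrable (K t x) (\<lambda>y. (f y - f x)\<^sup>2) \<and> G f x = (\<integral>y. (f y - f x)\<^sup>2 \<partial>K t x)"
    if f: "f \<in> L2 \<mu>" for f
  proof -
    note i = integrable_T[OF t L2_square_integrable[OF f]] L2_square_integrable[OF f]
      L2_mult_integrable[OF T_L2[OF t f] f]
    show "integrable \<mu> (G f)" unfolding G_def[abs_def] using i by simp
    show "(\<integral>x. G f x \<partial>\<mu>) = 2 * time_form t f"
      using i integral_T[OF t L2_square_integrable[OF f]]
      by (simp add: G_def time_form_eq[OF t f] L2_norm_power2 L2_inner_def)
    have [measurable]: "f \<in> borel_measurable borel" using f by (rule L2_borel)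
    show "AE x in \<mu>. integrable (K t x) (\<lambda>y. (f y - f x)\<^sup>2) \<and> G f x = (\<integral>y. (f y - f x)\<^sup>2 \<partial>K t x)"
      using AE_L2_K[OF t f]
    proof eventually_elim
      case (elim x)
      interpret K: prob_space "K t x" by (rule prob_space_K)
      have "(f y - f x)\<^sup>2 = (f y)\<^sup>2 - 2 * f x * f y + (f x)\<^sup>2" for y
        by (simp add: power2_diff algebra_simps)
      moreover have "K.expectation (\<lambda>y. (f x)\<^sup>2) = (f x)\<^sup>2"
        using K.prob_space by simp
      ultimately show ?case
        using L2_square_integrable[OF elim] K.L2_integrable[OF elim]
        by (simp add: G_def T_eq_K t)
    qed
  qed
  have "AE x in \<mu>. G f x \<le> G g x"
    using G(3)[OF f] G(3)[OF g]
  proof eventually_elim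
    case (elim x)
    then show ?case
      using le by (auto intro!: integral_mono simp: abs_le_square_iff)
  qed
  then have "(\<integral>x. G f x \<partial>\<mu>) \<le> (\<integral>x. G g x \<partial>\<mu>)"
    using G(1)[OF f] G(1)[OF g] by (intro integral_mono_AE)
  then show ?thesis using G(2)[OF f] G(2)[OF g] by simp
qed

lemma time_form_nonneg: "0 \<le> t \<Longrightarrow> f \<in> L2 \<mu> \<Longrightarrow> 0 \<le> time_form t f"
  using time_form_contraction[of t "\<lambda>x. 0" f] L2_const[of 0] by (simp add: time_form_def L2_inner_def)

end

section \<open>The closed form\<close>

context stationary_ergodic_markov_process
begin

lemma generator_value_L2:
  assumes "is_generator_value \<mu> T g h"
  shows "g \<in> L2 \<mu>" "h \<in> L2 \<mu>"
  using assms by (auto simp: is_generator_value_def)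

lemma difference_quotient_L2: "0 \<le> t \<Longrightarrow> g \<in> L2 \<mu> \<Longrightarrow> (\<lambda>x. (T t g x - g x) / t) \<in> L2 \<mu>"
  by (intro L2_divide L2_diff T_L2)

lemma generator_value_unique:
  assumes g: "is_generator_value \<mu> T g h" and g': "is_generator_value \<mu> T g h'"
  shows "AE x in \<mu>. h x = h' x"
proof -
  note L2s = generator_value_L2[OF g] generator_value_L2[OF g']
  let ?N = "\<lambda>t h. L2_norm \<mu> (\<lambda>x. (T t g x - g x) / t - h x)"
  have "((\<lambda>t. ?N t h + ?N t h') \<longlongrightarrow> 0 + 0) (at_right 0)"
    using g g' by (intro tendsto_add) (simp_all add: is_generator_value_def)
  moreover have "\<forall>\<^sub>F t in at_right 0. L2_norm \<mu> (\<lambda>x. h x - h' x) \<le> ?N t h + ?N t h'"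
  proof (rule eventually_at_right_less[THEN eventually_mono])
    fix t :: real assume t: "0 < t"
    show "L2_norm \<mu> (\<lambda>x. h x - h' x) \<le> ?N t h + ?N t h'"
      using L2_norm_triangle3[OF L2s(2) difference_quotient_L2[OF less_imp_le[OF t] L2s(1)] L2s(4)]
      by (simp add: L2_norm_minus_commute[of \<mu> h])
  qed
  ultimately have "L2_norm \<mu> (\<lambda>x. h x - h' x) \<le> 0 + 0"
    by (rule tendsto_lowerbound) simp
  then have "L2_norm \<mu> (\<lambda>x. h x - h' x) = 0"
    using L2_norm_nonneg[of \<mu> "\<lambda>x. h x - h' x"] by linarith
  then show ?thesis using L2_norm_eq_0_iff[OF L2_diff[OF L2s(2,4)]] by simp
qed

lemma gen_domain_L2: "g \<in> gen_domain \<mu> T \<Longrightarrow> g \<in> L2 \<mu>"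
  by (auto simp: gen_domain_def is_generator_value_def)

lemma generator_value_generator:
  "g \<in> gen_domain \<mu> T \<Longrightarrow> is_generator_value \<mu> T g (generator \<mu> T g)"
  using someI_ex[of "is_generator_value \<mu> T g"] by (simp add: gen_domain_def generator_def)

text \<open>\<open>generator\<close> picks an arbitrary representative; by uniqueness up to null
  sets any known value h of the generator may be used instead.\<close>

lemma pre_form_eq:
  assumes g: "is_generator_value \<mu> T g h"
  shows "pre_form \<mu> T g = - L2_inner \<mu> h g"
proof -
  have g': "is_generator_value \<mu> T g (generator \<mu> T g)"
    using g by (intro generator_value_generator) (auto simp: gen_domain_def)
  note L2s = generator_value_L2[OF g] generator_value_L2[OF g']
  show ?thesis
    unfolding pre_form_def L2_inner_uminus
    using L2_inner_cong_AE[OF L2_measurable[OF L2s(4)] L2_measurable[OF L2s(2)] L2_measurable[OF L2s(1)]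
        generator_value_unique[OF g' g]]
    by simp
qed

text \<open>By Cauchy-Schwarz the error is at most the L2 error of the difference quotient times the
  norm of g. Nonnegativity of the form, and later the spectral gap, pass from finite times to the
  generator through this limit.\<close>

lemma pre_form_tendsto:
  assumes "g \<in> gen_domain \<mu> T"
  shows "((\<lambda>t. time_form t g / t) \<longlongrightarrow> pre_form \<mu> T g) (at_right 0)"
proof -
  obtain h where h: "is_generator_value \<mu> T g h" using assms by (auto simp: gen_domain_def)
  note L2s = generator_value_L2[OF h]
  let ?D = "\<lambda>t x. (T t g x - g x) / t - h x"
  have "((\<lambda>t. L2_norm \<mu> (?D t) * L2_norm \<mu> g) \<longlongrightarrow> 0 * L2_norm \<mu> g) (at_right 0)"
    using h by (intro tendsto_mult) (simp_all add: is_generator_value_def)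
  then have lim: "((\<lambda>t. L2_norm \<mu> (?D t) * L2_norm \<mu> g) \<longlongrightarrow> 0) (at_right 0)" by simp
  have "((\<lambda>t. time_form t g / t - pre_form \<mu> T g) \<longlongrightarrow> 0) (at_right 0)"
  proof (rule Lim_null_comparison[OF _ lim], rule eventually_at_right_less[THEN eventually_mono])
    fix t :: real assume t: "0 < t"
    have q: "(\<lambda>x. (T t g x - g x) / t) \<in> L2 \<mu>" using t L2s by (intro difference_quotient_L2) auto
    have "L2_inner \<mu> (\<lambda>x. (T t g x - g x) / t) g = - (time_form t g / t)"
      using L2_inner_scale[of \<mu> "- 1 / t" "\<lambda>x. g x - T t g x" g]
      by (simp add: time_form_def minus_divide_left[symmetric] diff_divide_distrib)
    then have "time_form t g / t - pre_form \<mu> T g = - L2_inner \<mu> (?D t) g"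
      using L2_inner_diff[OF q L2s(2) L2s(1)] by (simp add: pre_form_eq[OF h])
    then show "norm (time_form t g / t - pre_form \<mu> T g) \<le> L2_norm \<mu> (?D t) * L2_norm \<mu> g"
      using L2_Cauchy_Schwarz[OF L2_diff[OF q L2s(2)] L2s(1)] by simp
  qed
  then show ?thesis by (rule LIM_zero_cancel)
qed

lemma pre_form_nonneg:
  assumes "g \<in> gen_domain \<mu> T"
  shows "0 \<le> pre_form \<mu> T g"
proof (rule tendsto_lowerbound[OF pre_form_tendsto[OF assms]])
  show "\<forall>\<^sub>F t in at_right 0. 0 \<le> time_form t g / t"
    by (rule eventually_at_right_less[THEN eventually_mono])
      (simp add: time_form_nonneg gen_domain_L2[OF assms])
qed simp

text \<open>On L2 the operator \<open>T t\<close> is linear only up to a null set depending on t, so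
  the difference quotients are compared in norm rather than pointwise.\<close>

lemma generator_value_linear:
  assumes g: "is_generator_value \<mu> T g h" and g': "is_generator_value \<mu> T g' h'"
  shows "is_generator_value \<mu> T (\<lambda>x. a * g x + b * g' x) (\<lambda>x. a * h x + b * h' x)"
  unfolding is_generator_value_def
proof (intro conjI)
  note L2s = generator_value_L2[OF g] generator_value_L2[OF g']
  let ?g = "\<lambda>x. a * g x + b * g' x" and ?h = "\<lambda>x. a * h x + b * h' x"
  show gL: "?g \<in> L2 \<mu>" and hL: "?h \<in> L2 \<mu>" using L2s by (auto intro: L2_add L2_scale)
  let ?D = "\<lambda>t g h x. (T t g x - g x) / t - h x"
  have lim: "((\<lambda>t. \<bar>a\<bar> * L2_norm \<mu> (?D t g h) + \<bar>b\<bar> * L2_norm \<mu> (?D t g' h')) \<longlongrightarrow> 0) (at_right 0)"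
    using g g' by (auto simp: is_generator_value_def intro!: tendsto_eq_intros)
  show "((\<lambda>t. L2_norm \<mu> (?D t ?g ?h)) \<longlongrightarrow> 0) (at_right 0)"
  proof (rule Lim_null_comparison[OF _ lim], rule eventually_at_right_less[THEN eventually_mono])
    fix t :: real assume t: "0 < t"
    have D: "?D t g h \<in> L2 \<mu>" if "g \<in> L2 \<mu>" "h \<in> L2 \<mu>" for g h
      using t that by (intro L2_diff[OF difference_quotient_L2]) auto
    have "AE x in \<mu>. ?D t ?g ?h x = a * ?D t g h x + b * ?D t g' h' x"
      using AE_T_linear[OF less_imp_le[OF t] L2s(1,3), of a b]
      by eventually_elim (simp add: diff_divide_distrib add_divide_distrib algebra_simps)
    then have "L2_norm \<mu> (?D t ?g ?h) = L2_norm \<mu> (\<lambda>x. a * ?D t g h x + b * ?D t g' h' x)"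
      by (intro L2_norm_cong_AE L2_measurable[OF D[OF gL hL]]
          L2_measurable[OF L2_add[OF L2_scale[OF D[OF L2s(1,2)]] L2_scale[OF D[OF L2s(3,4)]]]])
    then show "norm (L2_norm \<mu> (?D t ?g ?h)) \<le> \<bar>a\<bar> * L2_norm \<mu> (?D t g h) + \<bar>b\<bar> * L2_norm \<mu> (?D t g' h')"
      using L2_norm_triangle[OF L2_scale[OF D[OF L2s(1,2)], of a] L2_scale[OF D[OF L2s(3,4)], of b]]
      by (simp only: L2_norm_scale real_norm_def abs_of_nonneg L2_norm_nonneg)
  qed
qed

lemma gen_domain_linear:
  assumes "f \<in> gen_domain \<mu> T" "g \<in> gen_domain \<mu> T"
  shows "(\<lambda>x. a * f x + b * g x) \<in> gen_domain \<mu> T"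
  using assms generator_value_linear unfolding gen_domain_def by blast

lemma gen_domain_diff:
  "f \<in> gen_domain \<mu> T \<Longrightarrow> g \<in> gen_domain \<mu> T \<Longrightarrow> (\<lambda>x. f x - g x) \<in> gen_domain \<mu> T"
  using gen_domain_linear[of f g 1 "-1"] by simp

lemma
  assumes "f \<in> gen_domain \<mu> T"
  shows gen_domain_scale: "(\<lambda>x. c * f x) \<in> gen_domain \<mu> T"
    and pre_form_scale: "pre_form \<mu> T (\<lambda>x. c * f x) = c\<^sup>2 * pre_form \<mu> T f"
proof -
  obtain h where h: "is_generator_value \<mu> T f h" using assms by (auto simp: gen_domain_def)
  have ch: "is_generator_value \<mu> T (\<lambda>x. c * f x) (\<lambda>x. c * h x)"
    using generator_value_linear[OF h h, of c 0] by simp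
  then show "(\<lambda>x. c * f x) \<in> gen_domain \<mu> T" by (auto simp: gen_domain_def)
  show "pre_form \<mu> T (\<lambda>x. c * f x) = c\<^sup>2 * pre_form \<mu> T f"
    using L2_inner_scale[of \<mu> c f h]
    by (simp add: pre_form_eq[OF ch] pre_form_eq[OF h] L2_inner_scale L2_inner_commute[of \<mu> h] power2_eq_square)
qed

text \<open>Without symmetry the polarisation of the form consists of two different products; b
  collects both, and nonnegativity of the form along f + s g is all that the quadratic lemma asks
  for.\<close>

lemma pre_form_triangle:
  assumes f: "f \<in> gen_domain \<mu> T" and g: "g \<in> gen_domain \<mu> T"
  shows "sqrt (pre_form \<mu> T (\<lambda>x. f x + g x)) \<le> sqrt (pre_form \<mu> T f) + sqrt (pre_form \<mu> T g)"
proof -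
  obtain h where h: "is_generator_value \<mu> T f h" using f by (auto simp: gen_domain_def)
  obtain k where k: "is_generator_value \<mu> T g k" using g by (auto simp: gen_domain_def)
  note L2s = generator_value_L2[OF h] generator_value_L2[OF k]
  define b where "b = - (L2_inner \<mu> h g + L2_inner \<mu> k f)"
  have eq: "pre_form \<mu> T (\<lambda>x. f x + s * g x) = pre_form \<mu> T f + s * b + s\<^sup>2 * pre_form \<mu> T g" for s
  proof -
    have "is_generator_value \<mu> T (\<lambda>x. f x + s * g x) (\<lambda>x. h x + s * k x)"
      using generator_value_linear[OF h k, of 1 s] by simp
    then have "pre_form \<mu> T (\<lambda>x. f x + s * g x) = - L2_inner \<mu> (\<lambda>x. h x + s * k x) (\<lambda>x. f x + s * g x)"
      by (rule pre_form_eq)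
    also have "\<dots> = - (L2_inner \<mu> h f + s * L2_inner \<mu> h g + s * L2_inner \<mu> k f + s * s * L2_inner \<mu> k g)"
      using L2s by (simp add: L2_inner_add L2_inner_add_right L2_scale L2_add L2_inner_scale
          L2_inner_scale[of \<mu> s g, unfolded L2_inner_commute[of \<mu> _ h]] L2_inner_commute[of \<mu> _ "\<lambda>x. s * g x"]
          L2_inner_commute[of \<mu> g] algebra_simps)
    finally show ?thesis
      by (simp add: pre_form_eq[OF h] pre_form_eq[OF k] b_def power2_eq_square algebra_simps)
  qed
  have "0 \<le> pre_form \<mu> T f + s * b + s\<^sup>2 * pre_form \<mu> T g" for s
    using pre_form_nonneg[OF gen_domain_linear[OF f g, of 1 s]] by (simp add: eq)
  from sqrt_triangle_of_nonneg_quadratic(2)[OF this] show ?thesis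
    using eq[of 1] by simp
qed

lemma pre_form_minus_commute:
  assumes "f \<in> gen_domain \<mu> T" "g \<in> gen_domain \<mu> T"
  shows "pre_form \<mu> T (\<lambda>x. f x - g x) = pre_form \<mu> T (\<lambda>x. g x - f x)"
  using pre_form_scale[OF gen_domain_diff[OF assms], of "-1"] by simp

lemma abs_sqrt_pre_form_diff_le:
  assumes f: "f \<in> gen_domain \<mu> T" and g: "g \<in> gen_domain \<mu> T"
  shows "\<bar>sqrt (pre_form \<mu> T f) - sqrt (pre_form \<mu> T g)\<bar> \<le> sqrt (pre_form \<mu> T (\<lambda>x. f x - g x))"
  using pre_form_triangle[OF gen_domain_diff[OF f g] g] pre_form_triangle[OF gen_domain_diff[OF g f] f]
  by (simp add: pre_form_minus_commute[OF f g] abs_le_iff)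

section \<open>The closure of the form is well defined\<close>

lemma form_Cauchy_D:
  assumes "form_Cauchy \<mu> T g"
  shows "g n \<in> gen_domain \<mu> T"
    and "0 < e \<Longrightarrow> \<exists>N. \<forall>n\<ge>N. \<forall>m\<ge>N. pre_form \<mu> T (\<lambda>x. g n x - g m x) < e"
  using assms by (auto simp: form_Cauchy_def)

lemma form_Cauchy_sqrt:
  assumes "form_Cauchy \<mu> T g" "0 < e"
  shows "\<exists>N. \<forall>n\<ge>N. \<forall>m\<ge>N. sqrt (pre_form \<mu> T (\<lambda>x. g n x - g m x)) < e"
proof -
  obtain N where "\<forall>n\<ge>N. \<forall>m\<ge>N. pre_form \<mu> T (\<lambda>x. g n x - g m x) < e\<^sup>2"
    using form_Cauchy_D(2)[OF assms(1), of "e\<^sup>2"] assms(2) by auto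
  then show ?thesis using assms(2) by (intro exI[of _ N]) (auto intro!: real_less_lsqrt)
qed

text \<open>Closability speaks of a single sequence with limit 0. Comparing two approximations of
  the same function requires it for their difference, whose Cauchy property follows from the
  triangle inequality for the square root of the form.\<close>

lemma form_Cauchy_diff:
  assumes g: "form_Cauchy \<mu> T g" and k: "form_Cauchy \<mu> T k"
  shows "form_Cauchy \<mu> T (\<lambda>n x. g n x - k n x)"
  unfolding form_Cauchy_def
proof (intro conjI allI impI)
  fix n show "(\<lambda>x. g n x - k n x) \<in> gen_domain \<mu> T"
    by (intro gen_domain_diff form_Cauchy_D(1) g k)
next
  fix e :: real assume e: "0 < e"
  define d where "d = sqrt e / 2"
  have d: "0 < d" using e by (simp add: d_def)
  obtain N where N: "\<forall>n\<ge>N. \<forall>m\<ge>N. sqrt (pre_form \<mu> T (\<lambda>x. g n x - g m x)) < d"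
    using form_Cauchy_sqrt[OF g d] by blast
  obtain M where M: "\<forall>n\<ge>M. \<forall>m\<ge>M. sqrt (pre_form \<mu> T (\<lambda>x. k n x - k m x)) < d"
    using form_Cauchy_sqrt[OF k d] by blast
  show "\<exists>N. \<forall>n\<ge>N. \<forall>m\<ge>N. pre_form \<mu> T (\<lambda>x. g n x - k n x - (g m x - k m x)) < e"
  proof (intro exI[of _ "max N M"] allI impI)
    fix n m assume nm: "max N M \<le> n" "max N M \<le> m"
    note [simp] = form_Cauchy_D(1)[OF g] form_Cauchy_D(1)[OF k]
    have "sqrt (pre_form \<mu> T (\<lambda>x. (g n x - g m x) + (k m x - k n x)))
        \<le> sqrt (pre_form \<mu> T (\<lambda>x. g n x - g m x)) + sqrt (pre_form \<mu> T (\<lambda>x. k m x - k n x))"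
      by (intro pre_form_triangle gen_domain_diff) simp_all
    also have "\<dots> < d + d" using N M nm by (intro add_strict_mono) auto
    also have "\<dots> = sqrt e" by (simp add: d_def)
    also have "(\<lambda>x. (g n x - g m x) + (k m x - k n x)) = (\<lambda>x. g n x - k n x - (g m x - k m x))" by auto
    finally show "pre_form \<mu> T (\<lambda>x. g n x - k n x - (g m x - k m x)) < e" by simp
  qed
qed

text \<open>The difference of the two approximations is form-Cauchy and tends to 0 in L2, so
  closability sends its form to 0; the square roots of the two forms then have the same limit. This
  gives the uniqueness behind THE in \<open>dirichlet_form\<close>.\<close>

lemma dirichlet_form_unique:
  assumes g: "form_approx \<mu> T g f" and k: "form_approx \<mu> T k f" and f: "f \<in> L2 \<mu>"
    and e: "(\<lambda>n. pre_form \<mu> T (g n)) \<longlonglongrightarrow> e" and d: "(\<lambda>n. pre_form \<mu> T (k n)) \<longlonglongrightarrow> d"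
  shows "e = d"
proof -
  have gC: "form_Cauchy \<mu> T g" and kC: "form_Cauchy \<mu> T k" using g k by (auto simp: form_approx_def)
  note dom = form_Cauchy_D(1)[OF gC] form_Cauchy_D(1)[OF kC]
  have lim: "(\<lambda>n. L2_norm \<mu> (\<lambda>x. g n x - f x) + L2_norm \<mu> (\<lambda>x. k n x - f x)) \<longlonglongrightarrow> 0"
    using tendsto_add[of _ 0 _ _ 0] g k by (auto simp: form_approx_def)
  have "(\<lambda>n. L2_norm \<mu> (\<lambda>x. g n x - k n x)) \<longlonglongrightarrow> 0"
  proof (rule Lim_null_comparison[OF _ lim], rule always_eventually, rule allI)
    fix n
    show "norm (L2_norm \<mu> (\<lambda>x. g n x - k n x))
        \<le> L2_norm \<mu> (\<lambda>x. g n x - f x) + L2_norm \<mu> (\<lambda>x. k n x - f x)"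
      using L2_norm_triangle3[OF gen_domain_L2[OF dom(1)] f gen_domain_L2[OF dom(2)], of n n]
      by (simp add: L2_norm_minus_commute[of \<mu> f])
  qed
  then have "(\<lambda>n. pre_form \<mu> T (\<lambda>x. g n x - k n x)) \<longlonglongrightarrow> 0"
    using closable form_Cauchy_diff[OF gC kC] unfolding closable_form_def by blast
  then have "(\<lambda>n. sqrt (pre_form \<mu> T (\<lambda>x. g n x - k n x))) \<longlonglongrightarrow> sqrt 0"
    by (rule tendsto_real_sqrt)
  then have null: "(\<lambda>n. sqrt (pre_form \<mu> T (\<lambda>x. g n x - k n x))) \<longlonglongrightarrow> 0" by simp
  have "(\<lambda>n. sqrt (pre_form \<mu> T (g n)) - sqrt (pre_form \<mu> T (k n))) \<longlonglongrightarrow> 0"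
    by (rule Lim_null_comparison[OF _ null]) (simp add: abs_sqrt_pre_form_diff_le dom)
  moreover have "(\<lambda>n. sqrt (pre_form \<mu> T (g n)) - sqrt (pre_form \<mu> T (k n))) \<longlonglongrightarrow> sqrt e - sqrt d"
    by (intro tendsto_intros e d)
  ultimately have "sqrt e = sqrt d" using LIMSEQ_unique by fastforce
  then show ?thesis by simp
qed

lemma dirichlet_form_eq:
  assumes "form_approx \<mu> T g f" "f \<in> L2 \<mu>" "(\<lambda>n. pre_form \<mu> T (g n)) \<longlonglongrightarrow> e"
  shows "dirichlet_form \<mu> T f = e"
  unfolding dirichlet_form_def using assms dirichlet_form_unique by blast

text \<open>Existence of the limit: the square root of the form is a seminorm, so its values along a
  form-Cauchy sequence form a Cauchy sequence of reals.\<close>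

lemma form_domain_limit:
  assumes "f \<in> form_domain \<mu> T"
  obtains g where "form_approx \<mu> T g f" "(\<lambda>n. pre_form \<mu> T (g n)) \<longlonglongrightarrow> dirichlet_form \<mu> T f"
proof -
  obtain g where g: "form_approx \<mu> T g f" and f: "f \<in> L2 \<mu>"
    using assms by (auto simp: form_domain_def)
  have gC: "form_Cauchy \<mu> T g" using g by (simp add: form_approx_def)
  note dom = form_Cauchy_D(1)[OF gC]
  have "Cauchy (\<lambda>n. sqrt (pre_form \<mu> T (g n)))"
  proof (rule metric_CauchyI)
    fix e :: real assume "0 < e"
    from form_Cauchy_sqrt[OF gC this]
    obtain N where "\<forall>n\<ge>N. \<forall>m\<ge>N. sqrt (pre_form \<mu> T (\<lambda>x. g n x - g m x)) < e" ..
    then show "\<exists>N. \<forall>m\<ge>N. \<forall>n\<ge>N. dist (sqrt (pre_form \<mu> T (g m))) (sqrt (pre_form \<mu> T (g n))) < e"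
      unfolding dist_real_def
      by (intro exI[of _ N] allI impI order_le_less_trans[OF abs_sqrt_pre_form_diff_le[OF dom dom]]) blast
  qed
  then obtain l where "(\<lambda>n. sqrt (pre_form \<mu> T (g n))) \<longlonglongrightarrow> l"
    using Cauchy_convergent convergent_def by blast
  then have "(\<lambda>n. (sqrt (pre_form \<mu> T (g n)))\<^sup>2) \<longlonglongrightarrow> l\<^sup>2" by (rule tendsto_power)
  then have "(\<lambda>n. pre_form \<mu> T (g n)) \<longlonglongrightarrow> l\<^sup>2" by (simp add: pre_form_nonneg dom)
  with dirichlet_form_eq[OF g f this] g show thesis by (intro that) auto
qed

text \<open>The constant sequence g approximates f. Equality is asked only a.e. because f will be
  the square root of a Radon-Nikodym derivative, which is determined only up to null sets.\<close>

lemma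
  assumes g: "g \<in> gen_domain \<mu> T" and f: "f \<in> L2 \<mu>" and eq: "AE x in \<mu>. g x = f x"
  shows form_domain_of_gen_domain: "f \<in> form_domain \<mu> T"
    and dirichlet_form_of_gen_domain: "dirichlet_form \<mu> T f = pre_form \<mu> T g"
proof -
  have "L2_norm \<mu> (\<lambda>x. g x - f x) = 0"
    using L2_norm_eq_0_iff[OF L2_diff[OF gen_domain_L2[OF g] f]] eq by auto
  moreover have "form_Cauchy \<mu> T (\<lambda>n. g)"
    using pre_form_scale[OF g, of 0] g by (auto simp: form_Cauchy_def)
  ultimately have a: "form_approx \<mu> T (\<lambda>n. g) f" by (simp add: form_approx_def)
  then show "f \<in> form_domain \<mu> T" using f by (auto simp: form_domain_def)
  show "dirichlet_form \<mu> T f = pre_form \<mu> T g" by (rule dirichlet_form_eq[OF a f]) simp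
qed

lemma poincare_form_domain:
  assumes "poincare \<mu> T c" "f \<in> form_domain \<mu> T"
  shows "Var \<mu> f \<le> c * dirichlet_form \<mu> T f"
proof -
  obtain g where g: "form_approx \<mu> T g f" "(\<lambda>n. pre_form \<mu> T (g n)) \<longlonglongrightarrow> dirichlet_form \<mu> T f"
    using form_domain_limit[OF assms(2)] by blast
  have f: "f \<in> L2 \<mu>" using assms by (simp add: form_domain_def)
  have dom: "g n \<in> gen_domain \<mu> T" for n using g(1) by (auto simp: form_approx_def form_Cauchy_def)
  have "(\<lambda>n. Var \<mu> (g n)) \<longlonglongrightarrow> Var \<mu> f"
    using g(1) by (intro Var_tendsto gen_domain_L2 dom f) (simp add: form_approx_def)
  moreover have "(\<lambda>n. c * pre_form \<mu> T (g n)) \<longlonglongrightarrow> c * dirichlet_form \<mu> T f"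
    by (intro tendsto_intros g(2))
  ultimately show ?thesis
    by (rule LIMSEQ_le) (use assms(1) dom in \<open>auto simp: poincare_def\<close>)
qed

end

section \<open>Time averages of the semigroup\<close>

text \<open>The uniform law on [0, e). As a probability measure it makes Jensen's inequality and
  Fubini's theorem directly applicable to time averages; half-open intervals tile the line without
  overlap.\<close>

definition unif :: "real \<Rightarrow> real measure" where
  "unif e = density lborel (\<lambda>s. ennreal (indicator {0..<e} s / e))"

lemma sets_unif [measurable_cong, simp]: "sets (unif e) = sets borel"
  and space_unif [simp]: "space (unif e) = UNIV"
  by (simp_all add: unif_def)

lemma borel_measurable_unif [simp]: "borel_measurable (unif e) = borel_measurable borel"
  by (rule measurable_cong_sets) simp_all

lemma nn_integral_unif:
  assumes "0 < e" and [measurable]: "f \<in> borel_measurable borel"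
  shows "(\<integral>\<^sup>+s. f s \<partial>unif e) = (\<integral>\<^sup>+s. ennreal (indicator {0..<e} s / e) * f s \<partial>lborel)"
  unfolding unif_def by (rule nn_integral_density) measurable

lemma prob_space_unif:
  assumes "0 < e"
  shows "prob_space (unif e)"
proof (rule prob_spaceI)
  have "emeasure (unif e) (space (unif e)) = (\<integral>\<^sup>+s. ennreal (1 / e) * indicator {0..<e} s \<partial>lborel)"
    using assms by (auto simp: unif_def emeasure_density indicator_def intro!: nn_integral_cong)
  also have "\<dots> = ennreal (1 / e) * ennreal e"
    using assms by (simp add: nn_integral_cmult)
  also have "\<dots> = 1" using assms by (simp flip: ennreal_mult)
  finally show "emeasure (unif e) (space (unif e)) = 1" .
qed

lemma AE_unif: "0 < e \<Longrightarrow> AE s in unif e. 0 \<le> s \<and> s < e"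
  unfolding unif_def by (subst AE_density) (auto simp: indicator_def)

lemma integral_unif:
  fixes f :: "real \<Rightarrow> real"
  assumes "0 < e" and [measurable]: "f \<in> borel_measurable borel"
  shows "(\<integral>s. f s \<partial>unif e) = (\<integral>s. indicator {0..<e} s * f s \<partial>lborel) / e"
proof -
  have "(\<integral>s. f s \<partial>unif e) = (\<integral>s. (indicator {0..<e} s / e) *\<^sub>R f s \<partial>lborel)"
    unfolding unif_def using assms by (intro integral_density) auto
  then show ?thesis by simp
qed

lemma integrable_indicator_mult:
  fixes f :: "real \<Rightarrow> real"
  assumes [measurable]: "f \<in> borel_measurable borel" and B: "\<And>s. \<bar>f s\<bar> \<le> B"
  shows "integrable lborel (\<lambda>s. indicator {a..<b} s * f s)"
proof (rule Bochner_Integration.integrable_bound)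
  have "0 \<le> B" using B[of 0] by linarith
  show "integrable lborel (\<lambda>s. B * indicator {a..<b} s)" by (cases "a \<le> b") auto
  show "AE s in lborel. norm (indicator {a..<b} s * f s) \<le> norm (B * indicator {a..<b} s)"
    using B \<open>0 \<le> B\<close> by (auto simp: indicator_def)
qed measurable

lemma integral_unif_shift:
  fixes f :: "real \<Rightarrow> real"
  assumes "0 < b" and [measurable]: "f \<in> borel_measurable borel"
  shows "(\<integral>s. f (a + s) \<partial>unif b) = (\<integral>s. indicator {a..<a + b} s * f s \<partial>lborel) / b"
proof -
  have "(\<integral>s. indicator {a..<a + b} s * f s \<partial>lborel) = (\<integral>s. indicator {a..<a + b} (a + s) * f (a + s) \<partial>lborel)"
    using lborel_integral_real_affine[of 1 "\<lambda>s. indicator {a..<a + b} s * f s" a] by simp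
  also have "\<dots> = (\<integral>s. indicator {0..<b} s * f (a + s) \<partial>lborel)"
    by (intro Bochner_Integration.integral_cong) (auto simp: indicator_def)
  finally show ?thesis using assms(1) by (simp add: integral_unif)
qed

lemma integral_indicator_append:
  fixes f :: "real \<Rightarrow> real"
  assumes "a \<le> b" "b \<le> c" "f \<in> borel_measurable borel" "\<And>s. \<bar>f s\<bar> \<le> B"
  shows "(\<integral>s. indicator {a..<b} s * f s \<partial>lborel) + (\<integral>s. indicator {b..<c} s * f s \<partial>lborel)
    = (\<integral>s. indicator {a..<c} s * f s \<partial>lborel)"
proof -
  have "(\<integral>s. indicator {a..<c} s * f s \<partial>lborel) = (\<integral>s. indicator {a..<b} s * f s + indicator {b..<c} s * f s \<partial>lborel)"
    using assms(1,2) by (intro Bochner_Integration.integral_cong) (auto simp: indicator_def)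
  then show ?thesis
    using integrable_indicator_mult[OF assms(3,4)] by simp
qed

text \<open>With J the integral over an interval, J t (t + e) - J 0 e = J e (e + t) - J 0 t, since
  adding J 0 t + J 0 e to either side gives J 0 (t + e) + J 0 t. Thus a difference over t of
  averages over e is a difference over e of averages over t, up to the same factor 1 / (e
  t).\<close>

lemma unif_shift_exchange:
  fixes f :: "real \<Rightarrow> real"
  assumes t: "0 < t" and e: "0 < e" and f: "f \<in> borel_measurable borel" and B: "\<And>s. \<bar>f s\<bar> \<le> B"
  shows "((\<integral>s. f (t + s) \<partial>unif e) - (\<integral>s. f s \<partial>unif e)) / t
    = ((\<integral>s. f (e + s) \<partial>unif t) - (\<integral>s. f s \<partial>unif t)) / e"
proof -
  define J where "J a b = (\<integral>s. indicator {a..<b} s * f s \<partial>lborel)" for a b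
  note shift = integral_unif_shift[OF _ f, folded J_def]
  have add: "J 0 a + J a (a + b) = J 0 (a + b)" if "0 < a" "0 < b" for a b
    unfolding J_def using that by (intro integral_indicator_append[OF _ _ f B]) auto
  have eq: "J t (t + e) - J 0 e = J e (e + t) - J 0 t"
    using add[OF t e] add[OF e t] by (simp add: add.commute)
  have "(J t (t + e) / e - J 0 e / e) / t = (J t (t + e) - J 0 e) / (e * t)"
    "(J e (e + t) / t - J 0 t / t) / e = (J e (e + t) - J 0 t) / (e * t)"
    by (simp_all add: diff_divide_distrib[symmetric] mult.commute)
  then show ?thesis
    using shift[OF e, of t] shift[OF e, of 0] shift[OF t, of e] shift[OF t, of 0]
    by (simp add: eq)
qed

lemma prob_Fubini:
  fixes H :: "'a \<Rightarrow> 'b \<Rightarrow> real"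
  assumes "prob_space M" "prob_space N"
    and H: "(\<lambda>(x, y). H x y) \<in> borel_measurable (M \<Otimes>\<^sub>M N)" and B: "\<And>x y. \<bar>H x y\<bar> \<le> B"
  shows "(\<integral>y. \<integral>x. H x y \<partial>M \<partial>N) = (\<integral>x. \<integral>y. H x y \<partial>N \<partial>M)"
proof -
  interpret M: prob_space M by fact
  interpret N: prob_space N by fact
  interpret pair_prob_space M N ..
  have "integrable (M \<Otimes>\<^sub>M N) (case_prod H)"
    using H B by (intro P.integrable_const_bound[of _ B]) auto
  then show ?thesis by (rule Fubini_integral)
qed

lemma abs_prob_integral_le:
  fixes f :: "'a \<Rightarrow> real"
  assumes "prob_space M" "f \<in> borel_measurable M" "\<And>x. \<bar>f x\<bar> \<le> B"
  shows "\<bar>\<integral>x. f x \<partial>M\<bar> \<le> B"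
proof -
  interpret prob_space M by fact
  have "integrable M f" using assms by (intro integrable_const_bound[of _ B]) auto
  then have "\<bar>\<integral>x. f x \<partial>M\<bar> \<le> (\<integral>x. B \<partial>M)"
    using assms(3) by (intro order_trans[OF integral_abs_bound] integral_mono) auto
  then show ?thesis by (simp add: prob_space)
qed

lemma prob_integral_le:
  fixes f :: "'a \<Rightarrow> real"
  assumes "prob_space M" "integrable M f" "AE x in M. f x \<le> B"
  shows "(\<integral>x. f x \<partial>M) \<le> B"
proof -
  interpret prob_space M by fact
  have "(\<integral>x. f x \<partial>M) \<le> (\<integral>x. B \<partial>M)" using assms by (intro integral_mono_AE) auto
  then show ?thesis by (simp add: prob_space)
qed

text \<open>Minkowski's integral inequality for an average over a probability measure, obtained from
  Jensen's inequality inside and Fubini's theorem outside.\<close>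

lemma L2_norm_prob_average_le:
  fixes H :: "'a \<Rightarrow> 'b \<Rightarrow> real"
  assumes "prob_space M" "prob_space N"
    and H: "(\<lambda>(x, y). H x y) \<in> borel_measurable (M \<Otimes>\<^sub>M N)" and B: "\<And>x y. \<bar>H x y\<bar> \<le> B"
    and C: "AE x in M. L2_norm N (H x) \<le> C"
  shows "L2_norm N (\<lambda>y. \<integral>x. H x y \<partial>M) \<le> C"
proof -
  interpret M: prob_space M by fact
  interpret N: prob_space N by fact
  interpret pair_prob_space M N ..
  interpret NM: pair_prob_space N M ..
  note [measurable] = H
  have Hx: "(\<lambda>x. H x y) \<in> borel_measurable M" if "y \<in> space N" for y
    using measurable_compose[OF measurable_Pair2'[OF that] H] by simp
  have C0: "0 \<le> C"
    using C M.AE_const[of "0 \<le> C"] by (meson AE_mp M.AE_E_prob M.AE_False L2_norm_nonneg order_trans eventually_mono)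
  have m2: "(\<lambda>(x, y). (H x y)\<^sup>2) \<in> borel_measurable (M \<Otimes>\<^sub>M N)" by measurable
  have B2: "\<bar>(H x y)\<^sup>2\<bar> \<le> B\<^sup>2" for x y
    using B[of x y] by (simp add: abs_le_square_iff[symmetric])
  have m1: "(\<lambda>y. \<integral>x. H x y \<partial>M) \<in> borel_measurable N"
    by (rule M.borel_measurable_lebesgue_integral) (use measurable_pair_swap[OF H] in \<open>simp add: case_prod_unfold\<close>)
  have m3: "(\<lambda>y. \<integral>x. (H x y)\<^sup>2 \<partial>M) \<in> borel_measurable N"
    by (rule M.borel_measurable_lebesgue_integral) (use measurable_pair_swap[OF m2] in \<open>simp add: case_prod_unfold\<close>)
  have m4: "(\<lambda>x. \<integral>y. (H x y)\<^sup>2 \<partial>N) \<in> borel_measurable M"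
    by (rule N.borel_measurable_lebesgue_integral[OF m2])
  have b1: "\<bar>\<integral>x. H x y \<partial>M\<bar> \<le> B" if "y \<in> space N" for y
    using abs_prob_integral_le[OF assms(1) Hx[OF that] B] .
  have b3: "\<bar>\<integral>x. (H x y)\<^sup>2 \<partial>M\<bar> \<le> B\<^sup>2" if "y \<in> space N" for y
    by (intro abs_prob_integral_le[OF assms(1) _ B2] borel_measurable_power Hx that)
  have b4: "\<bar>\<integral>y. (H x y)\<^sup>2 \<partial>N\<bar> \<le> B\<^sup>2" if "x \<in> space M" for x
    using measurable_compose[OF measurable_Pair1'[OF that] m2]
    by (intro abs_prob_integral_le[OF assms(2) _ B2]) simp
  have "(\<integral>y. (\<integral>x. H x y \<partial>M)\<^sup>2 \<partial>N) \<le> (\<integral>y. \<integral>x. (H x y)\<^sup>2 \<partial>M \<partial>N)"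
  proof (rule integral_mono)
    show "integrable N (\<lambda>y. (\<integral>x. H x y \<partial>M)\<^sup>2)"
      using m1 b1 by (intro N.integrable_const_bound[of _ "B\<^sup>2"] AE_I2)
        (auto simp: abs_le_square_iff[symmetric] intro: order_trans[OF _ abs_ge_self])
    show "integrable N (\<lambda>y. \<integral>x. (H x y)\<^sup>2 \<partial>M)"
      using m3 b3 by (intro N.integrable_const_bound[of _ "B\<^sup>2"] AE_I2) auto
    fix y assume "y \<in> space N"
    then show "(\<integral>x. H x y \<partial>M)\<^sup>2 \<le> (\<integral>x. (H x y)\<^sup>2 \<partial>M)"
      using Hx B by (intro M.integral_power2_le M.L2_bounded[of _ B])
  qed
  also have "\<dots> = (\<integral>x. \<integral>y. (H x y)\<^sup>2 \<partial>N \<partial>M)"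
    by (rule prob_Fubini[OF assms(1,2) m2 B2])
  also have "\<dots> \<le> C\<^sup>2"
  proof (rule prob_integral_le[OF assms(1)])
    show "integrable M (\<lambda>x. \<integral>y. (H x y)\<^sup>2 \<partial>N)"
      using m4 b4 by (intro M.integrable_const_bound[of _ "B\<^sup>2"] AE_I2) auto
    show "AE x in M. (\<integral>y. (H x y)\<^sup>2 \<partial>N) \<le> C\<^sup>2"
      using C by eventually_elim (simp add: power_mono flip: L2_norm_power2)
  qed
  finally show ?thesis unfolding L2_norm_def using C0 by (intro real_le_lsqrt) auto
qed

section \<open>Time averages as elements of the domain of the generator\<close>

context stationary_ergodic_markov_process
begin

text \<open>The classical smoothing of g, namely 1/e times the integral of T s g over [0, e). It
  lies in the domain of the generator, and its image there is the explicit bounded function (T e g -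
  g) / e.\<close>

definition average :: "real \<Rightarrow> ('x \<Rightarrow> real) \<Rightarrow> 'x \<Rightarrow> real" where
  "average e g x = (\<integral>s. T (max 0 s) g x \<partial>unif e)"

lemma T_measurable_time:
  "g \<in> borel_measurable borel \<Longrightarrow> (\<lambda>s. T (max 0 s) g x) \<in> borel_measurable borel"
  using measurable_compose[OF measurable_Pair2'[of x borel borel] T_measurable_pair] by simp

text \<open>Fubini's theorem moves \<open>T t\<close> under the time integral and the semigroup law
  merges the two times; in both orders the result is the average over the shifted window [t, t +
  e).\<close>

lemma average_eq_shift:
  assumes "0 \<le> t" "0 < e" "g \<in> bounded_borel"
  shows "T t (average e g) x = (\<integral>s. T (max 0 (t + s)) g x \<partial>unif e)"
    and "average e (T t g) x = (\<integral>s. T (max 0 (t + s)) g x \<partial>unif e)"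
    and "average e g \<in> bounded_borel"
proof -
  note gm = bounded_borel_measurable[OF assms(3)]
  obtain B where B: "\<And>x. \<bar>g x\<bar> \<le> B" using bounded_borelD[OF assms(3)] by blast
  have TB: "\<bar>T (max 0 s) g x\<bar> \<le> B" for s x by (rule abs_T_le[OF _ gm B]) simp
  have pair: "(\<lambda>(s, x). T (max 0 s) g x) \<in> borel_measurable (unif e \<Otimes>\<^sub>M K t x)" for x
    using T_measurable_pair[OF gm] by (simp cong: measurable_cong_sets)
  \<comment> \<open>For negative s the truncation at 0 breaks the semigroup law, since max 0 (t + s)
    differs from t + max 0 s when t > 0; such s are null for \<open>unif e\<close>.\<close>
  have AEeq: "AE s in unif e. T t (T (max 0 s) g) x = T (max 0 (t + s)) g x"
    "AE s in unif e. T (max 0 s) (T t g) x = T (max 0 (t + s)) g x"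
    using AE_unif[OF assms(2)] by (eventually_elim, use assms in \<open>simp add: T_T max_def add.commute\<close>)+
  interpret U: prob_space "unif e" by (rule prob_space_unif[OF assms(2)])
  have "(\<lambda>(x, s). T (max 0 s) g x) \<in> borel_measurable (borel \<Otimes>\<^sub>M unif e)"
    using measurable_pair_swap[OF T_measurable_pair[OF gm]]
    by (simp add: case_prod_unfold cong: measurable_cong_sets)
  then have am: "average e g \<in> borel_measurable borel"
    unfolding average_def[abs_def] by (rule U.borel_measurable_lebesgue_integral)
  show "average e g \<in> bounded_borel"
    by (rule bounded_borelI[OF am, of B])
      (auto simp: average_def TB T_measurable_time[OF gm] intro!: abs_prob_integral_le prob_space_unif assms)
  have shiftm: "(\<lambda>s. T (max 0 (t + s)) g x) \<in> borel_measurable borel"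
    using measurable_compose[OF _ T_measurable_time[OF gm], of "\<lambda>s. t + s"] by simp
  have "T t (average e g) x = (\<integral>y. \<integral>s. T (max 0 s) g y \<partial>unif e \<partial>K t x)"
    using assms(1) am by (simp add: T_eq_K average_def)
  also have "\<dots> = (\<integral>s. \<integral>y. T (max 0 s) g y \<partial>K t x \<partial>unif e)"
    by (rule prob_Fubini[OF prob_space_unif[OF assms(2)] prob_space_K pair TB])
  also have "\<dots> = (\<integral>s. T t (T (max 0 s) g) x \<partial>unif e)"
    using assms(1) gm by (simp add: T_eq_K[symmetric] T_measurable)
  also have "\<dots> = (\<integral>s. T (max 0 (t + s)) g x \<partial>unif e)"
  proof (rule integral_cong_AE)
    have "(\<lambda>s. \<integral>y. T (max 0 s) g y \<partial>K t x) \<in> borel_measurable (unif e)"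
      using sigma_finite_measure.borel_measurable_lebesgue_integral[OF _ pair]
      by (simp add: prob_space_K prob_space_imp_sigma_finite)
    then show "(\<lambda>s. T t (T (max 0 s) g) x) \<in> borel_measurable (unif e)"
      using assms(1) gm by (simp add: T_eq_K[symmetric] T_measurable)
  qed (use shiftm AEeq(1) in auto)
  finally show "T t (average e g) x = (\<integral>s. T (max 0 (t + s)) g x \<partial>unif e)" .
  show "average e (T t g) x = (\<integral>s. T (max 0 (t + s)) g x \<partial>unif e)"
    unfolding average_def
    by (rule integral_cong_AE)
      (use AEeq(2) shiftm T_measurable_time[OF T_measurable[OF assms(1) gm]] in auto)
qed

lemma average_bounded_borel: "0 < e \<Longrightarrow> g \<in> bounded_borel \<Longrightarrow> average e g \<in> bounded_borel"
  by (rule average_eq_shift(3)[of 0]) auto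

lemma T_average: "0 \<le> t \<Longrightarrow> 0 < e \<Longrightarrow> g \<in> bounded_borel \<Longrightarrow> T t (average e g) x = average e (T t g) x"
  by (simp add: average_eq_shift)

lemma average_diff:
  assumes "0 < e" "f \<in> bounded_borel" "g \<in> bounded_borel"
  shows "average e (\<lambda>x. f x - g x) x = average e f x - average e g x"
proof -
  interpret U: prob_space "unif e" by (rule prob_space_unif[OF assms(1)])
  have "integrable (unif e) (\<lambda>s. T (max 0 s) f x)" if f: "f \<in> bounded_borel" for f
  proof -
    obtain B where "\<And>x. \<bar>f x\<bar> \<le> B" using bounded_borelD[OF f] by blast
    then have "\<bar>T (max 0 s) f x\<bar> \<le> B" for s
      by (intro abs_T_le bounded_borel_measurable[OF f]) auto
    then show ?thesis
      using T_measurable_time[OF bounded_borel_measurable[OF f]]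
      by (intro U.integrable_const_bound[of _ B]) auto
  qed
  then show ?thesis using assms by (simp add: average_def T_diff)
qed

lemma average_scale:
  assumes "f \<in> bounded_borel"
  shows "average e (\<lambda>x. c * f x) x = c * average e f x"
  using assms by (simp add: average_def T_scale bounded_borel_measurable)

text \<open>The exchange of the two time windows applied to s \<mapsto> T s g x. It reduces the
  computation of the generator on averages to the convergence of averages over [0, t) as t tends to
  0.\<close>

lemma average_quotient:
  assumes "0 < t" "0 < e" "g \<in> bounded_borel"
  shows "(T t (average e g) x - average e g x) / t = average t (\<lambda>x. (T e g x - g x) / e) x"
proof -
  note gm = bounded_borel_measurable[OF assms(3)]
  obtain B where B: "\<And>x. \<bar>g x\<bar> \<le> B" using bounded_borelD[OF assms(3)] by blast
  have TB: "\<bar>T (max 0 s) g x\<bar> \<le> B" for s x by (rule abs_T_le[OF _ gm B]) simp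
  have Te: "T e g \<in> bounded_borel" using assms by (intro T_bounded_borel) auto
  have "average t (\<lambda>x. (T e g x - g x) / e) x = (average t (T e g) x - average t g x) / e"
    using average_scale[OF bounded_borel_diff[OF Te assms(3)], of t "1 / e" x] average_diff[OF assms(1) Te assms(3)]
    by simp
  moreover have "((\<integral>s. T (max 0 (t + s)) g x \<partial>unif e) - average e g x) / t =
      ((\<integral>s. T (max 0 (e + s)) g x \<partial>unif t) - average t g x) / e"
    unfolding average_def using unif_shift_exchange[OF assms(1,2) T_measurable_time[OF gm] TB] .
  ultimately show ?thesis using assms by (simp add: average_eq_shift)
qed

lemma L2_norm_average_diff_le:
  assumes "0 < e" "g \<in> bounded_borel"
    and le: "\<And>s. 0 \<le> s \<Longrightarrow> s < e \<Longrightarrow> L2_norm \<mu> (\<lambda>x. T s g x - g x) \<le> C"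
  shows "L2_norm \<mu> (\<lambda>x. average e g x - g x) \<le> C"
proof -
  note [measurable] = bounded_borel_measurable[OF assms(2)]
  note gm = bounded_borel_measurable[OF assms(2)]
  obtain B where B: "\<And>x. \<bar>g x\<bar> \<le> B" using bounded_borelD[OF assms(2)] by blast
  have TB: "\<bar>T (max 0 s) g x\<bar> \<le> B" for s x by (rule abs_T_le[OF _ gm B]) simp
  interpret U: prob_space "unif e" by (rule prob_space_unif[OF assms(1)])
  note [measurable] = T_measurable_pair[OF gm]
  have "integrable (unif e) (\<lambda>s. T (max 0 s) g x)" for x
    using T_measurable_time[OF gm] TB by (intro U.integrable_const_bound[of _ B]) auto
  then have "average e g x - g x = (\<integral>s. T (max 0 s) g x - g x \<partial>unif e)" for x
    using U.prob_space by (simp add: average_def)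
  moreover have "L2_norm \<mu> (\<lambda>x. \<integral>s. T (max 0 s) g x - g x \<partial>unif e) \<le> C"
  proof (rule L2_norm_prob_average_le[OF prob_space_unif[OF assms(1)] prob_space_axioms])
    have "(\<lambda>p. (\<lambda>(s, x). T (max 0 s) g x) p - g (snd p)) \<in> borel_measurable (borel \<Otimes>\<^sub>M borel)"
      by measurable
    then show "(\<lambda>(s, x). T (max 0 s) g x - g x) \<in> borel_measurable (unif e \<Otimes>\<^sub>M \<mu>)"
      by (simp add: case_prod_unfold cong: measurable_cong_sets)
    show "\<bar>T (max 0 s) g x - g x\<bar> \<le> B + B" for s x
      using TB[of s x] B[of x] by linarith
    show "AE s in unif e. L2_norm \<mu> (\<lambda>x. T (max 0 s) g x - g x) \<le> C"
      using AE_unif[OF assms(1)] by eventually_elim (simp add: le)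
  qed
  ultimately show ?thesis by simp
qed

lemma average_tendsto:
  assumes g: "g \<in> bounded_borel"
  shows "((\<lambda>e. L2_norm \<mu> (\<lambda>x. average e g x - g x)) \<longlongrightarrow> 0) (at_right 0)"
proof (rule tendstoI)
  fix r :: real assume r: "0 < r"
  have "\<forall>\<^sub>F t in at_right 0. dist (L2_norm \<mu> (\<lambda>x. T t g x - g x)) 0 < r / 2"
    using strongly_continuous[OF bounded_borel_L2[OF g]] r by (intro tendstoD) auto
  then obtain d where d: "0 < d" "\<And>t. 0 < t \<Longrightarrow> t < d \<Longrightarrow> L2_norm \<mu> (\<lambda>x. T t g x - g x) < r / 2"
    by (auto simp: eventually_at_right_field)
  \<comment> \<open>The time s = 0 belongs to the averaging window but not to the filter of the
    continuity assumption.\<close>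
  have T0: "L2_norm \<mu> (\<lambda>x. T 0 g x - g x) = 0"
    using g by (simp add: T_0 bounded_borel_measurable L2_norm_const)
  have "dist (L2_norm \<mu> (\<lambda>x. average e g x - g x)) 0 < r" if e: "0 < e" "e < d" for e
  proof -
    have "L2_norm \<mu> (\<lambda>x. T s g x - g x) \<le> r / 2" if "0 \<le> s" "s < e" for s
      using d(2)[of s] T0 that e r by (cases "s = 0") (auto intro: less_imp_le)
    from L2_norm_average_diff_le[OF e(1) g this] r show ?thesis by simp
  qed
  with d(1) show "\<forall>\<^sub>F e in at_right 0. dist (L2_norm \<mu> (\<lambda>x. average e g x - g x)) 0 < r"
    by (auto simp: eventually_at_right_field)
qed

lemma generator_value_average:
  assumes "0 < e" "g \<in> bounded_borel"
  shows "is_generator_value \<mu> T (average e g) (\<lambda>x. (T e g x - g x) / e)"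
proof -
  have L: "(\<lambda>x. (T e g x - g x) / e) \<in> bounded_borel"
    using assms by (intro bounded_borel_divide bounded_borel_diff T_bounded_borel) auto
  have "((\<lambda>t. L2_norm \<mu> (\<lambda>x. (T t (average e g) x - average e g x) / t - (T e g x - g x) / e)) \<longlongrightarrow> 0) (at_right 0)"
  proof (rule Lim_transform_eventually[OF average_tendsto[OF L]])
    show "\<forall>\<^sub>F t in at_right 0. L2_norm \<mu> (\<lambda>x. average t (\<lambda>x. (T e g x - g x) / e) x - (T e g x - g x) / e) =
        L2_norm \<mu> (\<lambda>x. (T t (average e g) x - average e g x) / t - (T e g x - g x) / e)"
      by (rule eventually_at_right_less[THEN eventually_mono]) (simp add: average_quotient assms)
  qed
  then show ?thesis
    using L assms by (simp add: is_generator_value_def bounded_borel_L2 average_bounded_borel)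
qed

lemma integral_average:
  assumes "0 < e" "g \<in> bounded_borel" and k: "k \<in> bounded_borel"
  shows "(\<integral>x. average e g x * k x \<partial>\<mu>) = (\<integral>s. (\<integral>x. T (max 0 s) g x * k x \<partial>\<mu>) \<partial>unif e)"
proof -
  note gm = bounded_borel_measurable[OF assms(2)]
  note [measurable] = T_measurable_pair[OF gm] bounded_borel_measurable[OF k]
  obtain B where B: "0 \<le> B" "\<And>x. \<bar>g x\<bar> \<le> B" using bounded_borelD[OF assms(2)] by blast
  obtain C where C: "0 \<le> C" "\<And>x. \<bar>k x\<bar> \<le> C" using bounded_borelD[OF k] by blast
  have TB: "\<bar>T (max 0 s) g x\<bar> \<le> B" for s x by (rule abs_T_le[OF _ gm B(2)]) simp
  have "(\<lambda>p. (\<lambda>(s, x). T (max 0 s) g x) p * k (snd p)) \<in> borel_measurable (borel \<Otimes>\<^sub>M borel)"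
    by measurable
  then have "(\<integral>x. \<integral>s. T (max 0 s) g x * k x \<partial>unif e \<partial>\<mu>) = (\<integral>s. \<integral>x. T (max 0 s) g x * k x \<partial>\<mu> \<partial>unif e)"
    using TB C B(1) by (intro prob_Fubini[OF prob_space_unif[OF assms(1)] prob_space_axioms, of _ "B * C"])
      (auto simp: case_prod_unfold abs_mult intro: mult_mono cong: measurable_cong_sets)
  then show ?thesis by (simp add: average_def)
qed

lemma integral_average_eq:
  assumes "0 < e" "g \<in> bounded_borel"
  shows "(\<integral>x. average e g x \<partial>\<mu>) = (\<integral>x. g x \<partial>\<mu>)"
  using integral_average[OF assms bounded_borel_const[of 1]]
    integral_T[OF _ bounded_borel_integrable[OF assms(2)]]
    prob_space.prob_space[OF prob_space_unif[OF assms(1)]]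
  by simp

end

section \<open>Exponential decay of the variance\<close>

context stationary_ergodic_markov_process
begin

lemma prob_UNIV [simp]: "prob UNIV = 1"
  using prob_space by simp

text \<open>One Euler step for the squared norm of k = T s A: exactly, T (s + h) A = k + h D with D
  close to the generator image of k, and the Poincare inequality at k bounds that main term by -
  \<parallel>k\<parallel>^2 / c. The error \<rho> is measured at time 0; contraction makes it valid
  for every s, and this uniformity is what allows the step to be iterated.\<close>

lemma one_step_decay:
  assumes P: "poincare \<mu> T c" and c: "0 < c" and e: "0 < e" and g: "g \<in> bounded_borel"
    and mean: "(\<integral>x. g x \<partial>\<mu>) = 0" and s: "0 \<le> s" and h: "0 < h"
  defines "A \<equiv> average e g" and "L \<equiv> \<lambda>x. (T e g x - g x) / e"
  defines "\<rho> \<equiv> L2_norm \<mu> (\<lambda>x. average h L x - L x)"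
  shows "(L2_norm \<mu> (T (s + h) A))\<^sup>2 \<le> (1 - 2 * h / c) * (L2_norm \<mu> (T s A))\<^sup>2
    + h * (2 * \<rho> * L2_norm \<mu> A + h * (L2_norm \<mu> L + \<rho>)\<^sup>2)"
proof -
  let ?N = "L2_norm \<mu>"
  have Ts: "T s g \<in> bounded_borel" and Te: "T e g \<in> bounded_borel"
    using s e g by (auto intro: T_bounded_borel)
  have A: "A \<in> bounded_borel" unfolding A_def by (rule average_bounded_borel[OF e g])
  have L: "L \<in> bounded_borel" unfolding L_def by (intro bounded_borel_divide bounded_borel_diff Te g)
  define k where "k = T s A"
  have k: "k \<in> bounded_borel" unfolding k_def by (rule T_bounded_borel[OF s A])
  \<comment> \<open>Since \<open>T s\<close> commutes with averaging, k is again a time average,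
    hence in the domain of the generator.\<close>
  have k_eq: "k = average e (T s g)" using T_average[OF s e g] by (auto simp: k_def A_def)
  define Ls where "Ls = T s L"
  have Ls: "Ls \<in> bounded_borel" unfolding Ls_def by (rule T_bounded_borel[OF s L])
  have Ls_eq: "Ls = (\<lambda>x. (T e (T s g) x - T s g x) / e)"
  proof
    fix x
    have "Ls x = (T s (T e g) x - T s g x) / e"
      using T_scale[OF s bounded_borel_measurable[OF bounded_borel_diff[OF Te g]], of "1 / e" x]
        T_diff[OF s Te g] by (simp add: Ls_def L_def)
    then show "Ls x = (T e (T s g) x - T s g x) / e"
      using s e g by (simp add: T_T add.commute)
  qed
  have gen: "is_generator_value \<mu> T k Ls"
    unfolding k_eq Ls_eq by (rule generator_value_average[OF e Ts])
  define D where "D = average h Ls"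
  have D: "D \<in> bounded_borel" unfolding D_def by (rule average_bounded_borel[OF h Ls])
  have aL: "average h L \<in> bounded_borel" by (rule average_bounded_borel[OF h L])
  have D_eq: "T (s + h) A x = k x + h * D x" for x
  proof -
    have "(T h k x - k x) / h = D x"
      unfolding D_def k_eq Ls_eq by (rule average_quotient[OF h e Ts])
    then show ?thesis
      using h s A T_T[of h s A x] by (simp add: k_def field_simps)
  qed
  have "D x - Ls x = T s (\<lambda>x. average h L x - L x) x" for x
    using T_average[OF s h L, of x] T_diff[OF s aL L, of x] by (simp add: D_def Ls_def)
  then have DLs: "?N (\<lambda>x. D x - Ls x) \<le> \<rho>"
    using T_contraction[OF s bounded_borel_L2[OF bounded_borel_diff[OF aL L]]] by (simp add: \<rho>_def)
  note L2s = bounded_borel_L2[OF k] bounded_borel_L2[OF Ls] bounded_borel_L2[OF D]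
  have kA: "?N k \<le> ?N A" unfolding k_def by (rule T_contraction[OF s bounded_borel_L2[OF A]])
  have LsL: "?N Ls \<le> ?N L" unfolding Ls_def by (rule T_contraction[OF s bounded_borel_L2[OF L]])
  have \<rho>0: "0 \<le> \<rho>" by (simp add: \<rho>_def)
  have "?N D \<le> ?N (\<lambda>x. D x - Ls x) + ?N Ls"
    using L2_norm_triangle[OF L2_diff[OF L2s(3,2)] L2s(2)] by simp
  then have "?N D \<le> ?N L + \<rho>" using DLs LsL by linarith
  then have ND: "(?N D)\<^sup>2 \<le> (?N L + \<rho>)\<^sup>2" by (rule power_mono) simp
  have "(\<integral>x. k x \<partial>\<mu>) = 0"
    using integral_T[OF s bounded_borel_integrable[OF A]] integral_average_eq[OF e g] mean
    by (simp add: k_def A_def)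
  then have "Var \<mu> k = (?N k)\<^sup>2" by (simp add: Var_eq[OF L2s(1)])
  moreover have "Var \<mu> k \<le> c * pre_form \<mu> T k"
    using P gen by (auto simp: poincare_def gen_domain_def)
  ultimately have "(?N k)\<^sup>2 / c \<le> - L2_inner \<mu> Ls k"
    using c by (simp add: pre_form_eq[OF gen] divide_le_eq mult.commute)
  moreover have "L2_inner \<mu> D k = L2_inner \<mu> (\<lambda>x. D x - Ls x) k + L2_inner \<mu> Ls k"
    using L2s by (simp add: L2_inner_diff)
  moreover have "L2_inner \<mu> (\<lambda>x. D x - Ls x) k \<le> \<rho> * ?N A"
  proof -
    have "L2_inner \<mu> (\<lambda>x. D x - Ls x) k \<le> ?N (\<lambda>x. D x - Ls x) * ?N k"
      using L2_Cauchy_Schwarz[OF L2_diff[OF L2s(3,2)] L2s(1)] by simp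
    also have "\<dots> \<le> \<rho> * ?N A" using DLs kA \<rho>0 by (intro mult_mono) auto
    finally show ?thesis .
  qed
  ultimately have inner: "L2_inner \<mu> D k \<le> \<rho> * ?N A - (?N k)\<^sup>2 / c" by linarith
  have "T (s + h) A = (\<lambda>x. k x + h * D x)" using D_eq by auto
  then have "(?N (T (s + h) A))\<^sup>2 = (?N k)\<^sup>2 + 2 * h * L2_inner \<mu> D k + h\<^sup>2 * (?N D)\<^sup>2"
    using L2_norm_add_power2[OF L2s(1) L2_scale[OF L2s(3), of h]]
    by (simp add: L2_norm_scale power_mult_distrib L2_inner_commute[of \<mu> k] L2_inner_scale)
  also have "\<dots> \<le> (?N k)\<^sup>2 + 2 * h * (\<rho> * ?N A - (?N k)\<^sup>2 / c) + h\<^sup>2 * (?N L + \<rho>)\<^sup>2"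
    using inner ND h by (intro add_mono mult_left_mono) auto
  also have "\<dots> = (1 - 2 * h / c) * (?N k)\<^sup>2 + h * (2 * \<rho> * ?N A + h * (?N L + \<rho>)\<^sup>2)"
    by (simp add: algebra_simps power2_eq_square)
  finally show ?thesis unfolding k_def .
qed

text \<open>With n steps of length t / n the contraction factors multiply to at most exp (- 2 t /
  c), while the errors add up to at most t * r (t / n), which vanishes as n grows.\<close>

lemma decay_average:
  assumes P: "poincare \<mu> T c" and c: "0 < c" and e: "0 < e" and g: "g \<in> bounded_borel"
    and mean: "(\<integral>x. g x \<partial>\<mu>) = 0" and t: "0 < t"
  shows "(L2_norm \<mu> (T t (average e g)))\<^sup>2 \<le> exp (- (2 * t / c)) * (L2_norm \<mu> (average e g))\<^sup>2"
proof -
  let ?N = "L2_norm \<mu>"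
  define A where "A = average e g"
  define L where "L = (\<lambda>x. (T e g x - g x) / e)"
  have A: "A \<in> bounded_borel" unfolding A_def by (rule average_bounded_borel[OF e g])
  have L: "L \<in> bounded_borel" unfolding L_def
    using e g by (intro bounded_borel_divide bounded_borel_diff T_bounded_borel) auto
  define \<rho> where "\<rho> h = ?N (\<lambda>x. average h L x - L x)" for h
  define r where "r h = 2 * \<rho> h * ?N A + h * (?N L + \<rho> h)\<^sup>2" for h
  have \<rho>_lim: "(\<rho> \<longlongrightarrow> 0) (at_right 0)" unfolding \<rho>_def using average_tendsto[OF L] .
  have "(r \<longlongrightarrow> 2 * 0 * ?N A + 0 * (?N L + 0)\<^sup>2) (at_right 0)"
    unfolding r_def by (intro tendsto_intros \<rho>_lim)
  then have r_lim: "(r \<longlongrightarrow> 0) (at_right 0)" by simp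
  have r0: "0 \<le> r h" if "0 < h" for h using that by (simp add: r_def \<rho>_def)
  have step: "(?N (T (s + h) A))\<^sup>2 \<le> (1 - 2 * h / c) * (?N (T s A))\<^sup>2 + h * r h" if "0 \<le> s" "0 < h" for s h
    using one_step_decay[OF P c e g mean that] by (simp add: A_def L_def r_def \<rho>_def)
  have iter: "(?N (T (real n * h) A))\<^sup>2 \<le> (1 - 2 * h / c) ^ n * (?N A)\<^sup>2 + real n * h * r h"
    if h: "0 < h" "2 * h / c \<le> 1" for n h
  proof (induction n)
    case 0
    have "T 0 A = A" using A by (auto simp: T_0 bounded_borel_measurable)
    then show ?case by simp
  next
    case (Suc n)
    have "(?N (T (real (Suc n) * h) A))\<^sup>2 \<le> (1 - 2 * h / c) * (?N (T (real n * h) A))\<^sup>2 + h * r h"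
      using step[of "real n * h" h] h by (simp add: algebra_simps)
    also have "\<dots> \<le> (1 - 2 * h / c) * ((1 - 2 * h / c) ^ n * (?N A)\<^sup>2 + real n * h * r h) + h * r h"
      using Suc.IH h by (intro add_mono mult_left_mono) auto
    also have "\<dots> \<le> (1 - 2 * h / c) ^ Suc n * (?N A)\<^sup>2 + 1 * (real n * h * r h) + h * r h"
    proof -
      have "(1 - 2 * h / c) * (real n * h * r h) \<le> 1 * (real n * h * r h)"
        using h c r0[OF h(1)] by (intro mult_right_mono) auto
      then show ?thesis by (simp add: distrib_left mult.assoc)
    qed
    finally show ?case by (simp add: algebra_simps)
  qed
  have h_lim: "filterlim (\<lambda>n. t / real n) (at_right 0) sequentially"
    unfolding filterlim_at
  proof
    show "\<forall>\<^sub>F n in sequentially. t / real n \<in> {0<..} \<and> t / real n \<noteq> 0"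
      using t by (intro eventually_sequentiallyI[of 1]) auto
    show "(\<lambda>n. t / real n) \<longlonglongrightarrow> 0"
      by (intro tendsto_divide_0[OF tendsto_const] filterlim_at_top_imp_at_infinity filterlim_real_sequentially)
  qed
  have ev: "\<forall>\<^sub>F n in sequentially. (?N (T t A))\<^sup>2 \<le> exp (- (2 * t / c)) * (?N A)\<^sup>2 + t * r (t / real n)"
  \<comment> \<open>From this n on, 2 h / c \<le> 1, so the factor 1 - 2 h / c is nonnegative and
    may be raised to a power.\<close>
  proof (rule eventually_sequentiallyI[of "max 1 (nat \<lceil>2 * t / c\<rceil>)"])
    fix n assume n: "max 1 (nat \<lceil>2 * t / c\<rceil>) \<le> n"
    then have n0: "0 < real n" and nc: "2 * t / c \<le> real n" by linarith+
    define h where "h = t / real n"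
    have "2 * h / c = 2 * t / c / real n" by (simp add: h_def)
    then have h: "0 < h" "2 * h / c \<le> 1" using n0 nc t c by (simp_all add: h_def divide_le_eq)
    have nh: "real n * h = t" using n0 by (simp add: h_def)
    have "(1 - 2 * h / c) ^ n \<le> exp (- (2 * h / c)) ^ n"
      using h exp_ge_add_one_self[of "- (2 * h / c)"] by (intro power_mono) auto
    also have "\<dots> = exp (- (2 * t / c))"
      by (simp add: exp_of_nat_mult[symmetric] nh[symmetric] mult.commute mult.left_commute)
    finally have "(1 - 2 * h / c) ^ n * (?N A)\<^sup>2 \<le> exp (- (2 * t / c)) * (?N A)\<^sup>2"
      by (rule mult_right_mono) simp
    then show "(?N (T t A))\<^sup>2 \<le> exp (- (2 * t / c)) * (?N A)\<^sup>2 + t * r (t / real n)"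
      using iter[OF h, of n] by (simp add: nh flip: h_def)
  qed
  have "(\<lambda>n. exp (- (2 * t / c)) * (?N A)\<^sup>2 + t * r (t / real n))
      \<longlonglongrightarrow> exp (- (2 * t / c)) * (?N A)\<^sup>2 + t * 0"
    by (intro tendsto_intros filterlim_compose[OF r_lim h_lim])
  from tendsto_lowerbound[OF this ev] show ?thesis by (simp add: A_def)
qed

text \<open>Averages over [0, e) converge to g in L2 as e tends to 0, and \<open>T t\<close> is a
  contraction, so the bound for averages passes to every bounded g.\<close>

lemma decay_mean_zero:
  assumes P: "poincare \<mu> T c" and c: "0 < c" and g: "g \<in> bounded_borel"
    and mean: "(\<integral>x. g x \<partial>\<mu>) = 0" and t: "0 < t"
  shows "L2_norm \<mu> (T t g) \<le> exp (- (t / c)) * L2_norm \<mu> g"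
proof -
  let ?N = "L2_norm \<mu>"
  have t0: "0 \<le> t" using t by simp
  have "\<forall>\<^sub>F e in at_right 0. ?N (T t g) \<le> ?N (\<lambda>x. average e g x - g x)
      + exp (- (t / c)) * (?N g + ?N (\<lambda>x. average e g x - g x))"
  proof (rule eventually_at_right_less[THEN eventually_mono])
    fix e :: real assume e: "0 < e"
    have A: "average e g \<in> bounded_borel" by (rule average_bounded_borel[OF e g])
    have "(?N (T t (average e g)))\<^sup>2 \<le> (exp (- (t / c)) * ?N (average e g))\<^sup>2"
    proof -
      have "exp (- (2 * t / c)) = (exp (- (t / c)))\<^sup>2"
        by (simp add: power2_eq_square exp_add[symmetric])
      then show ?thesis using decay_average[OF P c e g mean t] by (simp add: power_mult_distrib)
    qed
    then have 1: "?N (T t (average e g)) \<le> exp (- (t / c)) * ?N (average e g)"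
      by (rule power2_le_imp_le) simp
    have "?N (average e g) \<le> ?N g + ?N (\<lambda>x. average e g x - g x)"
      using L2_norm_diff_le[OF bounded_borel_L2[OF A] bounded_borel_L2[OF g]] by linarith
    then have 2: "exp (- (t / c)) * ?N (average e g) \<le> exp (- (t / c)) * (?N g + ?N (\<lambda>x. average e g x - g x))"
      by (intro mult_left_mono) auto
    have "?N (\<lambda>x. T t (average e g) x - T t g x) \<le> ?N (\<lambda>x. average e g x - g x)"
      using T_contraction[OF t0 bounded_borel_L2[OF bounded_borel_diff[OF A g]]]
      by (simp add: T_diff[OF t0 A g, abs_def])
    then have 3: "?N (T t g) \<le> ?N (T t (average e g)) + ?N (\<lambda>x. average e g x - g x)"
      using L2_norm_diff_le[OF T_L2[OF t0 bounded_borel_L2[OF A]] T_L2[OF t0 bounded_borel_L2[OF g]]] by linarith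
    show "?N (T t g) \<le> ?N (\<lambda>x. average e g x - g x)
        + exp (- (t / c)) * (?N g + ?N (\<lambda>x. average e g x - g x))"
      using 1 2 3 by linarith
  qed
  moreover have "((\<lambda>e. ?N (\<lambda>x. average e g x - g x) + exp (- (t / c)) * (?N g + ?N (\<lambda>x. average e g x - g x)))
      \<longlongrightarrow> 0 + exp (- (t / c)) * (?N g + 0)) (at_right 0)"
    by (intro tendsto_intros average_tendsto g)
  ultimately have "?N (T t g) \<le> 0 + exp (- (t / c)) * (?N g + 0)"
    by (intro tendsto_lowerbound) auto
  then show ?thesis by simp
qed

lemma Var_decay:
  assumes P: "poincare \<mu> T c" and c: "0 < c" and g: "g \<in> bounded_borel" and t: "0 < t"
  shows "Var \<mu> (T t g) \<le> exp (- (2 * t / c)) * Var \<mu> g"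
proof -
  define m where "m = (\<integral>x. g x \<partial>\<mu>)"
  have t0: "0 \<le> t" using t by simp
  let ?k = "\<lambda>x. g x - m"
  have k: "?k \<in> bounded_borel" by (intro bounded_borel_diff g bounded_borel_const)
  have mean: "(\<integral>x. ?k x \<partial>\<mu>) = 0" using bounded_borel_integrable[OF g] by (simp add: m_def)
  have Tm: "(\<integral>x. T t g x \<partial>\<mu>) = m" unfolding m_def by (rule integral_T[OF t0 bounded_borel_integrable[OF g]])
  have "T t ?k = (\<lambda>x. T t g x - m)" using t0 g by (auto simp: T_diff T_const)
  then have "Var \<mu> (T t g) = (L2_norm \<mu> (T t ?k))\<^sup>2" by (simp add: Var_def Tm L2_norm_power2)
  also have "\<dots> \<le> (exp (- (t / c)) * L2_norm \<mu> ?k)\<^sup>2"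
    using decay_mean_zero[OF P c k mean t] by (rule power_mono) simp
  also have "\<dots> = exp (- (2 * t / c)) * (L2_norm \<mu> ?k)\<^sup>2"
    by (simp add: power_mult_distrib power2_eq_square exp_add[symmetric])
  also have "(L2_norm \<mu> ?k)\<^sup>2 = Var \<mu> g" by (simp add: Var_def m_def L2_norm_power2)
  finally show ?thesis .
qed

end

section \<open>The deviation inequality\<close>

lemma oscillation_ge:
  assumes "bounded (range u)"
  shows "\<bar>u x - u y\<bar> \<le> oscillation u"
proof -
  obtain B where B: "\<bar>u x\<bar> \<le> B" for x using assms by (auto simp: bounded_iff)
  have "bdd_above (range (\<lambda>p. \<bar>u (fst p) - u (snd p)\<bar>))"
  proof (rule bdd_aboveI2)
    fix p show "\<bar>u (fst p) - u (snd p)\<bar> \<le> B + B"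
      using B[of "fst p"] B[of "snd p"] by linarith
  qed
  from cSUP_upper[OF _ this, of "(x, y)"] show ?thesis by (simp add: oscillation_def)
qed

text \<open>The midpoint of supremum and infimum. Around the mean of u only the full oscillation is
  guaranteed as a bound; the half gained here becomes the factor 1/4 in the exponential
  moment.\<close>

lemma oscillation_center:
  assumes "bounded (range u)"
  shows "\<exists>a. \<forall>x. \<bar>u x - a\<bar> \<le> oscillation u / 2"
proof -
  obtain B where B: "\<bar>u x\<bar> \<le> B" for x using assms by (auto simp: bounded_iff)
  have a: "bdd_above (range u)" using B by (intro bdd_aboveI2[of _ _ B]) (simp add: abs_le_iff)
  have b: "bdd_below (range u)"
  proof (rule bdd_belowI2)
    fix x show "- B \<le> u x" using B[of x] by linarith
  qed
  have "(SUP x. u x) \<le> oscillation u + u y" for y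
    using oscillation_ge[OF assms, of _ y] by (intro cSUP_least) (auto simp: abs_le_iff algebra_simps)
  then have "(SUP x. u x) - oscillation u \<le> (INF y. u y)"
    by (intro cINF_greatest) (auto simp: algebra_simps)
  moreover have "u x \<le> (SUP x. u x)" "(INF x. u x) \<le> u x" for x
    using a b by (auto intro: cSUP_upper cINF_lower)
  ultimately have "\<bar>u x - ((SUP x. u x) + (INF x. u x)) / 2\<bar> \<le> oscillation u / 2" for x
  proof (intro abs_leI)
    assume *: "(SUP x. u x) - oscillation u \<le> (INF y. u y)" "\<And>x. u x \<le> (SUP x. u x)" "\<And>x. (INF x. u x) \<le> u x"
    show "u x - ((SUP x. u x) + (INF x. u x)) / 2 \<le> oscillation u / 2"
      "- (u x - ((SUP x. u x) + (INF x. u x)) / 2) \<le> oscillation u / 2"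
      using *(1) *(2,3)[of x] by (simp_all add: field_simps)
  qed
  then show ?thesis by blast
qed

lemma exp_le_quadratic:
  fixes x :: real
  assumes "\<bar>x\<bar> \<le> 1"
  shows "exp x \<le> 1 + x + x\<^sup>2"
proof (cases "0 \<le> x")
  case True
  then show ?thesis using assms by (intro exp_bound) auto
next
  case False
  define y where "y = - x"
  have y: "0 < y" "y \<le> 1" using False assms by (auto simp: y_def)
  have "exp x = 1 / exp y" by (simp add: y_def exp_minus inverse_eq_divide)
  also have "\<dots> \<le> 1 / (1 + y)"
    using y exp_ge_add_one_self[of y] by (intro divide_left_mono) auto
  also have "\<dots> \<le> 1 - y + y\<^sup>2"
  proof -
    have "1 \<le> (1 - y + y\<^sup>2) * (1 + y)"
      using y by (simp add: algebra_simps power2_eq_square)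
    then show ?thesis using y by (simp add: divide_le_eq)
  qed
  finally show ?thesis by (simp add: y_def)
qed

text \<open>Cut \<open>[0, n h)\<close> into \<open>n\<close> blocks and superpose them: the integral is the mean over a random
  shift of Riemann sums, and Jensen's inequality applies to \<open>exp\<close>.\<close>

lemma exp_integral_le_shifted_sums:
  fixes f :: "real \<Rightarrow> real"
  assumes h: "0 < h" and f [measurable]: "f \<in> borel_measurable borel" and B: "\<And>s. \<bar>f s\<bar> \<le> B"
  shows "exp (\<integral>s. indicator {0..<real n * h} s * f s \<partial>lborel)
    \<le> (\<integral>s. exp (h * (\<Sum>k<n. f (real k * h + s))) \<partial>unif h)"
proof -
  interpret U: prob_space "unif h" by (rule prob_space_unif[OF h])
  define I where "I = (\<integral>s. indicator {0..<real n * h} s * f s \<partial>lborel)"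
  define Y where "Y s = h * (\<Sum>k<n. f (real k * h + s))" for s
  have int_f: "integrable (unif h) (\<lambda>s. f (a + s))" for a
    using B by (intro U.integrable_const_bound[of _ B]) auto
  have "(\<Sum>k<n. \<integral>s. f (real k * h + s) \<partial>unif h) = (\<integral>s. indicator {0..<real n * h} s * f s \<partial>lborel) / h"
  proof (induction n)
    case 0
    show ?case by (simp add: indicator_def)
  next
    case (Suc n)
    have "(\<integral>s. indicator {0..<real n * h} s * f s \<partial>lborel)
        + (\<integral>s. indicator {real n * h..<real n * h + h} s * f s \<partial>lborel)
        = (\<integral>s. indicator {0..<real n * h + h} s * f s \<partial>lborel)"
      using h by (intro integral_indicator_append[OF _ _ f B]) auto
    then show ?case
      using Suc.IH integral_unif_shift[OF h f, of "real n * h"]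
      by (simp add: add_divide_distrib[symmetric] algebra_simps)
  qed
  then have mean: "(\<integral>s. Y s \<partial>unif h) = I"
    using h by (simp add: Y_def I_def int_f)
  have Yint: "integrable (unif h) Y" unfolding Y_def[abs_def] using int_f by auto
  have [measurable]: "Y \<in> borel_measurable borel" unfolding Y_def[abs_def] by measurable
  have Yb: "\<bar>Y s\<bar> \<le> h * (real n * B)" for s
  proof -
    have "\<bar>\<Sum>k<n. f (real k * h + s)\<bar> \<le> (\<Sum>k<n. B)"
      by (rule order_trans[OF sum_abs]) (intro sum_mono B)
    then show ?thesis using h by (simp add: Y_def abs_mult)
  qed
  have Eint: "integrable (unif h) (\<lambda>s. exp (Y s))"
    using Yb by (intro U.integrable_const_bound[of _ "exp (h * (real n * B))"]) (auto simp: abs_le_iff)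
  \<comment> \<open>Jensen's inequality through the tangent line of exp at I: its value at Y has
    mean exp I and lies below exp Y.\<close>
  have "exp I = (\<integral>s. exp I * (1 + (Y s - I)) \<partial>unif h)"
    using Yint mean U.prob_space by simp
  also have "\<dots> \<le> (\<integral>s. exp (Y s) \<partial>unif h)"
  proof (rule integral_mono)
    show "integrable (unif h) (\<lambda>s. exp I * (1 + (Y s - I)))" using Yint by auto
    fix s
    have "exp I * (1 + (Y s - I)) \<le> exp I * exp (Y s - I)"
      by (intro mult_left_mono exp_ge_add_one_self) auto
    then show "exp I * (1 + (Y s - I)) \<le> exp (Y s)" by (simp add: exp_add[symmetric])
  qed (rule Eint)
  finally show ?thesis by (simp add: I_def Y_def)
qed

section \<open>One step of the discretised Feynman-Kac semigroup\<close>

context stationary_ergodic_markov_process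
begin

text \<open>Both u - \<mu> u and k^2 - q^2 have mean 0, where q is the norm of k, so u may be
  recentered at a: the left side equals the integral of (u - a) (k^2 - q^2). The first factor is at
  most d / 2, and the integral of \<bar>k^2 - q^2\<bar> is controlled by the variance.\<close>

lemma integral_potential_le:
  assumes k: "k \<in> bounded_borel" and u: "u \<in> bounded_borel" and a: "\<And>x. \<bar>u x - a\<bar> \<le> d / 2"
  shows "(\<integral>x. (u x - (\<integral>y. u y \<partial>\<mu>)) * (k x)\<^sup>2 \<partial>\<mu>) \<le> d * (L2_norm \<mu> k * sqrt (Var \<mu> k))"
proof -
  define m where "m = (\<integral>y. u y \<partial>\<mu>)"
  define q where "q = L2_norm \<mu> k"
  have d: "0 \<le> d" using a[of undefined] by linarith
  note k2 = bounded_borel_power2[OF k]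
  note uk = bounded_borel_mult[OF u k2]
  note int = bounded_borel_integrable[OF uk] bounded_borel_integrable[OF k2] bounded_borel_integrable[OF u]
  have q2: "(\<integral>x. (k x)\<^sup>2 \<partial>\<mu>) = q\<^sup>2" by (simp add: q_def L2_norm_power2)
  have "(\<integral>x. (u x - m) * (k x)\<^sup>2 \<partial>\<mu>) = (\<integral>x. u x * (k x)\<^sup>2 \<partial>\<mu>) - m * q\<^sup>2"
    using int by (simp add: left_diff_distrib q2)
  also have "\<dots> = (\<integral>x. (u x * (k x)\<^sup>2 - a * (k x)\<^sup>2) - (q\<^sup>2 * u x - a * q\<^sup>2) \<partial>\<mu>)"
    using int by (simp add: q2 m_def)
  also have "\<dots> = (\<integral>x. (u x - a) * ((k x)\<^sup>2 - q\<^sup>2) \<partial>\<mu>)"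
    by (intro Bochner_Integration.integral_cong) (auto simp: algebra_simps)
  also have "\<dots> \<le> (\<integral>x. d / 2 * \<bar>(k x)\<^sup>2 - q\<^sup>2\<bar> \<partial>\<mu>)"
  proof (rule integral_mono)
    have kq: "(\<lambda>x. (k x)\<^sup>2 - q\<^sup>2) \<in> bounded_borel" by (intro bounded_borel_diff k2 bounded_borel_const)
    show "integrable \<mu> (\<lambda>x. (u x - a) * ((k x)\<^sup>2 - q\<^sup>2))"
      by (intro bounded_borel_integrable bounded_borel_mult kq bounded_borel_diff u bounded_borel_const)
    show "integrable \<mu> (\<lambda>x. d / 2 * \<bar>(k x)\<^sup>2 - q\<^sup>2\<bar>)"
      by (intro bounded_borel_integrable bounded_borel_scale bounded_borel_abs kq)
    fix x
    have "(u x - a) * ((k x)\<^sup>2 - q\<^sup>2) \<le> \<bar>u x - a\<bar> * \<bar>(k x)\<^sup>2 - q\<^sup>2\<bar>"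
      by (metis abs_ge_self abs_mult)
    also have "\<dots> \<le> d / 2 * \<bar>(k x)\<^sup>2 - q\<^sup>2\<bar>" by (intro mult_right_mono a) auto
    finally show "(u x - a) * ((k x)\<^sup>2 - q\<^sup>2) \<le> d / 2 * \<bar>(k x)\<^sup>2 - q\<^sup>2\<bar>" .
  qed
  also have "\<dots> = d / 2 * (\<integral>x. \<bar>(k x)\<^sup>2 - q\<^sup>2\<bar> \<partial>\<mu>)" by simp
  also have "\<dots> \<le> d / 2 * (2 * (q * sqrt (Var \<mu> k)))"
  proof (intro mult_left_mono)
    have "(\<integral>x. \<bar>(k x)\<^sup>2 - q\<^sup>2\<bar> \<partial>\<mu>)\<^sup>2 \<le> (2 * (q * sqrt (Var \<mu> k)))\<^sup>2"
      using integral_abs_square_diff_le[OF bounded_borel_L2[OF k]] Var_nonneg[of k]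
      by (simp add: q_def power_mult_distrib)
    then show "(\<integral>x. \<bar>(k x)\<^sup>2 - q\<^sup>2\<bar> \<partial>\<mu>) \<le> 2 * (q * sqrt (Var \<mu> k))"
      by (rule power2_le_imp_le) (simp add: q_def Var_nonneg)
  qed (use d in simp)
  finally show ?thesis by (simp add: m_def q_def)
qed

text \<open>This bounds the top of the spectrum of the generator plus the potential
  \<open>\<kappa> * (u - \<mu> u)\<close>, the generator entering through the Poincare inequality only.\<close>

lemma integral_scaled_potential_le:
  assumes k: "k \<in> bounded_borel" and u: "u \<in> bounded_borel" and a: "\<And>x. \<bar>u x - a\<bar> \<le> d / 2"
    and c: "0 < c" and \<kappa>: "0 \<le> \<kappa>"
  shows "(\<integral>x. \<kappa> * (u x - (\<integral>y. u y \<partial>\<mu>)) * (k x)\<^sup>2 \<partial>\<mu>)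
    \<le> \<kappa>\<^sup>2 * d\<^sup>2 * c / 4 * (L2_norm \<mu> k)\<^sup>2 + Var \<mu> k / c"
proof -
  \<comment> \<open>The bound of the previous lemma, times \<kappa>, equals 2 w v. Its square
    completion w^2 + v^2 separates a multiple of the squared norm from exactly the Var k / c that
    the semigroup can pay for.\<close>
  define v where "v = sqrt (Var \<mu> k / c)"
  define w where "w = \<kappa> * d * sqrt c * L2_norm \<mu> k / 2"
  have v2: "v\<^sup>2 = Var \<mu> k / c" using c Var_nonneg[of k] by (simp add: v_def)
  have w2: "w\<^sup>2 = \<kappa>\<^sup>2 * d\<^sup>2 * c / 4 * (L2_norm \<mu> k)\<^sup>2"
    using c by (simp add: w_def power_mult_distrib power_divide)
  have "sqrt (Var \<mu> k) = v * sqrt c" using c by (simp add: v_def real_sqrt_divide)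
  then have wv: "\<kappa> * (d * (L2_norm \<mu> k * sqrt (Var \<mu> k))) = 2 * w * v" by (simp add: w_def)
  have "(\<integral>x. \<kappa> * (u x - (\<integral>y. u y \<partial>\<mu>)) * (k x)\<^sup>2 \<partial>\<mu>)
      = \<kappa> * (\<integral>x. (u x - (\<integral>y. u y \<partial>\<mu>)) * (k x)\<^sup>2 \<partial>\<mu>)"
    by (simp add: mult.assoc)
  also have "\<dots> \<le> 2 * w * v"
    unfolding wv[symmetric] by (intro mult_left_mono integral_potential_le[OF k u a] \<kappa>)
  also have "\<dots> \<le> w\<^sup>2 + v\<^sup>2" by (rule sum_squares_bound)
  finally show ?thesis by (simp add: v2 w2)
qed

text \<open>One factor of a Lie-Trotter product, and the real-valued counterpart of
  \<open>nn_step\<close>: the integral identity along the path needs \<open>ennreal\<close>, the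
  norm estimate needs reals.\<close>

definition step :: "('x \<Rightarrow> real) \<Rightarrow> real \<Rightarrow> ('x \<Rightarrow> real) \<Rightarrow> 'x \<Rightarrow> real" where
  "step v h g x = v x * T h g x"

lemma step_bounded_borel: "v \<in> bounded_borel \<Longrightarrow> 0 \<le> h \<Longrightarrow> g \<in> bounded_borel \<Longrightarrow> step v h g \<in> bounded_borel"
  unfolding step_def[abs_def] by (intro bounded_borel_mult T_bounded_borel)

lemma funpow_step_bounded_borel:
  "v \<in> bounded_borel \<Longrightarrow> 0 \<le> h \<Longrightarrow> (step v h ^^ n) (\<lambda>x. 1) \<in> bounded_borel"
  by (induction n) (simp_all add: step_bounded_borel)

lemma T_nonneg: "0 \<le> t \<Longrightarrow> f \<in> borel_measurable borel \<Longrightarrow> (\<And>x. 0 \<le> f x) \<Longrightarrow> 0 \<le> T t f x"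
  by (simp add: T_eq_K)

lemma funpow_step_nonneg:
  assumes "v \<in> bounded_borel" "\<And>x. 0 \<le> v x" "0 \<le> h"
  shows "0 \<le> (step v h ^^ n) (\<lambda>x. 1) x"
proof (induction n arbitrary: x)
  case (Suc n)
  have "(step v h ^^ Suc n) (\<lambda>x. 1) x = v x * T h ((step v h ^^ n) (\<lambda>x. 1)) x"
    unfolding funpow.simps comp_apply by (rule step_def)
  then show ?case
    using Suc assms T_nonneg[OF assms(3) bounded_borel_measurable[OF funpow_step_bounded_borel[OF assms(1,3), of n]]]
    by simp
qed simp

lemma nn_integral_K_bounded:
  assumes "0 \<le> t" "g \<in> bounded_borel" "\<And>x. 0 \<le> g x"
  shows "(\<integral>\<^sup>+y. ennreal (g y) \<partial>K t x) = ennreal (T t g x)"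
  using assms integrable_K[OF assms(2), of t x]
  by (simp add: T_eq_K bounded_borel_measurable nn_integral_eq_integral)

lemma funpow_nn_step_eq:
  assumes "v \<in> bounded_borel" "\<And>x. 0 \<le> v x" "0 \<le> h"
  shows "(nn_step (\<lambda>x. ennreal (v x)) h ^^ n) (\<lambda>x. 1) = (\<lambda>x. ennreal ((step v h ^^ n) (\<lambda>x. 1) x))"
proof (induction n)
  case (Suc n)
  let ?G = "(step v h ^^ n) (\<lambda>x. 1)"
  have "(nn_step (\<lambda>x. ennreal (v x)) h ^^ Suc n) (\<lambda>x. 1) x = ennreal ((step v h ^^ Suc n) (\<lambda>x. 1) x)" for x
  proof -
    have "(nn_step (\<lambda>x. ennreal (v x)) h ^^ Suc n) (\<lambda>x. 1) x
        = ennreal (v x) * (\<integral>\<^sup>+y. ennreal (?G y) \<partial>K h x)"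
      unfolding funpow.simps comp_apply Suc.IH by (rule nn_step_def)
    also have "\<dots> = ennreal (v x) * ennreal (T h ?G x)"
      using nn_integral_K_bounded[OF assms(3), of ?G x]
        funpow_step_bounded_borel[OF assms(1,3), of n] funpow_step_nonneg[OF assms, of n]
      by simp
    also have "\<dots> = ennreal (v x * T h ?G x)" by (simp add: ennreal_mult' assms(2))
    also have "v x * T h ?G x = (step v h ^^ Suc n) (\<lambda>x. 1) x"
      unfolding funpow.simps comp_apply by (rule step_def[symmetric])
    finally show ?thesis .
  qed
  then show ?case by blast
qed simp

text \<open>The multiplication costs the potential term, bounded by \<Lambda> times the squared norm
  plus Var k / c with k = T h g. The transition pays for the latter: the means of k and g agree, Var
  k \<le> exp (- 2 h / c) Var g, and (1 + 2 h / c) exp (- 2 h / c) \<le> 1, so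
  \<parallel>k\<parallel>^2 + (2 h / c) Var k \<le> \<parallel>g\<parallel>^2. The condition on h M
  keeps the exponent in [-1, 1], where exp x \<le> 1 + x + x^2.\<close>

lemma L2_norm_step_le:
  assumes P: "poincare \<mu> T c" and c: "0 < c" and u: "u \<in> bounded_borel" and a: "\<And>x. \<bar>u x - a\<bar> \<le> d / 2"
    and \<kappa>: "0 \<le> \<kappa>" and h: "0 < h" and g: "g \<in> bounded_borel"
    and M: "\<And>x. \<bar>\<kappa> * (u x - (\<integral>y. u y \<partial>\<mu>))\<bar> \<le> M" and hM: "2 * h * M \<le> 1"
  shows "(L2_norm \<mu> (step (\<lambda>x. exp (h * (\<kappa> * (u x - (\<integral>y. u y \<partial>\<mu>))))) h g))\<^sup>2
    \<le> (1 + 2 * h * (\<kappa>\<^sup>2 * d\<^sup>2 * c / 4) + 4 * h\<^sup>2 * M\<^sup>2) * (L2_norm \<mu> g)\<^sup>2"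
proof -
  let ?N = "L2_norm \<mu>"
  define V where "V x = \<kappa> * (u x - (\<integral>y. u y \<partial>\<mu>))" for x
  define \<Lambda> where "\<Lambda> = \<kappa>\<^sup>2 * d\<^sup>2 * c / 4"
  define k where "k = T h g"
  define \<theta> where "\<theta> = exp (- (2 * h / c))"
  have h0: "0 \<le> h" using h by simp
  have V: "V \<in> bounded_borel" unfolding V_def[abs_def]
    by (intro bounded_borel_scale bounded_borel_diff u bounded_borel_const)
  have VM: "\<bar>V x\<bar> \<le> M" for x using M by (simp add: V_def)
  have k: "k \<in> bounded_borel" unfolding k_def by (rule T_bounded_borel[OF h0 g])
  have \<Lambda>: "0 \<le> \<Lambda>" using c by (simp add: \<Lambda>_def)
  note k2 = bounded_borel_power2[OF k]
  have pw: "(exp (h * V x))\<^sup>2 \<le> 1 + 2 * h * V x + 4 * h\<^sup>2 * M\<^sup>2" for x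
  proof -
    have "\<bar>2 * h * V x\<bar> = 2 * h * \<bar>V x\<bar>" using h by (simp add: abs_mult)
    also have "\<dots> \<le> 2 * h * M" using h VM by (intro mult_left_mono) auto
    finally have b: "\<bar>2 * h * V x\<bar> \<le> 2 * h * M" .
    then have "\<bar>2 * h * V x\<bar> \<le> 1" using hM by linarith
    have "(exp (h * V x))\<^sup>2 = exp (2 * h * V x)" by (simp add: exp_double[symmetric] mult.assoc)
    also have "\<dots> \<le> 1 + 2 * h * V x + (2 * h * V x)\<^sup>2" by (rule exp_le_quadratic) fact
    also have "(2 * h * V x)\<^sup>2 \<le> (2 * h * M)\<^sup>2"
      using power_mono[OF b, of 2] by simp
    finally show ?thesis by (simp add: power_mult_distrib)
  qed
  have "(?N (step (\<lambda>x. exp (h * V x)) h g))\<^sup>2 = (\<integral>x. (exp (h * V x))\<^sup>2 * (k x)\<^sup>2 \<partial>\<mu>)"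
    by (simp add: L2_norm_power2 step_def k_def power_mult_distrib)
  also have "\<dots> \<le> (\<integral>x. (1 + 2 * h * V x + 4 * h\<^sup>2 * M\<^sup>2) * (k x)\<^sup>2 \<partial>\<mu>)"
  proof (rule integral_mono)
    have "(\<lambda>x. exp (h * V x)) \<in> bounded_borel"
    proof (rule bounded_borelI)
      show "\<bar>exp (h * V x)\<bar> \<le> exp (h * M)" for x
        using VM[of x] h by (simp add: abs_le_iff)
      show "(\<lambda>x. exp (h * V x)) \<in> borel_measurable borel"
        using bounded_borel_measurable[OF V] by measurable
    qed
    then show "integrable \<mu> (\<lambda>x. (exp (h * V x))\<^sup>2 * (k x)\<^sup>2)"
      by (intro bounded_borel_integrable bounded_borel_mult k2 bounded_borel_power2)
    show "integrable \<mu> (\<lambda>x. (1 + 2 * h * V x + 4 * h\<^sup>2 * M\<^sup>2) * (k x)\<^sup>2)"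
      by (intro bounded_borel_integrable bounded_borel_mult[OF _ k2] bounded_borel_add bounded_borel_scale V bounded_borel_const)
    show "(exp (h * V x))\<^sup>2 * (k x)\<^sup>2 \<le> (1 + 2 * h * V x + 4 * h\<^sup>2 * M\<^sup>2) * (k x)\<^sup>2" for x
      by (intro mult_right_mono pw) auto
  qed
  also have "\<dots> = (\<integral>x. (k x)\<^sup>2 + 2 * h * (V x * (k x)\<^sup>2) + 4 * h\<^sup>2 * M\<^sup>2 * (k x)\<^sup>2 \<partial>\<mu>)"
    by (intro Bochner_Integration.integral_cong) (auto simp: algebra_simps)
  also have "\<dots> = (?N k)\<^sup>2 + 2 * h * (\<integral>x. V x * (k x)\<^sup>2 \<partial>\<mu>) + 4 * h\<^sup>2 * M\<^sup>2 * (?N k)\<^sup>2"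
    using bounded_borel_integrable[OF k2] bounded_borel_integrable[OF bounded_borel_mult[OF V k2]]
    by (simp add: L2_norm_power2)
  also have "\<dots> \<le> (?N k)\<^sup>2 + 2 * h * (\<Lambda> * (?N k)\<^sup>2 + Var \<mu> k / c) + 4 * h\<^sup>2 * M\<^sup>2 * (?N k)\<^sup>2"
    using integral_scaled_potential_le[OF k u a c \<kappa>] h
    by (intro add_mono mult_left_mono) (auto simp: V_def \<Lambda>_def)
  also have "\<dots> = ((?N k)\<^sup>2 + 2 * h / c * Var \<mu> k) + (2 * h * \<Lambda> + 4 * h\<^sup>2 * M\<^sup>2) * (?N k)\<^sup>2"
    by (simp add: algebra_simps)
  also have "\<dots> \<le> (?N g)\<^sup>2 + (2 * h * \<Lambda> + 4 * h\<^sup>2 * M\<^sup>2) * (?N g)\<^sup>2"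
  proof (rule add_mono)
    have m: "(\<integral>x. k x \<partial>\<mu>) = (\<integral>x. g x \<partial>\<mu>)"
      unfolding k_def by (rule integral_T[OF h0 bounded_borel_integrable[OF g]])
    have "(1 + 2 * h / c) * \<theta> \<le> 1"
    proof -
      have "(1 + 2 * h / c) * \<theta> \<le> exp (2 * h / c) * \<theta>"
        by (intro mult_right_mono exp_ge_add_one_self) (simp add: \<theta>_def)
      also have "\<dots> = 1" by (simp add: \<theta>_def exp_add[symmetric])
      finally show ?thesis .
    qed
    then have \<theta>: "(1 + 2 * h / c) * \<theta> * Var \<mu> g \<le> 1 * Var \<mu> g"
      by (rule mult_right_mono) (rule Var_nonneg)
    have "(1 + 2 * h / c) * Var \<mu> k \<le> (1 + 2 * h / c) * (\<theta> * Var \<mu> g)"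
      using Var_decay[OF P c g h] h c by (intro mult_left_mono) (auto simp: k_def \<theta>_def)
    then have "(1 + 2 * h / c) * Var \<mu> k \<le> Var \<mu> g" using \<theta> by (simp add: mult.assoc)
    then have "Var \<mu> k + 2 * h / c * Var \<mu> k \<le> Var \<mu> g" by (simp only: distrib_right mult_1)
    then show "(?N k)\<^sup>2 + 2 * h / c * Var \<mu> k \<le> (?N g)\<^sup>2"
      using Var_eq[OF bounded_borel_L2[OF k]] Var_eq[OF bounded_borel_L2[OF g]]
      unfolding m by linarith
    show "(2 * h * \<Lambda> + 4 * h\<^sup>2 * M\<^sup>2) * (?N k)\<^sup>2 \<le> (2 * h * \<Lambda> + 4 * h\<^sup>2 * M\<^sup>2) * (?N g)\<^sup>2"
      using T_contraction[OF h0 bounded_borel_L2[OF g]] \<Lambda> h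
      by (intro mult_left_mono power_mono) (auto simp: k_def)
  qed
  finally show ?thesis by (simp add: V_def \<Lambda>_def algebra_simps)
qed

lemma L2_norm_average_le:
  assumes "0 < e" "g \<in> bounded_borel"
  shows "L2_norm \<mu> (average e g) \<le> L2_norm \<mu> g"
proof -
  note gm = bounded_borel_measurable[OF assms(2)]
  obtain B where B: "\<And>x. \<bar>g x\<bar> \<le> B" using bounded_borelD[OF assms(2)] by blast
  have TB: "\<bar>T (max 0 s) g x\<bar> \<le> B" for s x by (rule abs_T_le[OF _ gm B]) simp
  show ?thesis
    unfolding average_def[abs_def]
  proof (rule L2_norm_prob_average_le[OF prob_space_unif[OF assms(1)] prob_space_axioms _ TB])
    show "(\<lambda>(s, x). T (max 0 s) g x) \<in> borel_measurable (unif e \<Otimes>\<^sub>M \<mu>)"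
      using T_measurable_pair[OF gm] by (simp cong: measurable_cong_sets)
    show "AE s in unif e. L2_norm \<mu> (T (max 0 s) g) \<le> L2_norm \<mu> g"
      by (intro AE_I2 T_contraction bounded_borel_L2 assms) simp
  qed
qed

section \<open>Exponential moments of the path integral\<close>

definition path_exp :: "('x \<Rightarrow> real) \<Rightarrow> real \<Rightarrow> 'w \<Rightarrow> real" where
  "path_exp V t \<omega> = exp (\<integral>s. indicator {0..<t} s * V (X (max 0 s) \<omega>) \<partial>lborel)"

lemma measurable_path_integral [measurable]:
  fixes V :: "'x \<Rightarrow> real"
  assumes [measurable]: "V \<in> borel_measurable borel"
  shows "(\<lambda>\<omega>. \<integral>s. indicator {0..<t} s * V (X (max 0 s) \<omega>) \<partial>lborel) \<in> borel_measurable F"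
proof -
  have 1: "(\<lambda>p. V (X (max 0 (fst p)) (snd p))) \<in> borel_measurable (borel \<Otimes>\<^sub>M F)"
    using measurable_compose[OF measurable_X_pair' assms] .
  have 2: "(\<lambda>p. indicator {0..<t} (fst p) :: real) \<in> borel_measurable (borel \<Otimes>\<^sub>M F)"
    by (rule measurable_compose[OF measurable_fst borel_measurable_indicator]) simp
  have "(\<lambda>p. indicator {0..<t} (fst p) * V (X (max 0 (fst p)) (snd p))) \<in> borel_measurable (borel \<Otimes>\<^sub>M F)"
    by (rule borel_measurable_times[OF 2 1])
  from measurable_pair_swap[OF this]
  have "(\<lambda>(\<omega>, s). indicator {0..<t} s * V (X (max 0 s) \<omega>)) \<in> borel_measurable (F \<Otimes>\<^sub>M borel)"
    by (simp add: case_prod_unfold)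
  then have "(\<lambda>(\<omega>, s). indicator {0..<t} s * V (X (max 0 s) \<omega>)) \<in> borel_measurable (F \<Otimes>\<^sub>M lborel)"
    by (simp cong: measurable_cong_sets)
  then show ?thesis by (rule sigma_finite_measure.borel_measurable_lebesgue_integral[OF sigma_finite_lborel])
qed

lemma measurable_path: "\<omega> \<in> space F \<Longrightarrow> (\<lambda>s. X (max 0 s) \<omega>) \<in> borel \<rightarrow>\<^sub>M borel"
  using measurable_compose[OF measurable_Pair2'[of \<omega> F borel] measurable_X_pair'] by simp

lemma measurable_path_exp [measurable]:
  "V \<in> borel_measurable borel \<Longrightarrow> path_exp V t \<in> borel_measurable F"
  unfolding path_exp_def[abs_def] by measurable

text \<open>For a fixed shift s the exponential of the Riemann sum is a product along the grid s + k
  h, whose expectation is T s of the n-th iterate of \<open>step\<close> at x. Averaging over the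
  uniform shift turns this into \<open>average h\<close> of that iterate.\<close>

lemma nn_integral_path_exp_le:
  assumes V: "V \<in> bounded_borel" and h: "0 < h"
  shows "(\<integral>\<^sup>+\<omega>. ennreal (path_exp V (real n * h) \<omega>) \<partial>P x)
    \<le> ennreal (average h ((step (\<lambda>x. exp (h * V x)) h ^^ n) (\<lambda>x. 1)) x)"
proof -
  define v where "v y = exp (h * V y)" for y
  define G where "G = (step v h ^^ n) (\<lambda>x. 1)"
  have h0: "0 \<le> h" using h by simp
  note [measurable] = bounded_borel_measurable[OF V]
  obtain B where B: "0 \<le> B" "\<And>x. \<bar>V x\<bar> \<le> B" using bounded_borelD[OF V] by blast
  have v: "v \<in> bounded_borel"
  proof (rule bounded_borelI)
    show "\<bar>v x\<bar> \<le> exp (h * B)" for x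
      using B(2)[of x] h by (simp add: v_def abs_le_iff)
    show "v \<in> borel_measurable borel" unfolding v_def[abs_def] by measurable
  qed
  have v0: "0 \<le> v x" for x by (simp add: v_def)
  note [measurable] = bounded_borel_measurable[OF v]
  have G: "G \<in> bounded_borel" unfolding G_def by (rule funpow_step_bounded_borel[OF v h0])
  have G0: "0 \<le> G x" for x unfolding G_def by (rule funpow_step_nonneg[OF v v0 h0])
  interpret U: prob_space "unif h" by (rule prob_space_unif[OF h])
  interpret Px: prob_space "P x" by (rule prob_space_P)
  interpret pair_prob_space "unif h" "P x" ..
  let ?E = "\<lambda>s \<omega>. exp (h * (\<Sum>k<n. V (X (max 0 (real k * h + s)) \<omega>)))"
  have Em: "(\<lambda>p. ?E (fst p) (snd p)) \<in> borel_measurable (borel \<Otimes>\<^sub>M F)"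
  proof -
    have [measurable]: "(\<lambda>p. X (max 0 (real k * h + fst p)) (snd p)) \<in> borel \<Otimes>\<^sub>M F \<rightarrow>\<^sub>M borel" for k
    proof -
      have "(\<lambda>p. (real k * h + fst p, snd p)) \<in> borel \<Otimes>\<^sub>M F \<rightarrow>\<^sub>M borel \<Otimes>\<^sub>M F" by measurable
      from measurable_compose[OF this measurable_X_pair'] show ?thesis by simp
    qed
    show ?thesis by measurable
  qed
  have E1: "(\<integral>\<^sup>+\<omega>. ennreal (path_exp V (real n * h) \<omega>) \<partial>P x) \<le> (\<integral>\<^sup>+\<omega>. \<integral>\<^sup>+s. ennreal (?E s \<omega>) \<partial>unif h \<partial>P x)"
  proof (rule nn_integral_mono)
    fix \<omega> assume "\<omega> \<in> space (P x)"
    then have \<omega>: "\<omega> \<in> space F" by simp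
    have [measurable]: "(\<lambda>s. V (X (max 0 s) \<omega>)) \<in> borel_measurable borel"
      using measurable_path[OF \<omega>] by measurable
    have "path_exp V (real n * h) \<omega> \<le> (\<integral>s. ?E s \<omega> \<partial>unif h)"
      unfolding path_exp_def by (rule exp_integral_le_shifted_sums[OF h _ B(2)]) measurable
    also have "ennreal \<dots> = (\<integral>\<^sup>+s. ennreal (?E s \<omega>) \<partial>unif h)"
    proof (rule nn_integral_eq_integral[symmetric])
      have "?E s \<omega> \<le> exp (h * (\<Sum>k<n. B))" for s
        using B(2) h by (auto intro!: mult_left_mono sum_mono simp: abs_le_iff simp del: sum_constant)
      then show "integrable (unif h) (\<lambda>s. ?E s \<omega>)"
        by (intro U.integrable_const_bound[of _ "exp (h * (\<Sum>k<n. B))"]) auto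
    qed simp
    finally show "ennreal (path_exp V (real n * h) \<omega>) \<le> (\<integral>\<^sup>+s. ennreal (?E s \<omega>) \<partial>unif h)"
      by (simp add: ennreal_leI)
  qed
  also have "\<dots> = (\<integral>\<^sup>+s. \<integral>\<^sup>+\<omega>. ennreal (?E s \<omega>) \<partial>P x \<partial>unif h)"
  proof (rule Fubini')
    have "(\<lambda>p. ennreal (?E (fst p) (snd p))) \<in> borel_measurable (borel \<Otimes>\<^sub>M F)" using Em by measurable
    then show "(\<lambda>(s, \<omega>). ennreal (?E s \<omega>)) \<in> borel_measurable (unif h \<Otimes>\<^sub>M P x)"
      by (simp add: case_prod_unfold cong: measurable_cong_sets)
  qed
  also have "\<dots> = (\<integral>\<^sup>+s. ennreal (T (max 0 s) G x) \<partial>unif h)"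
  proof (rule nn_integral_cong_AE)
    show "AE s in unif h. (\<integral>\<^sup>+\<omega>. ennreal (?E s \<omega>) \<partial>P x) = ennreal (T (max 0 s) G x)"
      using AE_unif[OF h]
    proof eventually_elim
      case (elim s)
      have "(\<integral>\<^sup>+\<omega>. ennreal (?E s \<omega>) \<partial>P x)
          = (\<integral>\<^sup>+\<omega>. (\<Prod>k<n. ennreal (v (X (s + real k * h) \<omega>))) * 1 \<partial>P x)"
        using elim h0 by (intro nn_integral_cong)
          (simp add: prod_ennreal v0 v_def exp_sum[symmetric] sum_distrib_left add.commute max_def)
      also have "\<dots> = (\<integral>\<^sup>+y. (nn_step (\<lambda>x. ennreal (v x)) h ^^ n) (\<lambda>x. 1) y \<partial>K s x)"
        using elim by (intro nn_integral_product_path h0) auto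
      also have "\<dots> = (\<integral>\<^sup>+y. ennreal (G y) \<partial>K s x)"
        by (simp add: funpow_nn_step_eq[OF v v0 h0] G_def)
      also have "\<dots> = ennreal (T s G x)" using elim by (intro nn_integral_K_bounded G G0) auto
      finally show ?case using elim by (simp add: max_def)
    qed
  qed
  also have "\<dots> = ennreal (average h G x)"
  proof -
    obtain C where C: "\<And>x. \<bar>G x\<bar> \<le> C" using bounded_borelD[OF G] by blast
    have "\<bar>T (max 0 s) G x\<bar> \<le> C" for s
      by (rule abs_T_le[OF _ bounded_borel_measurable[OF G] C]) simp
    moreover have "0 \<le> T (max 0 s) G x" for s
      by (rule T_nonneg[OF _ bounded_borel_measurable[OF G] G0]) simp
    ultimately show ?thesis
      using T_measurable_time[OF bounded_borel_measurable[OF G], of x] unfolding average_def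
      by (intro nn_integral_eq_integral U.integrable_const_bound[of _ C]) auto
  qed
  finally show ?thesis by (simp add: G_def v_def[abs_def])
qed

text \<open>Cauchy-Schwarz separates the initial density from the n-th iterate, whose norm grows by
  at most a factor sqrt q per step. With h = t / n the second-order terms sum to a multiple of 1 /
  n, so only the first-order rate survives in the limit.\<close>

lemma exponential_moment_le:
  assumes P: "poincare \<mu> T c" and c: "0 < c" and u: "u \<in> bounded_borel" and a: "\<And>x. \<bar>u x - a\<bar> \<le> d / 2"
    and \<kappa>: "0 \<le> \<kappa>" and t: "0 < t" and f: "f \<in> L2 \<mu>" and f0: "\<And>x. 0 \<le> f x"
  shows "(\<integral>\<^sup>+x. ennreal (f x) * (\<integral>\<^sup>+\<omega>. ennreal (path_exp (\<lambda>x. \<kappa> * (u x - (\<integral>y. u y \<partial>\<mu>))) t \<omega>) \<partial>P x) \<partial>\<mu>)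
    \<le> ennreal (L2_norm \<mu> f * exp (t * (\<kappa>\<^sup>2 * d\<^sup>2 * c / 4)))"
proof -
  let ?N = "L2_norm \<mu>"
  define V where "V x = \<kappa> * (u x - (\<integral>y. u y \<partial>\<mu>))" for x
  define \<Lambda> where "\<Lambda> = \<kappa>\<^sup>2 * d\<^sup>2 * c / 4"
  have V: "V \<in> bounded_borel" unfolding V_def[abs_def]
    by (intro bounded_borel_scale bounded_borel_diff u bounded_borel_const)
  obtain M where M: "0 \<le> M" "\<And>x. \<bar>V x\<bar> \<le> M" using bounded_borelD[OF V] by blast
  let ?I = "\<integral>\<^sup>+x. ennreal (f x) * (\<integral>\<^sup>+\<omega>. ennreal (path_exp V t \<omega>) \<partial>P x) \<partial>\<mu>"
  have "\<forall>\<^sub>F n in sequentially. ?I \<le> ennreal (?N f * exp (t * \<Lambda> + 2 * t\<^sup>2 * M\<^sup>2 / real n))"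
  \<comment> \<open>From this n on, 2 h M \<le> 1, as the one-step estimate requires.\<close>
  proof (rule eventually_sequentiallyI[of "max 1 (nat \<lceil>2 * t * M\<rceil>)"])
    fix n assume n: "max 1 (nat \<lceil>2 * t * M\<rceil>) \<le> n"
    then have n0: "0 < real n" and nM: "2 * t * M \<le> real n" by linarith+
    define h where "h = t / real n"
    have "2 * h * M = 2 * t * M / real n" by (simp add: h_def)
    then have hM: "2 * h * M \<le> 1" using n0 nM by (simp add: divide_le_eq)
    have h: "0 < h" using t n0 by (simp add: h_def)
    have nh: "real n * h = t" using n0 by (simp add: h_def)
    define q where "q = 1 + 2 * h * \<Lambda> + 4 * h\<^sup>2 * M\<^sup>2"
    have \<Lambda>: "0 \<le> \<Lambda>" using c by (simp add: \<Lambda>_def)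
    have q0: "0 \<le> q" using h \<Lambda> by (simp add: q_def)
    define v where "v = (\<lambda>x. exp (h * V x))"
    have v: "v \<in> bounded_borel"
    proof (rule bounded_borelI)
      show "\<bar>v x\<bar> \<le> exp (h * M)" for x
        using M(2)[of x] h by (simp add: v_def abs_le_iff)
      show "v \<in> borel_measurable borel" unfolding v_def using bounded_borel_measurable[OF V] by measurable
    qed
    define G where "G j = (step v h ^^ j) (\<lambda>x. 1)" for j
    have G: "G j \<in> bounded_borel" for j unfolding G_def using h by (intro funpow_step_bounded_borel v) simp
    have Gn: "(?N (G j))\<^sup>2 \<le> q ^ j" for j
    proof (induction j)
      case 0
      show ?case by (simp add: G_def L2_norm_const)
    next
      case (Suc j)
      have "(?N (step v h (G j)))\<^sup>2 \<le> q * (?N (G j))\<^sup>2"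
        unfolding v_def V_def q_def \<Lambda>_def
        by (rule L2_norm_step_le[OF P c u a \<kappa> h G M(2)[unfolded V_def] hM])
      also have "\<dots> \<le> q * q ^ j" by (intro mult_left_mono Suc.IH q0)
      finally show ?case by (simp add: G_def)
    qed
    have "q \<le> exp (2 * h * \<Lambda> + 4 * h\<^sup>2 * M\<^sup>2)"
      using exp_ge_add_one_self[of "2 * h * \<Lambda> + 4 * h\<^sup>2 * M\<^sup>2"] unfolding q_def by linarith
    then have "q ^ n \<le> exp (2 * h * \<Lambda> + 4 * h\<^sup>2 * M\<^sup>2) ^ n"
      using q0 by (rule power_mono)
    also have "\<dots> = exp (real n * (2 * h * \<Lambda> + 4 * h\<^sup>2 * M\<^sup>2))" by (rule exp_of_nat_mult[symmetric])
    also have "real n * (2 * h * \<Lambda> + 4 * h\<^sup>2 * M\<^sup>2) = 2 * (t * \<Lambda> + 2 * t\<^sup>2 * M\<^sup>2 / real n)"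
      using n0 by (simp add: h_def field_simps power2_eq_square)
    finally have "(?N (G n))\<^sup>2 \<le> (exp (t * \<Lambda> + 2 * t\<^sup>2 * M\<^sup>2 / real n))\<^sup>2"
      using Gn[of n] unfolding exp_double by linarith
    then have NG: "?N (G n) \<le> exp (t * \<Lambda> + 2 * t\<^sup>2 * M\<^sup>2 / real n)"
      by (rule power2_le_imp_le) simp
    have A: "average h (G n) \<in> bounded_borel" by (rule average_bounded_borel[OF h G])
    have A0: "0 \<le> average h (G n) x" for x
      unfolding average_def
      using h by (intro Bochner_Integration.integral_nonneg T_nonneg bounded_borel_measurable[OF G])
        (auto simp: G_def v_def intro!: funpow_step_nonneg v[unfolded v_def])
    have fA: "integrable \<mu> (\<lambda>x. f x * average h (G n) x)"
      by (rule L2_mult_integrable[OF f bounded_borel_L2[OF A]])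
    have "?I \<le> (\<integral>\<^sup>+x. ennreal (f x) * ennreal (average h (G n) x) \<partial>\<mu>)"
      using nn_integral_path_exp_le[OF V h, where n=n]
      by (intro nn_integral_mono mult_left_mono) (simp_all add: nh G_def v_def)
    also have "\<dots> = (\<integral>\<^sup>+x. ennreal (f x * average h (G n) x) \<partial>\<mu>)"
      by (simp add: ennreal_mult' f0)
    also have "\<dots> = ennreal (\<integral>x. f x * average h (G n) x \<partial>\<mu>)"
      using fA by (rule nn_integral_eq_integral) (simp add: f0 A0)
    also have "\<dots> \<le> ennreal (?N f * exp (t * \<Lambda> + 2 * t\<^sup>2 * M\<^sup>2 / real n))"
    proof (rule ennreal_leI)
      have "(\<integral>x. f x * average h (G n) x \<partial>\<mu>) \<le> ?N f * ?N (average h (G n))"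
        using L2_Cauchy_Schwarz[OF f bounded_borel_L2[OF A]] by (simp add: L2_inner_def)
      also have "\<dots> \<le> ?N f * exp (t * \<Lambda> + 2 * t\<^sup>2 * M\<^sup>2 / real n)"
        using L2_norm_average_le[OF h G[of n]] NG by (intro mult_left_mono) auto
      finally show "(\<integral>x. f x * average h (G n) x \<partial>\<mu>) \<le> ?N f * exp (t * \<Lambda> + 2 * t\<^sup>2 * M\<^sup>2 / real n)" .
    qed
    finally show "?I \<le> ennreal (?N f * exp (t * \<Lambda> + 2 * t\<^sup>2 * M\<^sup>2 / real n))" .
  qed
  moreover have "(\<lambda>n. ennreal (?N f * exp (t * \<Lambda> + 2 * t\<^sup>2 * M\<^sup>2 / real n)))
      \<longlonglongrightarrow> ennreal (?N f * exp (t * \<Lambda> + 0))"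
    by (intro tendsto_ennrealI tendsto_intros tendsto_divide_0[OF tendsto_const]
        filterlim_at_top_imp_at_infinity filterlim_real_sequentially)
  ultimately have "?I \<le> ennreal (?N f * exp (t * \<Lambda> + 0))"
    by (intro tendsto_lowerbound[where F=sequentially]) auto
  then show ?thesis by (simp add: V_def[abs_def] \<Lambda>_def)
qed

section \<open>The Chernoff bound for time averages\<close>

lemma nn_integral_ac_eq:
  assumes \<beta>: "\<beta> \<in> space (prob_algebra borel)" and ac: "absolutely_continuous \<mu> \<beta>"
    and [measurable]: "\<phi> \<in> borel_measurable borel"
  shows "(\<integral>\<^sup>+x. \<phi> x \<partial>\<beta>) = (\<integral>\<^sup>+x. ennreal (enn2real (RN_deriv \<mu> \<beta> x)) * \<phi> x \<partial>\<mu>)"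
proof -
  have sets: "sets \<beta> = sets \<mu>" and pr: "prob_space \<beta>" using \<beta> by (auto simp: space_prob_algebra)
  have fin: "AE x in \<mu>. RN_deriv \<mu> \<beta> x \<noteq> \<infinity>"
    by (rule RN_deriv_finite[OF prob_space_imp_sigma_finite[OF pr] ac sets])
  have "(\<integral>\<^sup>+x. \<phi> x \<partial>\<beta>) = (\<integral>\<^sup>+x. \<phi> x \<partial>density \<mu> (RN_deriv \<mu> \<beta>))"
    by (simp add: density_RN_deriv[OF ac sets])
  also have "\<dots> = (\<integral>\<^sup>+x. RN_deriv \<mu> \<beta> x * \<phi> x \<partial>\<mu>)"
    by (rule nn_integral_density) (auto simp: borel_measurable_RN_deriv cong: measurable_cong_sets)
  also have "\<dots> = (\<integral>\<^sup>+x. ennreal (enn2real (RN_deriv \<mu> \<beta> x)) * \<phi> x \<partial>\<mu>)"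
    using fin by (intro nn_integral_cong_AE) (auto simp: less_top)
  finally show ?thesis .
qed

text \<open>The deviation event in the exponentiated form to which Markov's inequality applies. The
  closed and half-open time windows differ by the null point t, and the truncation of time at 0 is
  invisible inside the window.\<close>

lemma time_average_event:
  assumes u: "u \<in> bounded_borel" and t: "0 < t" and \<kappa>: "0 < \<kappa>" and \<omega>: "\<omega> \<in> space F"
  shows "1 / t * (LINT s:{0..t}|lborel. u (X s \<omega>)) - m \<ge> r \<longleftrightarrow>
    path_exp (\<lambda>x. \<kappa> * (u x - m)) t \<omega> \<ge> exp (\<kappa> * t * r)"
proof -
  note [measurable] = bounded_borel_measurable[OF u]
  obtain B where B: "\<And>x. \<bar>u x\<bar> \<le> B" using bounded_borelD[OF u] by blast
  have m: "(\<lambda>s. u (X (max 0 s) \<omega>)) \<in> borel_measurable borel"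
    using measurable_path[OF \<omega>] by measurable
  define S where "S = (\<integral>s. indicator {0..<t} s * u (X (max 0 s) \<omega>) \<partial>lborel)"
  have "(LINT s:{0..t}|lborel. u (X s \<omega>)) = (\<integral>s. indicator {0..t} s * u (X (max 0 s) \<omega>) \<partial>lborel)"
    unfolding set_lebesgue_integral_def
    by (intro Bochner_Integration.integral_cong) (auto simp: indicator_def)
  also have "\<dots> = S"
    unfolding S_def
  proof (rule integral_cong_AE)
    have "AE s in lborel. s \<noteq> t" by (rule AE_lborel_singleton)
    then show "AE s in lborel. indicator {0..t} s * u (X (max 0 s) \<omega>) = indicator {0..<t} s * u (X (max 0 s) \<omega>)"
      by eventually_elim (auto simp: indicator_def)
  qed (use m in auto)
  finally have eq: "(LINT s:{0..t}|lborel. u (X s \<omega>)) = S" .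
  have i: "integrable lborel (\<lambda>s. indicator {0..<t} s * u (X (max 0 s) \<omega>))"
    by (rule integrable_indicator_mult[OF m B])
  have "(\<integral>s. indicator {0..<t} s * (\<kappa> * (u (X (max 0 s) \<omega>) - m)) \<partial>lborel)
      = (\<integral>s. \<kappa> * (indicator {0..<t} s * u (X (max 0 s) \<omega>)) - \<kappa> * m * indicator {0..<t} s \<partial>lborel)"
    by (intro Bochner_Integration.integral_cong) (auto simp: algebra_simps)
  also have "\<dots> = \<kappa> * S - \<kappa> * m * t"
    using i t by (subst Bochner_Integration.integral_diff) (auto simp: S_def)
  finally have p: "path_exp (\<lambda>x. \<kappa> * (u x - m)) t \<omega> = exp (\<kappa> * (S - t * m))"
    by (simp add: path_exp_def algebra_simps)
  have "1 / t * S - m \<ge> r \<longleftrightarrow> t * r \<le> S - t * m" using t by (simp add: field_simps)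
  also have "\<dots> \<longleftrightarrow> \<kappa> * (t * r) \<le> \<kappa> * (S - t * m)" using \<kappa> by simp
  finally show ?thesis by (simp add: eq p mult.assoc)
qed

lemma deviation_pos:
  assumes P: "poincare \<mu> T c" and c: "0 < c" and u: "u \<in> borel_measurable borel" and bu: "bounded (range u)"
    and d: "0 < oscillation u" and t: "0 < t" and r: "0 < r"
    and \<beta>: "\<beta> \<in> space (prob_algebra borel)" and ac: "absolutely_continuous \<mu> \<beta>"
    and f: "(\<lambda>x. enn2real (RN_deriv \<mu> \<beta> x)) \<in> L2 \<mu>"
  shows "measure (\<beta> \<bind> P) {\<omega> \<in> space F. 1 / t * (LINT s:{0..t}|lborel. u (X s \<omega>)) - (\<integral>x. u x \<partial>\<mu>) \<ge> r}
    \<le> L2_norm \<mu> (\<lambda>x. enn2real (RN_deriv \<mu> \<beta> x)) * exp (- (t * r\<^sup>2 / (c * (oscillation u)\<^sup>2)))"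
proof -
  let ?d = "oscillation u" and ?f = "\<lambda>x. enn2real (RN_deriv \<mu> \<beta> x)"
  obtain a where a: "\<And>x. \<bar>u x - a\<bar> \<le> ?d / 2" using oscillation_center[OF bu] by blast
  obtain B where "\<And>x. \<bar>u x\<bar> \<le> B" using bu by (auto simp: bounded_iff)
  then have u: "u \<in> bounded_borel" using u by (intro bounded_borelI)
  \<comment> \<open>The minimiser of -\<kappa> t r + t \<kappa>^2 d^2 c / 4, with d the oscillation;
    the minimum is -\<kappa> t r / 2 = -t r^2 / (c d^2).\<close>
  define \<kappa> where "\<kappa> = 2 * r / (c * ?d\<^sup>2)"
  have \<kappa>: "0 < \<kappa>" using r c d by (simp add: \<kappa>_def)
  define V where "V x = \<kappa> * (u x - (\<integral>y. u y \<partial>\<mu>))" for x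
  have V [measurable]: "V \<in> borel_measurable borel"
    unfolding V_def[abs_def] using bounded_borel_measurable[OF u] by measurable
  define E where "E = {\<omega> \<in> space F. 1 / t * (LINT s:{0..t}|lborel. u (X s \<omega>)) - (\<integral>x. u x \<partial>\<mu>) \<ge> r}"
  have E_eq: "E = {\<omega> \<in> space F. path_exp V t \<omega> \<ge> exp (\<kappa> * t * r)}"
    unfolding E_def V_def[abs_def] using time_average_event[OF u t \<kappa>] by auto
  have EF [measurable]: "E \<in> sets F" unfolding E_eq by measurable
  have sets_\<beta> [measurable_cong]: "sets \<beta> = sets borel" and pr: "prob_space \<beta>"
    using \<beta> by (auto simp: space_prob_algebra)
  have P\<beta>: "P \<in> \<beta> \<rightarrow>\<^sub>M subprob_algebra F" by (simp cong: measurable_cong_sets)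
  have ne: "space \<beta> \<noteq> {}" using prob_space.not_empty[OF pr] .
  have sets_bP [measurable_cong]: "sets (\<beta> \<bind> P) = sets F"
    by (rule sets_bind[OF _ ne]) simp
  have \<phi>: "(\<lambda>x. \<integral>\<^sup>+\<omega>. ennreal (path_exp V t \<omega>) \<partial>P x) \<in> borel_measurable borel"
    by (rule nn_integral_measurable_subprob_algebra2[where N=F]) measurable
  have "emeasure (\<beta> \<bind> P) E = (\<integral>\<^sup>+\<omega>. indicator E \<omega> \<partial>(\<beta> \<bind> P))" by (simp add: sets_bP)
  also have "\<dots> \<le> (\<integral>\<^sup>+\<omega>. ennreal (exp (- (\<kappa> * t * r))) * ennreal (path_exp V t \<omega>) \<partial>(\<beta> \<bind> P))"
  proof (rule nn_integral_mono)
    fix \<omega>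
    have "1 \<le> ennreal (exp (- (\<kappa> * t * r)) * path_exp V t \<omega>)" if "\<omega> \<in> E"
    proof -
      have "exp (- (\<kappa> * t * r)) * exp (\<kappa> * t * r) \<le> exp (- (\<kappa> * t * r)) * path_exp V t \<omega>"
        using that by (intro mult_left_mono) (auto simp: E_eq)
      then show ?thesis by (simp add: exp_add[symmetric])
    qed
    then show "indicator E \<omega> \<le> ennreal (exp (- (\<kappa> * t * r))) * ennreal (path_exp V t \<omega>)"
      by (cases "\<omega> \<in> E") (auto simp: ennreal_mult')
  qed
  also have "\<dots> = ennreal (exp (- (\<kappa> * t * r))) * (\<integral>\<^sup>+\<omega>. ennreal (path_exp V t \<omega>) \<partial>(\<beta> \<bind> P))"
    by (rule nn_integral_cmult) measurable
  also have "(\<integral>\<^sup>+\<omega>. ennreal (path_exp V t \<omega>) \<partial>(\<beta> \<bind> P))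
      = (\<integral>\<^sup>+x. \<integral>\<^sup>+\<omega>. ennreal (path_exp V t \<omega>) \<partial>P x \<partial>\<beta>)"
    by (rule nn_integral_bind[OF _ P\<beta>]) measurable
  also have "\<dots> = (\<integral>\<^sup>+x. ennreal (?f x) * (\<integral>\<^sup>+\<omega>. ennreal (path_exp V t \<omega>) \<partial>P x) \<partial>\<mu>)"
    by (rule nn_integral_ac_eq[OF \<beta> ac \<phi>])
  also have "\<dots> \<le> ennreal (L2_norm \<mu> ?f * exp (t * (\<kappa>\<^sup>2 * ?d\<^sup>2 * c / 4)))"
    unfolding V_def using \<kappa> by (intro exponential_moment_le[OF P c u a _ t f]) auto
  finally have "emeasure (\<beta> \<bind> P) E \<le> ennreal (exp (- (\<kappa> * t * r))) * ennreal (L2_norm \<mu> ?f * exp (t * (\<kappa>\<^sup>2 * ?d\<^sup>2 * c / 4)))"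
    by (simp add: mult_left_mono)
  also have "\<dots> = ennreal (L2_norm \<mu> ?f * exp (- (t * r\<^sup>2 / (c * ?d\<^sup>2))))"
  proof -
    have "\<kappa> * (c * ?d\<^sup>2) = 2 * r" using c d by (simp add: \<kappa>_def)
    then have "t * (\<kappa>\<^sup>2 * ?d\<^sup>2 * c / 4) = \<kappa> * t * r / 2"
      by (simp add: power2_eq_square mult.commute mult.left_commute)
    moreover have "\<kappa> * t * r / 2 = t * r\<^sup>2 / (c * ?d\<^sup>2)" by (simp add: \<kappa>_def power2_eq_square)
    ultimately have "exp (- (\<kappa> * t * r)) * exp (t * (\<kappa>\<^sup>2 * ?d\<^sup>2 * c / 4)) = exp (- (t * r\<^sup>2 / (c * ?d\<^sup>2)))"
      unfolding exp_add[symmetric] by simp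
    then show ?thesis
      by (simp add: ennreal_mult[symmetric] mult.left_commute)
  qed
  finally have "enn2real (emeasure (\<beta> \<bind> P) E) \<le> L2_norm \<mu> ?f * exp (- (t * r\<^sup>2 / (c * ?d\<^sup>2)))"
    by (rule enn2real_leI[rotated]) simp
  then show ?thesis by (simp add: measure_def E_def)
qed

lemma poincare_mono:
  assumes "poincare \<mu> T c" "c \<le> c'"
  shows "poincare \<mu> T c'"
  using assms mult_right_mono[OF assms(2) pre_form_nonneg] unfolding poincare_def by fastforce

text \<open>In the degenerate cases the claimed bound is 0. If the oscillation vanishes, u is
  constant and r > 0 empties the event. If c = 0, the Poincare inequality holds with every constant
  e > 0, and the corresponding bounds tend to 0 with e.\<close>

lemma deviation_inequality:
  assumes P: "poincare \<mu> T c" and u: "u \<in> borel_measurable borel" and bu: "bounded (range u)"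
    and t: "0 < t" and r: "0 < r"
    and \<beta>: "\<beta> \<in> space (prob_algebra borel)" and ac: "absolutely_continuous \<mu> \<beta>"
    and f: "(\<lambda>x. enn2real (RN_deriv \<mu> \<beta> x)) \<in> L2 \<mu>"
  shows "measure (\<beta> \<bind> P) {\<omega> \<in> space F. 1 / t * (LINT s:{0..t}|lborel. u (X s \<omega>)) - (\<integral>x. u x \<partial>\<mu>) \<ge> r}
    \<le> L2_norm \<mu> (\<lambda>x. enn2real (RN_deriv \<mu> \<beta> x)) * deviation_bound c (oscillation u) t r"
proof -
  let ?f = "\<lambda>x. enn2real (RN_deriv \<mu> \<beta> x)"
  let ?p = "measure (\<beta> \<bind> P) {\<omega> \<in> space F. 1 / t * (LINT s:{0..t}|lborel. u (X s \<omega>)) - (\<integral>x. u x \<partial>\<mu>) \<ge> r}"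
  have c: "0 \<le> c" using P by (simp add: poincare_def)
  have d: "0 \<le> oscillation u" using oscillation_ge[OF bu, of undefined undefined] by simp
  consider "oscillation u = 0" | "0 < oscillation u" "0 < c" | "0 < oscillation u" "c = 0"
    using c d by linarith
  then show ?thesis
  proof cases
    case 1
    have "u x = u undefined" for x using oscillation_ge[OF bu, of x undefined] 1 by simp
    then have "u = (\<lambda>x. u undefined)" by blast
    then obtain b where b: "u = (\<lambda>x. b)" by blast
    have "1 / t * (LINT s:{0..t}|lborel. u (X s \<omega>)) - (\<integral>x. u x \<partial>\<mu>) = 0" for \<omega>
      using t by (simp add: b set_lebesgue_integral_def)
    then have "?p = 0" using r by (simp add: not_le[symmetric])
    then show ?thesis by (simp add: deviation_bound_def 1)
  next
    case 2
    then show ?thesis using deviation_pos[OF P 2(2) u bu 2(1) t r \<beta> ac f] by (simp add: deviation_bound_def)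
  next
    case 3
    have "\<forall>\<^sub>F e in at_right 0. ?p \<le> L2_norm \<mu> ?f * exp (- (t * r\<^sup>2 / (oscillation u)\<^sup>2 / e))"
    proof (rule eventually_at_right_less[THEN eventually_mono])
      fix e :: real assume e: "0 < e"
      have "poincare \<mu> T e" using poincare_mono[OF P] 3 e by simp
      from deviation_pos[OF this e u bu 3(1) t r \<beta> ac f]
      show "?p \<le> L2_norm \<mu> ?f * exp (- (t * r\<^sup>2 / (oscillation u)\<^sup>2 / e))"
        by (simp add: mult.commute)
    qed
    moreover have "((\<lambda>e. L2_norm \<mu> ?f * exp (- (t * r\<^sup>2 / (oscillation u)\<^sup>2 / e))) \<longlongrightarrow> L2_norm \<mu> ?f * 0) (at_right 0)"
    proof (intro tendsto_mult tendsto_const filterlim_compose[OF exp_at_bot])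
      have "0 < t * r\<^sup>2 / (oscillation u)\<^sup>2" using t r 3 by simp
      then have "filterlim (\<lambda>e. t * r\<^sup>2 / (oscillation u)\<^sup>2 / e) at_top (at_right 0)"
        unfolding divide_inverse[of _ "_ :: real"]
        by (intro filterlim_tendsto_pos_mult_at_top[OF tendsto_const] filterlim_inverse_at_top_right)
      from filterlim_compose[OF filterlim_uminus_at_bot_at_top this]
      show "filterlim (\<lambda>e. - (t * r\<^sup>2 / (oscillation u)\<^sup>2 / e)) at_bot (at_right 0)" .
    qed
    ultimately have "?p \<le> L2_norm \<mu> ?f * 0" by (intro tendsto_lowerbound) auto
    then show ?thesis using 3 by (simp add: deviation_bound_def)
  qed
qed

end

section \<open>Total variation and the trivial Wasserstein distance\<close>

lemma emeasure_unif_lessThan: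
  assumes "0 \<le> p" "p \<le> 1"
  shows "emeasure (unif 1) {..<p} = ennreal p"
proof -
  have "emeasure (unif 1) {..<p} = (\<integral>\<^sup>+s. indicator {..<p} s \<partial>unif 1)" by simp
  also have "\<dots> = (\<integral>\<^sup>+s. ennreal (indicator {0..<1} s / 1) * indicator {..<p} s \<partial>lborel)"
    by (rule nn_integral_unif) auto
  also have "\<dots> = (\<integral>\<^sup>+s. indicator {0..<p} s \<partial>lborel)"
    using assms by (intro nn_integral_cong) (auto simp: indicator_def)
  finally show ?thesis using assms by simp
qed

lemma nn_integral_unif_split:
  fixes a b :: ennreal
  assumes p: "0 \<le> p" "p \<le> 1"
  shows "(\<integral>\<^sup>+s. (if s < p then a else b) \<partial>unif 1) = ennreal p * a + ennreal (1 - p) * b"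
proof -
  interpret U: prob_space "unif 1" by (rule prob_space_unif) simp
  have 1: "emeasure (unif 1) {p..} = ennreal (1 - p)"
  proof -
    have "emeasure (unif 1) (space (unif 1) - {..<p}) = emeasure (unif 1) (space (unif 1)) - emeasure (unif 1) {..<p}"
      by (rule emeasure_compl) (auto simp: U.emeasure_eq_measure)
    moreover have "space (unif 1) - {..<p} = {p..}" by auto
    ultimately show ?thesis
      using p U.emeasure_space_1 by (simp add: emeasure_unif_lessThan ennreal_minus[symmetric])
  qed
  have "(\<integral>\<^sup>+s. (if s < p then a else b) \<partial>unif 1)
      = (\<integral>\<^sup>+s. a * indicator {..<p} s + b * indicator {p..} s \<partial>unif 1)"
    by (intro nn_integral_cong) (auto simp: indicator_def)
  also have "\<dots> = a * emeasure (unif 1) {..<p} + b * emeasure (unif 1) {p..}"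
    by (subst nn_integral_add) (auto simp: nn_integral_cmult)
  finally show ?thesis using p by (simp add: 1 emeasure_unif_lessThan mult.commute)
qed

context stationary_ergodic_markov_process
begin

lemma integral_u_bound:
  fixes u :: "'x \<Rightarrow> real"
  assumes \<nu>: "\<nu> \<in> space (prob_algebra borel)" and u: "u \<in> borel_measurable borel" "\<And>x. \<bar>u x\<bar> \<le> 1"
  shows "\<bar>\<integral>x. u x \<partial>\<nu>\<bar> \<le> 1"
proof -
  have "prob_space \<nu>" "sets \<nu> = sets borel" using \<nu> by (auto simp: space_prob_algebra)
  then show ?thesis using u by (intro abs_prob_integral_le) (auto cong: measurable_cong_sets)
qed

lemma mu_prob_algebra: "\<mu> \<in> space (prob_algebra borel)"
  by (simp add: space_prob_algebra prob_space_axioms)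

lemma tv_norm_upper:
  assumes \<nu>: "\<nu> \<in> space (prob_algebra borel)" and u: "u \<in> borel_measurable borel" "\<And>x. \<bar>u x\<bar> \<le> 1"
  shows "(\<integral>x. u x \<partial>\<nu>) - (\<integral>x. u x \<partial>\<mu>) \<le> tv_norm \<nu> \<mu>"
proof -
  have 1: "u \<in> {u \<in> borel_measurable borel. \<forall>x. \<bar>u x\<bar> \<le> 1}" using u by simp
  have 2: "bdd_above ((\<lambda>u :: 'x \<Rightarrow> real. (\<integral>x. u x \<partial>\<nu>) - (\<integral>x. u x \<partial>\<mu>)) ` {u \<in> borel_measurable borel. \<forall>x. \<bar>u x\<bar> \<le> 1})"
  proof (rule bdd_aboveI2)
    fix u :: "'x \<Rightarrow> real"
    assume "u \<in> {u \<in> borel_measurable borel. \<forall>x. \<bar>u x\<bar> \<le> 1}"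
    then show "(\<integral>x. u x \<partial>\<nu>) - (\<integral>x. u x \<partial>\<mu>) \<le> 2"
      using integral_u_bound[OF \<nu>, of u] integral_u_bound[OF mu_prob_algebra, of u] by auto
  qed
  show ?thesis unfolding tv_norm_def using cSUP_upper[OF 1 2] by simp
qed

lemma tv_norm_least:
  assumes "\<And>u. u \<in> borel_measurable borel \<Longrightarrow> (\<And>x. \<bar>u x\<bar> \<le> 1) \<Longrightarrow> (\<integral>x. u x \<partial>\<nu>) - (\<integral>x. u x \<partial>\<mu>) \<le> C"
  shows "tv_norm \<nu> \<mu> \<le> C"
  unfolding tv_norm_def
proof (rule cSUP_least)
qed (use assms in \<open>auto intro!: exI[of _ "\<lambda>x. 0"]\<close>)

lemma tv_norm_nonneg: "\<nu> \<in> space (prob_algebra borel) \<Longrightarrow> 0 \<le> tv_norm \<nu> \<mu>"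
  using tv_norm_upper[of \<nu> "\<lambda>x. 0"] by simp

lemma
  assumes \<nu>: "\<nu> \<in> space (prob_algebra borel)" and ac: "absolutely_continuous \<mu> \<nu>"
  defines "f \<equiv> \<lambda>x. enn2real (RN_deriv \<mu> \<nu> x)"
  shows density_eq: "\<nu> = density \<mu> (\<lambda>x. ennreal (f x))"
    and density_measurable: "f \<in> borel_measurable borel"
    and density_integrable: "integrable \<mu> f"
    and density_integral: "(\<integral>x. f x \<partial>\<mu>) = 1"
proof -
  have sets: "sets \<nu> = sets \<mu>" and pr: "prob_space \<nu>" using \<nu> by (auto simp: space_prob_algebra)
  have RNm: "RN_deriv \<mu> \<nu> \<in> borel_measurable borel"
    using borel_measurable_RN_deriv[of \<mu> \<nu>] by (simp cong: measurable_cong_sets)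
  have fin: "AE x in \<mu>. RN_deriv \<mu> \<nu> x \<noteq> \<infinity>"
    by (rule RN_deriv_finite[OF prob_space_imp_sigma_finite[OF pr] ac sets])
  show fm: "f \<in> borel_measurable borel" unfolding f_def using RNm by measurable
  have "density \<mu> (\<lambda>x. ennreal (f x)) = density \<mu> (RN_deriv \<mu> \<nu>)"
    using fin RNm by (intro density_cong) (auto simp: f_def less_top)
  then show eq: "\<nu> = density \<mu> (\<lambda>x. ennreal (f x))" by (simp add: density_RN_deriv[OF ac sets])
  have "(\<integral>\<^sup>+x. ennreal (f x) \<partial>\<mu>) = emeasure (density \<mu> (\<lambda>x. ennreal (f x))) (space \<mu>)"
    using fm by (simp add: emeasure_density)
  also have "\<dots> = 1"
    using prob_space.emeasure_space_1[OF pr] sets_eq_imp_space_eq[OF sets] by (simp flip: eq)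
  finally have 1: "(\<integral>\<^sup>+x. ennreal (f x) \<partial>\<mu>) = 1" .
  then show i: "integrable \<mu> f"
    using fm by (intro integrableI_nonneg) (auto simp: f_def)
  show "(\<integral>x. f x \<partial>\<mu>) = 1"
    using 1 nn_integral_eq_integral[OF i] by (simp add: f_def)
qed

text \<open>With f = d\<nu>/d\<mu> the supremum is over integrals of u (f - 1), and it is attained
  at u = sgn (f - 1).\<close>

lemma tv_norm_eq:
  assumes \<nu>: "\<nu> \<in> space (prob_algebra borel)" and ac: "absolutely_continuous \<mu> \<nu>"
  shows "tv_norm \<nu> \<mu> = (\<integral>x. \<bar>enn2real (RN_deriv \<mu> \<nu> x) - 1\<bar> \<partial>\<mu>)"
proof -
  define f where "f = (\<lambda>x. enn2real (RN_deriv \<mu> \<nu> x))"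
  note f = density_eq[OF \<nu> ac, folded f_def] density_measurable[OF \<nu> ac, folded f_def]
    density_integrable[OF \<nu> ac, folded f_def]
  note [measurable] = f(2)
  have f1: "integrable \<mu> (\<lambda>x. f x - 1)" using f(3) by simp
  have int: "integrable \<mu> (\<lambda>x. u x * (f x - 1))" "(\<integral>x. u x \<partial>\<nu>) - (\<integral>x. u x \<partial>\<mu>) = (\<integral>x. u x * (f x - 1) \<partial>\<mu>)"
    if [measurable]: "u \<in> borel_measurable borel" and b: "\<And>x. \<bar>u x\<bar> \<le> 1" for u
  proof -
    have bd: "integrable \<mu> (\<lambda>x. u x * g x)" if "integrable \<mu> g" for g
    proof (rule Bochner_Integration.integrable_bound[OF that])
      show "AE x in \<mu>. norm (u x * g x) \<le> norm (g x)"
        using mult_right_mono[OF b] by (intro AE_I2) (simp add: abs_mult)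
    qed (use borel_measurable_integrable[OF that] in auto)
    show "integrable \<mu> (\<lambda>x. u x * (f x - 1))" by (rule bd[OF f1])
    have "(\<integral>x. u x \<partial>\<nu>) = (\<integral>x. f x * u x \<partial>\<mu>)"
      by (subst f(1), subst integral_density) (auto simp: f_def)
    moreover have "integrable \<mu> u" using bd[of "\<lambda>x. 1"] by simp
    ultimately show "(\<integral>x. u x \<partial>\<nu>) - (\<integral>x. u x \<partial>\<mu>) = (\<integral>x. u x * (f x - 1) \<partial>\<mu>)"
      using bd[OF f(3)] by (simp add: right_diff_distrib mult.commute)
  qed
  show ?thesis
    unfolding f_def[symmetric, THEN fun_cong]
  proof (rule antisym)
    show "tv_norm \<nu> \<mu> \<le> (\<integral>x. \<bar>f x - 1\<bar> \<partial>\<mu>)"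
    proof (rule tv_norm_least)
      fix u :: "'x \<Rightarrow> real"
      assume u: "u \<in> borel_measurable borel" "\<And>x. \<bar>u x\<bar> \<le> 1"
      have "(\<integral>x. u x * (f x - 1) \<partial>\<mu>) \<le> (\<integral>x. \<bar>f x - 1\<bar> \<partial>\<mu>)"
      proof (rule integral_mono[OF int(1)[OF u]])
        show "integrable \<mu> (\<lambda>x. \<bar>f x - 1\<bar>)" using f1 by simp
        show "u x * (f x - 1) \<le> \<bar>f x - 1\<bar>" for x
          using mult_right_mono[OF u(2)[of x], of "\<bar>f x - 1\<bar>"] by (simp add: abs_mult[symmetric])
      qed
      then show "(\<integral>x. u x \<partial>\<nu>) - (\<integral>x. u x \<partial>\<mu>) \<le> (\<integral>x. \<bar>f x - 1\<bar> \<partial>\<mu>)" by (simp add: int(2)[OF u])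
    qed
    define u where "u x = sgn (f x - 1)" for x
    have u: "u \<in> borel_measurable borel"
      unfolding u_def[abs_def] by measurable
    have u1: "\<And>x. \<bar>u x\<bar> \<le> 1" by (simp add: u_def sgn_if)
    have "(\<integral>x. u x * (f x - 1) \<partial>\<mu>) = (\<integral>x. \<bar>f x - 1\<bar> \<partial>\<mu>)"
      by (simp add: u_def abs_sgn mult.commute)
    then show "(\<integral>x. \<bar>f x - 1\<bar> \<partial>\<mu>) \<le> tv_norm \<nu> \<mu>"
      using tv_norm_upper[OF \<nu> u u1] int(2)[OF u u1] by simp
  qed
qed

lemma tv_norm_le_fisher_info:
  assumes P: "poincare \<mu> T c" and \<nu>: "\<nu> \<in> space (prob_algebra borel)"
  shows "ereal ((tv_norm \<nu> \<mu>)\<^sup>2) \<le> info_scale (4 * c) (fisher_info \<mu> T \<nu>)"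
proof -
  define h where "h = (\<lambda>x. sqrt (enn2real (RN_deriv \<mu> \<nu> x)))"
  show ?thesis
  proof (cases "absolutely_continuous \<mu> \<nu> \<and> h \<in> form_domain \<mu> T")
    case True
    then have ac: "absolutely_continuous \<mu> \<nu>" and h: "h \<in> form_domain \<mu> T" by auto
    have hL: "h \<in> L2 \<mu>" using h by (simp add: form_domain_def)
    have h2: "(h x)\<^sup>2 = enn2real (RN_deriv \<mu> \<nu> x)" for x by (simp add: h_def)
    have h1: "(L2_norm \<mu> h)\<^sup>2 = 1"
      using density_integral[OF \<nu> ac] by (simp add: L2_norm_power2 h2)
    have "(tv_norm \<nu> \<mu>)\<^sup>2 \<le> 4 * Var \<mu> h"
      using integral_abs_square_diff_le[OF hL] by (simp add: h1 h2 tv_norm_eq[OF \<nu> ac])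
    also have "\<dots> \<le> 4 * c * dirichlet_form \<mu> T h"
      using poincare_form_domain[OF P h] by simp
    finally show ?thesis
      using True by (simp add: fisher_info_def info_scale_def h_def Let_def)
  next
    case False
    then show ?thesis by (auto simp: fisher_info_def info_scale_def h_def Let_def)
  qed
qed

section \<open>Couplings for the trivial metric\<close>

lemma sets_diagonal: "{p :: 'x \<times> 'x. fst p \<noteq> snd p} \<in> sets (borel \<Otimes>\<^sub>M borel)"
proof -
  have "closed {p :: 'x \<times> 'x. fst p = snd p}"
    by (intro closed_Collect_eq continuous_intros)
  then have "- {p :: 'x \<times> 'x. fst p = snd p} \<in> sets borel" by (intro borel_open open_Compl)
  moreover have "- {p :: 'x \<times> 'x. fst p = snd p} = {p. fst p \<noteq> snd p}" by auto
  \<comment> \<open>A Polish space is second countable, so the product \<sigma>-field is the Borel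
    \<sigma>-field of the product and contains the open complement of the diagonal.\<close>
  ultimately show ?thesis unfolding borel_prod by metis
qed

lemma trivial_metric_indicator:
  "ennreal (trivial_metric (fst p) (snd p)) = indicator {p. fst p \<noteq> snd p} p"
  by (auto simp: trivial_metric_def indicator_def)

text \<open>The values of u at the two coordinates differ only off the diagonal, and there by at
  most 2.\<close>

lemma tv_norm_le_coupling:
  assumes \<pi>: "\<pi> \<in> couplings \<nu> \<mu>"
  shows "ennreal (tv_norm \<nu> \<mu> / 2) \<le> (\<integral>\<^sup>+z. ennreal (trivial_metric (fst z) (snd z)) \<partial>\<pi>)"
proof -
  have sets [measurable_cong]: "sets \<pi> = sets (borel \<Otimes>\<^sub>M borel)" and pr: "prob_space \<pi>"
    and d1: "distr \<pi> borel fst = \<nu>" and d2: "distr \<pi> borel snd = \<mu>"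
    using \<pi> by (auto simp: couplings_def space_prob_algebra)
  interpret \<pi>: prob_space \<pi> by (rule pr)
  let ?D = "{p :: 'x \<times> 'x. fst p \<noteq> snd p}"
  have D [measurable]: "?D \<in> sets \<pi>" using sets_diagonal by (simp add: sets)
  have "tv_norm \<nu> \<mu> \<le> 2 * measure \<pi> ?D"
  proof (rule tv_norm_least)
    fix u :: "'x \<Rightarrow> real"
    assume [measurable]: "u \<in> borel_measurable borel" and b: "\<And>x. \<bar>u x\<bar> \<le> 1"
    have i: "integrable \<pi> (\<lambda>p. u (fst p))" "integrable \<pi> (\<lambda>p. u (snd p))"
      using b by (auto intro!: \<pi>.integrable_const_bound[of _ 1])
    have "(\<integral>x. u x \<partial>\<nu>) - (\<integral>x. u x \<partial>\<mu>) = (\<integral>p. u (fst p) - u (snd p) \<partial>\<pi>)"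
      using i by (simp add: integral_distr flip: d1 d2)
    also have "\<dots> \<le> (\<integral>p. 2 * indicator ?D p \<partial>\<pi>)"
    proof (rule integral_mono)
      fix p
      show "u (fst p) - u (snd p) \<le> 2 * indicator ?D p"
        using b[of "fst p"] b[of "snd p"] by (auto simp: indicator_def abs_le_iff)
    qed (use i D in \<open>auto simp: less_top[symmetric]\<close>)
    also have "\<dots> = 2 * measure \<pi> ?D" using D by simp
    finally show "(\<integral>x. u x \<partial>\<nu>) - (\<integral>x. u x \<partial>\<mu>) \<le> 2 * measure \<pi> ?D" .
  qed
  then have "ennreal (tv_norm \<nu> \<mu> / 2) \<le> emeasure \<pi> ?D"
    by (simp add: \<pi>.emeasure_eq_measure ennreal_leI)
  then show ?thesis using D by (simp add: trivial_metric_indicator)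
qed

text \<open>Maximal coupling: with \<open>f = d\<nu>/d\<mu>\<close>, keep the \<open>\<mu>\<close>-distributed point \<open>y\<close> with probability
  \<open>min (f y) 1\<close> and replace it by a draw from the normalised \<open>(f - 1)\<^sup>+ \<mu>\<close> otherwise.\<close>

lemma maximal_coupling:
  assumes \<nu>: "\<nu> \<in> space (prob_algebra borel)" and ac: "absolutely_continuous \<mu> \<nu>"
  shows "\<exists>\<pi> \<in> couplings \<nu> \<mu>. (\<integral>\<^sup>+z. ennreal (trivial_metric (fst z) (snd z)) \<partial>\<pi>) \<le> ennreal (tv_norm \<nu> \<mu> / 2)"
proof -
  define f where "f = (\<lambda>x. enn2real (RN_deriv \<mu> \<nu> x))"
  note f = density_eq[OF \<nu> ac, folded f_def] density_measurable[OF \<nu> ac, folded f_def]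
    density_integrable[OF \<nu> ac, folded f_def] density_integral[OF \<nu> ac, folded f_def]
  note [measurable] = f(2)
  have f0: "0 \<le> f x" for x by (simp add: f_def)
  define p where "p x = min (f x) 1" for x
  define e where "e x = max 0 (f x - 1)" for x
  define \<delta> where "\<delta> = (\<integral>x. e x \<partial>\<mu>)"
  have [measurable]: "p \<in> borel_measurable borel" "e \<in> borel_measurable borel"
    unfolding p_def[abs_def] e_def[abs_def] by measurable
  have p01: "0 \<le> p x" "p x \<le> 1" and e0: "0 \<le> e x" and pe: "p x + e x = f x" for x
    using f0[of x] by (auto simp: p_def e_def)
  have pint: "integrable \<mu> p" using p01 by (intro integrable_const_bound[of _ 1]) auto
  have eint: "integrable \<mu> e"
    using Bochner_Integration.integrable_diff[OF f(3) pint] by (simp add: pe[symmetric])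
  have "(\<integral>x. p x \<partial>\<mu>) + \<delta> = (\<integral>x. p x + e x \<partial>\<mu>)"
    using pint eint by (simp add: \<delta>_def)
  also have "\<dots> = 1" using f(4) by (simp add: pe)
  finally have dp: "(\<integral>x. 1 - p x \<partial>\<mu>) = \<delta>" using pint by simp
  have \<delta>0: "0 \<le> \<delta>" using e0 by (simp add: \<delta>_def)
  have tv: "tv_norm \<nu> \<mu> = 2 * \<delta>"
  proof -
    have "\<bar>f x - 1\<bar> = e x + (1 - p x)" for x by (auto simp: p_def e_def)
    then have "tv_norm \<nu> \<mu> = (\<integral>x. e x + (1 - p x) \<partial>\<mu>)"
      using tv_norm_eq[OF \<nu> ac] by (simp add: f_def)
    also have "\<dots> = \<delta> + (\<integral>x. 1 - p x \<partial>\<mu>)" unfolding \<delta>_def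
      using eint pint by (intro Bochner_Integration.integral_add) auto
    finally show ?thesis by (simp add: dp)
  qed
  \<comment> \<open>The normalised excess (f - 1)^+ \<mu>. If \<delta> = 0 there is no excess to
    normalise; \<mu> is then a placeholder, drawn with total probability \<delta> = 0.\<close>
  define \<rho> where "\<rho> = (if \<delta> = 0 then \<mu> else density \<mu> (\<lambda>x. ennreal (e x / \<delta>)))"
  have sets_\<rho> [measurable_cong]: "sets \<rho> = sets borel" by (simp add: \<rho>_def)
  have \<rho>_eq: "ennreal \<delta> * emeasure \<rho> A = (\<integral>\<^sup>+x. ennreal (e x) * indicator A x \<partial>\<mu>)" if [measurable]: "A \<in> sets borel" for A
  proof (cases "\<delta> = 0")
    case True
    then have "AE x in \<mu>. e x = 0"
      using integral_nonneg_eq_0_iff_AE[OF eint] e0 by (simp add: \<delta>_def)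
    then have "(\<integral>\<^sup>+x. ennreal (e x) * indicator A x \<partial>\<mu>) = (\<integral>\<^sup>+x. 0 \<partial>\<mu>)"
      by (intro nn_integral_cong_AE) auto
    then show ?thesis using True by simp
  next
    case False
    have "ennreal \<delta> * emeasure \<rho> A = (\<integral>\<^sup>+x. ennreal \<delta> * (ennreal (e x / \<delta>) * indicator A x) \<partial>\<mu>)"
      using False by (simp add: \<rho>_def emeasure_density nn_integral_cmult)
    also have "\<dots> = (\<integral>\<^sup>+x. ennreal (e x) * indicator A x \<partial>\<mu>)"
      using False \<delta>0 e0 by (intro nn_integral_cong) (simp add: mult.assoc[symmetric] ennreal_mult[symmetric])
    finally show ?thesis .
  qed
  have pr_\<rho>: "prob_space \<rho>"
  proof (cases "\<delta> = 0")
    case True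
    then show ?thesis by (simp add: \<rho>_def prob_space_axioms)
  next
    case False
    have "ennreal \<delta> * emeasure \<rho> UNIV = (\<integral>\<^sup>+x. ennreal (e x) \<partial>\<mu>)"
      using \<rho>_eq[of UNIV] by simp
    also have "\<dots> = ennreal \<delta> * 1"
      using nn_integral_eq_integral[OF eint] e0 by (simp add: \<delta>_def)
    finally have "ennreal \<delta> * emeasure \<rho> UNIV = ennreal \<delta> * 1" .
    then have "emeasure \<rho> UNIV = 1"
      using False \<delta>0 unfolding ennreal_mult_cancel_left by auto
    then show ?thesis using sets_eq_imp_space_eq[OF sets_\<rho>] by (intro prob_spaceI) simp
  qed
  interpret \<rho>: prob_space \<rho> by (rule pr_\<rho>)
  interpret U: prob_space "unif 1" by (rule prob_space_unif) simp
  interpret \<rho>U: pair_prob_space \<rho> "unif 1" ..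
  interpret M: pair_prob_space \<mu> "\<rho> \<Otimes>\<^sub>M unif 1" ..
  let ?M = "\<mu> \<Otimes>\<^sub>M (\<rho> \<Otimes>\<^sub>M unif 1)"
  \<comment> \<open>A point w = (y, z, s) consists of the \<mu>-distributed point, a candidate
    replacement and a uniform coin; y is kept when s < p y.\<close>
  define g where "g w = (if snd (snd w) < p (fst w) then fst w else fst (snd w))" for w :: "'x \<times> 'x \<times> real"
  have [measurable]: "g \<in> ?M \<rightarrow>\<^sub>M borel" unfolding g_def[abs_def] by measurable
  have int: "(\<integral>\<^sup>+w. (if snd (snd w) < p (fst w) then \<phi> (fst w) else \<psi> (fst (snd w))) \<partial>?M)
      = (\<integral>\<^sup>+y. ennreal (p y) * \<phi> y + ennreal (1 - p y) * (\<integral>\<^sup>+z. \<psi> z \<partial>\<rho>) \<partial>\<mu>)"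
    if [measurable]: "\<phi> \<in> borel_measurable borel" "\<psi> \<in> borel_measurable borel" for \<phi> \<psi> :: "'x \<Rightarrow> ennreal"
  proof -
    have "(\<integral>\<^sup>+w. (if snd (snd w) < p (fst w) then \<phi> (fst w) else \<psi> (fst (snd w))) \<partial>?M)
        = (\<integral>\<^sup>+y. \<integral>\<^sup>+q. (if snd q < p y then \<phi> y else \<psi> (fst q)) \<partial>(\<rho> \<Otimes>\<^sub>M unif 1) \<partial>\<mu>)"
      by (subst \<rho>U.P.nn_integral_fst[symmetric]) (simp_all cong: if_cong)
    also have "\<dots> = (\<integral>\<^sup>+y. \<integral>\<^sup>+z. \<integral>\<^sup>+s. (if s < p y then \<phi> y else \<psi> z) \<partial>unif 1 \<partial>\<rho> \<partial>\<mu>)"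
      by (intro nn_integral_cong) (subst U.nn_integral_fst[symmetric], simp_all cong: if_cong)
    also have "\<dots> = (\<integral>\<^sup>+y. \<integral>\<^sup>+z. ennreal (p y) * \<phi> y + ennreal (1 - p y) * \<psi> z \<partial>\<rho> \<partial>\<mu>)"
      by (simp add: nn_integral_unif_split p01)
    also have "\<dots> = (\<integral>\<^sup>+y. ennreal (p y) * \<phi> y + ennreal (1 - p y) * (\<integral>\<^sup>+z. \<psi> z \<partial>\<rho>) \<partial>\<mu>)"
      by (simp add: nn_integral_add nn_integral_cmult \<rho>.emeasure_space_1)
    finally show ?thesis .
  qed
  define \<pi> where "\<pi> = distr ?M (borel \<Otimes>\<^sub>M borel) (\<lambda>w. (g w, fst w))"
  have \<pi>m: "(\<lambda>w. (g w, fst w)) \<in> ?M \<rightarrow>\<^sub>M borel \<Otimes>\<^sub>M borel" by measurable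
  have "distr \<pi> borel snd = distr ?M borel fst"
    unfolding \<pi>_def by (subst distr_distr[OF _ \<pi>m]) (auto simp: comp_def)
  also have "\<dots> = distr ?M \<mu> fst" by (rule distr_cong) simp_all
  also have "\<dots> = \<mu>" by (rule \<rho>U.P.distr_pair_fst)
  finally have snd: "distr \<pi> borel snd = \<mu>" .
  have fst: "distr \<pi> borel fst = \<nu>"
  proof (rule measure_eqI)
    show "sets (distr \<pi> borel fst) = sets \<nu>" using \<nu> by (simp add: space_prob_algebra)
    fix A assume "A \<in> sets (distr \<pi> borel fst)"
    then have A [measurable]: "A \<in> sets borel" by simp
    have "emeasure (distr \<pi> borel fst) A = emeasure (distr ?M borel g) A"
      unfolding \<pi>_def by (subst distr_distr[OF _ \<pi>m]) (auto simp: comp_def)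
    also have "\<dots> = (\<integral>\<^sup>+x. indicator A x \<partial>distr ?M borel g)" by simp
    also have "\<dots> = (\<integral>\<^sup>+w. indicator A (g w) \<partial>?M)" by (rule nn_integral_distr) measurable
    also have "\<dots> = (\<integral>\<^sup>+w. (if snd (snd w) < p (fst w) then indicator A (fst w) else indicator A (fst (snd w))) \<partial>?M)"
      by (intro nn_integral_cong) (simp add: g_def)
    also have "\<dots> = (\<integral>\<^sup>+y. ennreal (p y) * indicator A y + ennreal (1 - p y) * emeasure \<rho> A \<partial>\<mu>)"
      by (subst int) (simp_all add: sets_\<rho>)
    also have "\<dots> = (\<integral>\<^sup>+y. ennreal (p y) * indicator A y \<partial>\<mu>) + (\<integral>\<^sup>+y. ennreal (1 - p y) \<partial>\<mu>) * emeasure \<rho> A"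
      by (simp add: nn_integral_add nn_integral_multc)
    also have "(\<integral>\<^sup>+y. ennreal (1 - p y) \<partial>\<mu>) = ennreal \<delta>"
      using pint p01 by (subst nn_integral_eq_integral) (auto simp: dp[symmetric])
    also have "(\<integral>\<^sup>+y. ennreal (p y) * indicator A y \<partial>\<mu>) + ennreal \<delta> * emeasure \<rho> A
        = (\<integral>\<^sup>+y. ennreal (p y) * indicator A y + ennreal (e y) * indicator A y \<partial>\<mu>)"
      by (simp add: \<rho>_eq nn_integral_add)
    also have "\<dots> = (\<integral>\<^sup>+y. ennreal (f y) * indicator A y \<partial>\<mu>)"
      by (intro nn_integral_cong) (simp add: distrib_right[symmetric] ennreal_plus[symmetric] p01 e0 pe del: ennreal_plus)
    also have "\<dots> = emeasure \<nu> A"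
      by (subst f(1)) (simp add: emeasure_density f_def[symmetric, THEN fun_cong])
    finally show "emeasure (distr \<pi> borel fst) A = emeasure \<nu> A" .
  qed
  have "\<pi> \<in> space (prob_algebra (borel \<Otimes>\<^sub>M borel))"
    unfolding \<pi>_def space_prob_algebra using M.P.prob_space_distr[OF \<pi>m] by simp
  with fst snd have \<pi>: "\<pi> \<in> couplings \<nu> \<mu>" by (simp add: couplings_def)
  have "(\<integral>\<^sup>+z. ennreal (trivial_metric (fst z) (snd z)) \<partial>\<pi>) = (\<integral>\<^sup>+w. ennreal (trivial_metric (g w) (fst w)) \<partial>?M)"
    unfolding \<pi>_def trivial_metric_indicator
    by (subst nn_integral_distr[OF \<pi>m]) (use sets_diagonal in \<open>auto simp: trivial_metric_indicator[symmetric]\<close>)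
  \<comment> \<open>An inequality because a replacement may coincide with the point that it
    replaces; the converse bound holds for every coupling.\<close>
  also have "\<dots> \<le> (\<integral>\<^sup>+w. (if snd (snd w) < p (fst w) then 0 else 1) \<partial>?M)"
    by (intro nn_integral_mono) (simp add: g_def trivial_metric_def)
  also have "\<dots> = (\<integral>\<^sup>+y. ennreal (1 - p y) \<partial>\<mu>)"
    using int[of "\<lambda>x. 0" "\<lambda>x. 1"] by (simp add: \<rho>.emeasure_space_1)
  also have "\<dots> = ennreal \<delta>"
    using pint p01 by (subst nn_integral_eq_integral) (auto simp: dp[symmetric])
  finally show ?thesis using \<pi> tv by auto
qed

text \<open>Every coupling costs at least half the total variation, and the maximal coupling attains
  it. Absolutely continuous \<nu> are the ones that matter, since the information of any other \<nu>
  is infinite.\<close>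

lemma W1_trivial_eq:
  assumes \<nu>: "\<nu> \<in> space (prob_algebra borel)" and ac: "absolutely_continuous \<mu> \<nu>"
  shows "enn2real (W1 trivial_metric \<nu> \<mu>) = tv_norm \<nu> \<mu> / 2"
proof -
  have "W1 trivial_metric \<nu> \<mu> = ennreal (tv_norm \<nu> \<mu> / 2)"
  proof (rule antisym)
    obtain \<pi> where "\<pi> \<in> couplings \<nu> \<mu>"
      "(\<integral>\<^sup>+z. ennreal (trivial_metric (fst z) (snd z)) \<partial>\<pi>) \<le> ennreal (tv_norm \<nu> \<mu> / 2)"
      using maximal_coupling[OF \<nu> ac] by blast
    then show "W1 trivial_metric \<nu> \<mu> \<le> ennreal (tv_norm \<nu> \<mu> / 2)"
      unfolding W1_def by (rule INF_lower2)
    show "ennreal (tv_norm \<nu> \<mu> / 2) \<le> W1 trivial_metric \<nu> \<mu>"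
      unfolding W1_def by (intro INF_greatest tv_norm_le_coupling)
  qed
  then show ?thesis using tv_norm_nonneg[OF \<nu>] by simp
qed

end

section \<open>The converse in the reversible case\<close>

text \<open>If q = b 0 / c exceeded 1, the recursion would give b k \<ge> c q^(2^k), contradicting
  the bound C. It turns a Cauchy-Schwarz estimate along doubled times into an estimate without
  loss.\<close>

lemma bounded_imp_ratio_le_1:
  fixes b :: "nat \<Rightarrow> real"
  assumes b0: "0 \<le> c" and sq: "\<And>k. (b k)\<^sup>2 \<le> b (Suc k) * c" and bd: "\<And>k. b k \<le> C"
  shows "b 0 \<le> c"
proof (rule ccontr)
  assume "\<not> b 0 \<le> c"
  then have b: "c < b 0" by simp
  have c: "0 < c"
  proof (rule ccontr)
    assume "\<not> 0 < c"
    then have "c = 0" using b0 by simp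
    then show False using sq[of 0] b by simp
  qed
  define q where "q = b 0 / c"
  have q: "1 < q" using b c by (simp add: q_def)
  have grow: "c * q ^ (2 ^ k) \<le> b k" for k
  proof (induction k)
    case 0
    show ?case using c by (simp add: q_def)
  next
    case (Suc k)
    have "(c * q ^ (2 ^ k))\<^sup>2 \<le> (b k)\<^sup>2" using Suc.IH q c by (intro power_mono) auto
    also have "\<dots> \<le> b (Suc k) * c" by (rule sq)
    also have "(c * q ^ (2 ^ k))\<^sup>2 = c * q ^ (2 ^ Suc k) * c"
      using power_mult[of q "2 ^ k" 2] by (simp add: power_mult_distrib power2_eq_square mult_ac)
    finally show ?case using c by (simp add: mult.commute)
  qed
  obtain n where n: "C / c < q ^ n" using real_arch_pow[OF q] by blast
  have "n \<le> 2 ^ n" by (rule less_imp_le) (rule less_exp)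
  then have "q ^ n \<le> q ^ (2 ^ n)" using q by (intro power_increasing) auto
  then have "C / c < q ^ (2 ^ n)" using n by linarith
  then have "C < c * q ^ (2 ^ n)" using c by (simp add: divide_less_eq mult.commute)
  then show False using grow[of n] bd[of n] by linarith
qed

section \<open>Finite-time forms, the resolvent, and measures with squared density\<close>

context stationary_ergodic_markov_process
begin

lemma time_form_scale:
  assumes "0 \<le> t" "f \<in> bounded_borel"
  shows "time_form t (\<lambda>x. c * f x) = c\<^sup>2 * time_form t f"
  using assms
  by (simp add: time_form_def T_scale bounded_borel_measurable L2_inner_def power2_eq_square
      right_diff_distrib[symmetric] mult.assoc mult.left_commute)

lemma time_form_eq_of_abs_eq:
  assumes "0 \<le> t" "f \<in> L2 \<mu>" "g \<in> L2 \<mu>" "\<And>x y. \<bar>f x - f y\<bar> = \<bar>g x - g y\<bar>"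
  shows "time_form t f = time_form t g"
  using assms by (intro antisym time_form_contraction) simp_all

text \<open>The parallelogram identity, with the nonnegative form of f - g dropped.\<close>

lemma time_form_add_le:
  assumes t: "0 \<le> t" and f: "f \<in> bounded_borel" and g: "g \<in> bounded_borel"
  shows "time_form t (\<lambda>x. f x + g x) \<le> 2 * time_form t f + 2 * time_form t g"
proof -
  note Tf = T_bounded_borel[OF t f] and Tg = T_bounded_borel[OF t g]
  define D where "D f x = f x - T t f x" for f x
  have D: "D f \<in> L2 \<mu>" "D g \<in> L2 \<mu>"
    unfolding D_def[abs_def] by (intro bounded_borel_L2 bounded_borel_diff f g Tf Tg)+
  have 1: "time_form t (\<lambda>x. f x + g x) = L2_inner \<mu> (\<lambda>x. D f x + D g x) (\<lambda>x. f x + g x)"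
    "time_form t (\<lambda>x. f x - g x) = L2_inner \<mu> (\<lambda>x. D f x - D g x) (\<lambda>x. f x - g x)"
    by (simp_all add: time_form_def D_def T_add[OF t f g] T_diff[OF t f g] algebra_simps)
  have 2: "time_form t f = L2_inner \<mu> (D f) f" "time_form t g = L2_inner \<mu> (D g) g"
    by (simp_all add: time_form_def D_def[abs_def])
  have "time_form t (\<lambda>x. f x + g x) + time_form t (\<lambda>x. f x - g x) = 2 * time_form t f + 2 * time_form t g"
    unfolding 1 2 using D bounded_borel_L2[OF f] bounded_borel_L2[OF g]
    by (simp add: L2_inner_add L2_inner_diff L2_inner_add_right L2_inner_diff_right L2_add L2_diff)
  moreover have "0 \<le> time_form t (\<lambda>x. f x - g x)"
    by (intro time_form_nonneg t bounded_borel_L2 bounded_borel_diff f g)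
  ultimately show ?thesis by linarith
qed

lemma time_form_le_L2_norm:
  assumes t: "0 \<le> t" and f: "f \<in> L2 \<mu>"
  shows "time_form t f \<le> 2 * (L2_norm \<mu> f)\<^sup>2"
proof -
  have "- L2_inner \<mu> (T t f) f \<le> L2_norm \<mu> (T t f) * L2_norm \<mu> f"
    using L2_Cauchy_Schwarz[OF T_L2[OF t f] f] by linarith
  also have "\<dots> \<le> L2_norm \<mu> f * L2_norm \<mu> f"
    using T_contraction[OF t f] by (intro mult_right_mono) auto
  finally show ?thesis by (simp add: time_form_eq[OF t f] power2_eq_square)
qed

text \<open>Expanding the square and using contraction, the left side is at most 2
  \<parallel>f\<parallel>^2 - 2 \<langle>T t f, f\<rangle>.\<close>

lemma L2_norm_T_diff_le:
  assumes t: "0 \<le> t" and f: "f \<in> L2 \<mu>"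
  shows "(L2_norm \<mu> (\<lambda>x. T t f x - f x))\<^sup>2 \<le> 2 * time_form t f"
proof -
  have "(L2_norm \<mu> (T t f))\<^sup>2 \<le> (L2_norm \<mu> f)\<^sup>2"
    using T_contraction[OF t f] by (intro power_mono) auto
  then show ?thesis by (simp add: L2_norm_diff_power2[OF T_L2[OF t f] f] time_form_eq[OF t f])
qed

text \<open>The resolvent is the semigroup evaluated at an independent exponential time of rate 1,
  hence an average over a probability measure.\<close>

lemma resolvent1_bounded:
  assumes f: "f \<in> bounded_borel"
  shows "resolvent1 T f x = (\<integral>s. T (max 0 s) f x \<partial>density lborel (exponential_density 1))"
proof -
  have [measurable]: "(\<lambda>s. T (max 0 s) f x) \<in> borel_measurable borel"
    by (rule T_measurable_time[OF bounded_borel_measurable[OF f]])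
  have "(\<integral>s. T (max 0 s) f x \<partial>density lborel (exponential_density 1))
      = (\<integral>s. exponential_density 1 s *\<^sub>R T (max 0 s) f x \<partial>lborel)"
    by (rule integral_density) (auto simp: exponential_density_nonneg)
  also have "\<dots> = resolvent1 T f x"
    unfolding resolvent1_def set_lebesgue_integral_def
    by (intro Bochner_Integration.integral_cong) (auto simp: exponential_density_def indicator_def)
  finally show ?thesis ..
qed

lemma integral_indicator_resolvent1:
  assumes A: "A \<in> sets borel" and B: "B \<in> sets borel"
  shows "(\<integral>x. indicator A x * resolvent1 T (indicator B) x \<partial>\<mu>)
    = (\<integral>s. \<integral>x. indicator A x * T (max 0 s) (indicator B) x \<partial>\<mu> \<partial>density lborel (exponential_density 1))"
proof -
  let ?D = "density lborel (exponential_density 1)"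
  have pr: "prob_space ?D" by (rule prob_space_exponential_density) simp
  note B' = bounded_borel_indicator[OF B]
  have TB: "\<bar>T (max 0 s) (indicator B) x\<bar> \<le> 1" for s x
    by (rule abs_T_le) (use B in \<open>auto simp: indicator_def\<close>)
  note [measurable] = A T_measurable_pair[OF bounded_borel_measurable[OF B']]
  have "(\<lambda>p. indicator A (snd p) * (\<lambda>(s, x). T (max 0 s) (indicator B) x) p :: real) \<in> borel_measurable (borel \<Otimes>\<^sub>M borel)"
    by measurable
  then have m: "(\<lambda>(s, x). indicator A x * T (max 0 s) (indicator B) x) \<in> borel_measurable (?D \<Otimes>\<^sub>M \<mu>)"
    by (simp add: case_prod_unfold cong: measurable_cong_sets)
  have "\<bar>indicator A x * T (max 0 s) (indicator B) x\<bar> \<le> 1" for s x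
    using TB[of s x] by (auto simp: indicator_def)
  from prob_Fubini[OF pr prob_space_axioms m this]
  show ?thesis by (simp add: resolvent1_bounded[OF B'])
qed

text \<open>By invariance the squared norm of the indicator, \<mu> B, is also the mean of T t
  applied to it; subtracting the part on B leaves the mass that flows into B from its complement. So
  the quantity in the positivity assumption, for the complement of B and B, is an exponential
  average of finite-time forms.\<close>

lemma time_form_indicator:
  assumes t: "0 \<le> t" and B: "B \<in> sets borel"
  shows "time_form t (indicator B) = (\<integral>x. indicator (- B) x * T t (indicator B) x \<partial>\<mu>)"
proof -
  note B' = bounded_borel_indicator[OF B]
  note TB = T_bounded_borel[OF t B']
  have i: "integrable \<mu> (\<lambda>x. T t (indicator B) x * indicator B x)"
    by (intro bounded_borel_integrable bounded_borel_mult TB B')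
  have "(\<integral>x. indicator (- B) x * T t (indicator B) x \<partial>\<mu>)
      = (\<integral>x. T t (indicator B) x - T t (indicator B) x * indicator B x \<partial>\<mu>)"
    by (intro Bochner_Integration.integral_cong) (auto simp: indicator_def)
  also have "\<dots> = (\<integral>x. indicator B x \<partial>\<mu>) - (\<integral>x. T t (indicator B) x * indicator B x \<partial>\<mu>)"
    using i bounded_borel_integrable[OF TB] integral_T[OF t bounded_borel_integrable[OF B']] by simp
  also have "(\<integral>x. indicator B x \<partial>\<mu>) = (\<integral>x. (indicator B x)\<^sup>2 \<partial>\<mu> :: real)"
    by (intro Bochner_Integration.integral_cong) (auto simp: indicator_def)
  finally show ?thesis
    by (simp add: time_form_eq[OF t bounded_borel_L2[OF B']] L2_norm_power2 L2_inner_def)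
qed

text \<open>For nonnegative h the function h is, up to a null set, the square root of the density of
  h^2 \<mu>. This converts the information inequality into a statement about elements of the domain
  of the generator.\<close>

lemma
  assumes h: "h \<in> gen_domain \<mu> T" and h0: "\<And>x. 0 \<le> h x" and h1: "L2_norm \<mu> h = 1"
  defines "\<nu> \<equiv> density \<mu> (\<lambda>x. ennreal ((h x)\<^sup>2))"
  shows square_density_prob: "\<nu> \<in> space (prob_algebra borel)"
    and fisher_info_square_density: "fisher_info \<mu> T \<nu> = ereal (pre_form \<mu> T h)"
    and tv_norm_square_density: "tv_norm \<nu> \<mu> = (\<integral>x. \<bar>(h x)\<^sup>2 - 1\<bar> \<partial>\<mu>)"
proof -
  have hL: "h \<in> L2 \<mu>" by (rule gen_domain_L2[OF h])
  have [measurable]: "h \<in> borel_measurable borel" by (rule L2_borel[OF hL])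
  have "(\<integral>x. (h x)\<^sup>2 \<partial>\<mu>) = 1" using h1 by (simp flip: L2_norm_power2)
  then have "emeasure \<nu> (space \<nu>) = 1"
    using nn_integral_eq_integral[OF L2_square_integrable[OF hL]] by (simp add: \<nu>_def emeasure_density)
  then have pr: "prob_space \<nu>" by (rule prob_spaceI)
  then show \<nu>: "\<nu> \<in> space (prob_algebra borel)" by (simp add: space_prob_algebra \<nu>_def)
  have ac: "absolutely_continuous \<mu> \<nu>" unfolding \<nu>_def by (rule absolutely_continuousI_density) simp
  have "AE x in \<mu>. ennreal ((h x)\<^sup>2) = RN_deriv \<mu> \<nu> x"
    by (rule RN_deriv_unique) (simp_all add: \<nu>_def)
  then have RN: "AE x in \<mu>. enn2real (RN_deriv \<mu> \<nu> x) = (h x)\<^sup>2"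
    by eventually_elim (metis enn2real_ennreal zero_le_power2)
  have Rm [measurable]: "(\<lambda>x. enn2real (RN_deriv \<mu> \<nu> x)) \<in> borel_measurable borel"
    by (rule density_measurable[OF \<nu> ac])
  show "tv_norm \<nu> \<mu> = (\<integral>x. \<bar>(h x)\<^sup>2 - 1\<bar> \<partial>\<mu>)"
    unfolding tv_norm_eq[OF \<nu> ac] using RN by (intro integral_cong_AE) auto
  define k where "k = (\<lambda>x. sqrt (enn2real (RN_deriv \<mu> \<nu> x)))"
  have km: "k \<in> borel_measurable borel" unfolding k_def by measurable
  have hk: "AE x in \<mu>. h x = k x" using RN by eventually_elim (simp add: k_def h0)
  have kL: "k \<in> L2 \<mu>" by (rule L2_cong_AE[OF hL _ hk]) (simp add: km)
  show "fisher_info \<mu> T \<nu> = ereal (pre_form \<mu> T h)"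
    using ac form_domain_of_gen_domain[OF h kL hk] dirichlet_form_of_gen_domain[OF h kL hk]
    by (simp add: fisher_info_def Let_def k_def)
qed

end

section \<open>Consequences of symmetry\<close>

locale reversible_markov_process = stationary_ergodic_markov_process +
  assumes reversible: "reversible \<mu> T"
begin

lemma T_symmetric:
  "0 \<le> t \<Longrightarrow> f \<in> L2 \<mu> \<Longrightarrow> g \<in> L2 \<mu> \<Longrightarrow> L2_inner \<mu> (T t f) g = L2_inner \<mu> f (T t g)"
  using reversible by (auto simp: reversible_def)

lemma T_inner_add:
  assumes "0 \<le> s" "0 \<le> t" "f \<in> bounded_borel"
  shows "L2_inner \<mu> (T s f) (T t f) = L2_inner \<mu> (T (s + t) f) f"
proof -
  have "L2_inner \<mu> (T s f) (T t f) = L2_inner \<mu> (T t (T s f)) f"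
    using assms by (intro T_symmetric[symmetric] bounded_borel_L2 T_bounded_borel) auto
  also have "T t (T s f) = T (s + t) f" using assms by (auto simp: T_T add.commute)
  finally show ?thesis .
qed

text \<open>Half-time splitting: symmetry moves one copy of \<open>T s\<close> across the inner
  product, so forms of T s f are increments of the single function s \<mapsto> \<langle>T s f,
  f\<rangle>.\<close>

lemma time_form_T:
  assumes "0 \<le> s" "0 \<le> a" "f \<in> bounded_borel"
  shows "time_form a (T s f) = L2_inner \<mu> (T (2 * s) f) f - L2_inner \<mu> (T (2 * s + a) f) f"
proof -
  have Ts: "T s f \<in> bounded_borel" using assms by (intro T_bounded_borel)
  have "T a (T s f) = T (s + a) f" using assms by (auto simp: T_T add.commute)
  then show ?thesis
    using assms T_inner_add[of s s f] T_inner_add[of "s + a" s f]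
    by (simp add: time_form_eq bounded_borel_L2[OF Ts] L2_inner_self[symmetric] algebra_simps)
qed

text \<open>Symmetry makes the two cross terms equal, so the finite-time form is the diagonal of a
  nonnegative symmetric bilinear form.\<close>

lemma time_form_Cauchy_Schwarz:
  assumes a: "0 \<le> a" and f: "f \<in> bounded_borel" and g: "g \<in> bounded_borel"
  shows "(L2_inner \<mu> (\<lambda>x. f x - T a f x) g)\<^sup>2 \<le> time_form a f * time_form a g"
proof -
  note L2s = bounded_borel_L2[OF f] bounded_borel_L2[OF g]
    bounded_borel_L2[OF T_bounded_borel[OF a f]] bounded_borel_L2[OF T_bounded_borel[OF a g]]
  define b where "b = L2_inner \<mu> (\<lambda>x. f x - T a f x) g"
  have sym: "L2_inner \<mu> (\<lambda>x. g x - T a g x) f = b"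
    using L2s T_symmetric[OF a L2s(1,2)]
    by (simp add: b_def L2_inner_diff L2_inner_commute[of \<mu> g f] L2_inner_commute[of \<mu> "T a g" f])
  have "time_form a (\<lambda>x. f x + s * g x) = time_form a f + s * (2 * b) + s\<^sup>2 * time_form a g" for s
  proof -
    have sg: "(\<lambda>x. s * g x) \<in> bounded_borel" by (rule bounded_borel_scale[OF g])
    have "T a (\<lambda>x. f x + s * g x) x = T a f x + s * T a g x" for x
      using T_add[OF a f sg] by (simp add: T_scale a bounded_borel_measurable g)
    then have "(\<lambda>x. (f x + s * g x) - T a (\<lambda>x. f x + s * g x) x)
        = (\<lambda>x. (f x - T a f x) + s * (g x - T a g x))" by (auto simp: algebra_simps)
    then have "time_form a (\<lambda>x. f x + s * g x)
        = L2_inner \<mu> (\<lambda>x. (f x - T a f x) + s * (g x - T a g x)) (\<lambda>x. f x + s * g x)"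
      by (simp add: time_form_def)
    also have "\<dots> = time_form a f + s * b + s * b + s * s * time_form a g"
    proof -
      define u where "u = (\<lambda>x. f x - T a f x)"
      define v where "v = (\<lambda>x. g x - T a g x)"
      have uv: "u \<in> L2 \<mu>" "v \<in> L2 \<mu>" unfolding u_def v_def using L2s by (auto intro: L2_diff)
      have r: "L2_inner \<mu> k (\<lambda>x. s * g x) = s * L2_inner \<mu> k g" for k
        using L2_inner_scale[of \<mu> s g k] by (simp add: L2_inner_commute)
      have e: "L2_inner \<mu> u f = time_form a f" "L2_inner \<mu> v g = time_form a g" "L2_inner \<mu> u g = b" "L2_inner \<mu> v f = b"
        using sym by (simp_all add: time_form_def b_def u_def v_def)
      have "L2_inner \<mu> (\<lambda>x. u x + s * v x) (\<lambda>x. f x + s * g x)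
          = time_form a f + s * b + s * b + s * s * time_form a g"
        using L2s uv by (simp add: L2_inner_add L2_inner_add_right L2_scale L2_add L2_inner_scale r e algebra_simps)
      then show ?thesis by (simp add: u_def v_def)
    qed
    finally show ?thesis by (simp add: power2_eq_square)
  qed
  moreover have "0 \<le> time_form a (\<lambda>x. f x + s * g x)" for s
    by (intro time_form_nonneg a bounded_borel_L2 bounded_borel_add f bounded_borel_scale g)
  ultimately have "0 \<le> time_form a f + s * (2 * b) + s\<^sup>2 * time_form a g" for s by metis
  from sqrt_triangle_of_nonneg_quadratic(1)[OF this] show ?thesis
    by (simp add: b_def power_mult_distrib)
qed

text \<open>Replaces the spectral theorem: \<open>s \<mapsto> \<langle>T s f, f\<rangle>\<close> is convex, hence its increments over
  steps of length \<open>a\<close> are largest at \<open>s = 0\<close>. Here \<open>b s\<^sup>2 \<le> b (2 s) * b 0\<close> is iterated.\<close>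

lemma increment_le_time_form:
  assumes s: "0 \<le> s" and a: "0 \<le> a" and f: "f \<in> bounded_borel"
  shows "L2_inner \<mu> (T s f) f - L2_inner \<mu> (T (s + a) f) f \<le> time_form a f"
proof -
  define b where "b s = L2_inner \<mu> (T s f) f - L2_inner \<mu> (T (s + a) f) f" for s
  \<comment> \<open>b s is the bilinear form between T s f and f, and the form of T s f alone is b
    (2 s); Cauchy-Schwarz gives the recursion.\<close>
  have sq: "(b s)\<^sup>2 \<le> b (2 * s) * time_form a f" if s: "0 \<le> s" for s
  proof -
    have Ts: "T s f \<in> bounded_borel" by (rule T_bounded_borel[OF s f])
    have "T a (T s f) = T (s + a) f" using s a f by (auto simp: T_T add.commute)
    then have "L2_inner \<mu> (\<lambda>x. T s f x - T a (T s f) x) f = b s"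
      using s a f by (simp add: b_def L2_inner_diff bounded_borel_L2 T_bounded_borel)
    then show ?thesis
      using time_form_Cauchy_Schwarz[OF a Ts f] by (simp add: time_form_T[OF s a f] b_def)
  qed
  have bd: "b r \<le> 2 * (L2_norm \<mu> f)\<^sup>2" if r: "0 \<le> r" for r
  proof -
    have "\<bar>L2_inner \<mu> (T q f) f\<bar> \<le> (L2_norm \<mu> f)\<^sup>2" if q: "0 \<le> q" for q
    proof -
      have "\<bar>L2_inner \<mu> (T q f) f\<bar> \<le> L2_norm \<mu> (T q f) * L2_norm \<mu> f"
        by (rule L2_Cauchy_Schwarz[OF T_L2[OF q bounded_borel_L2[OF f]] bounded_borel_L2[OF f]])
      also have "\<dots> \<le> L2_norm \<mu> f * L2_norm \<mu> f"
        by (intro mult_right_mono T_contraction q bounded_borel_L2 f) simp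
      finally show ?thesis by (simp add: power2_eq_square)
    qed
    from this[of r] this[of "r + a"] show ?thesis using r a by (simp add: b_def abs_le_iff)
  qed
  have "b (2 ^ 0 * s) \<le> time_form a f"
  proof (rule bounded_imp_ratio_le_1[where b="\<lambda>k. b (2 ^ k * s)" and C="2 * (L2_norm \<mu> f)\<^sup>2"])
    show "0 \<le> time_form a f" by (intro time_form_nonneg a bounded_borel_L2 f)
    show "(b (2 ^ k * s))\<^sup>2 \<le> b (2 ^ Suc k * s) * time_form a f" for k
      using sq[of "2 ^ k * s"] s by (simp add: mult.assoc)
    show "b (2 ^ k * s) \<le> 2 * (L2_norm \<mu> f)\<^sup>2" for k using s by (intro bd) simp
  qed
  then show ?thesis by (simp add: b_def)
qed

text \<open>The difference of the two sides is the form over t - s of T (s / 2) f, hence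
  nonnegative.\<close>

lemma time_form_mono:
  assumes "0 \<le> s" "s \<le> t" "f \<in> bounded_borel"
  shows "time_form s f \<le> time_form t f"
proof -
  have "0 \<le> time_form (t - s) (T (s / 2) f)"
    using assms by (intro time_form_nonneg bounded_borel_L2 T_bounded_borel) auto
  then have "L2_inner \<mu> (T t f) f \<le> L2_inner \<mu> (T s f) f"
    using assms by (simp add: time_form_T)
  then show ?thesis using assms by (simp add: time_form_eq bounded_borel_L2)
qed

text \<open>The form over n t telescopes into increments of length t, each at most the increment at
  0.\<close>

lemma time_form_multiple:
  assumes "0 \<le> t" "f \<in> bounded_borel"
  shows "time_form (real n * t) f \<le> real n * time_form t f"
proof (induction n)
  case 0
  have "T 0 f = f" using assms by (auto simp: T_0 bounded_borel_measurable)
  then show ?case by (simp add: time_form_def L2_inner_def)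
next
  case (Suc n)
  have "L2_inner \<mu> (T (real n * t) f) f - L2_inner \<mu> (T (real n * t + t) f) f \<le> time_form t f"
    using assms by (intro increment_le_time_form) auto
  then have "time_form (real n * t + t) f \<le> time_form (real n * t) f + time_form t f"
    using assms by (simp add: time_form_eq bounded_borel_L2)
  then show ?case using Suc.IH by (simp add: algebra_simps)
qed

text \<open>Smallness at one time t spreads to every \<tau> with linear growth, which is integrable
  against the exponential law in the resolvent. The summand 1 pays for rounding \<tau> up to a
  multiple of t \<le> 1.\<close>

lemma time_form_le_linear:
  assumes t: "0 < t" "t \<le> 1" and f: "f \<in> bounded_borel" and le: "time_form t f \<le> \<kappa> * t" and \<tau>: "0 \<le> \<tau>"
  shows "time_form \<tau> f \<le> \<kappa> * (\<tau> + 1)"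
proof -
  define n where "n = nat \<lceil>\<tau> / t\<rceil>"
  have "\<tau> / t \<le> real n" "real n \<le> \<tau> / t + 1" using t \<tau> by (simp_all add: n_def)
  then have n: "\<tau> \<le> real n * t" "real n * t \<le> \<tau> + t" using t by (simp_all add: field_simps)
  have "0 \<le> time_form t f" using t by (intro time_form_nonneg bounded_borel_L2 f) simp
  then have "0 \<le> \<kappa> * t" using le by linarith
  then have \<kappa>: "0 \<le> \<kappa>" using t by (simp add: zero_le_mult_iff)
  have "time_form \<tau> f \<le> time_form (real n * t) f" by (rule time_form_mono[OF \<tau> n(1) f])
  also have "\<dots> \<le> real n * time_form t f" using t by (intro time_form_multiple f) simp
  also have "\<dots> \<le> real n * (\<kappa> * t)" by (intro mult_left_mono le) simp
  also have "\<dots> = \<kappa> * (real n * t)" by simp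
  also have "\<dots> \<le> \<kappa> * (\<tau> + 1)" using n t by (intro mult_left_mono \<kappa>) simp
  finally show ?thesis .
qed

text \<open>The generator of the average is (T t f - f) / t, so its form is the mean over s of
  (\<langle>T s f, f\<rangle> - \<langle>T (s + t) f, f\<rangle>) / t, and by convexity each
  increment is at most the one at s = 0.\<close>

lemma pre_form_average_le:
  assumes t: "0 < t" and f: "f \<in> bounded_borel"
  shows "pre_form \<mu> T (average t f) \<le> time_form t f / t"
proof -
  have t0: "0 \<le> t" using t by simp
  have Tf: "T t f \<in> bounded_borel" by (rule T_bounded_borel[OF t0 f])
  define k where "k = (\<lambda>x. (T t f x - f x) / t)"
  have k: "k \<in> bounded_borel" unfolding k_def by (intro bounded_borel_divide bounded_borel_diff Tf f)
  have tf0: "0 \<le> time_form t f" by (intro time_form_nonneg t0 bounded_borel_L2 f)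
  have "pre_form \<mu> T (average t f) = - L2_inner \<mu> k (average t f)"
    unfolding k_def by (rule pre_form_eq[OF generator_value_average[OF t f]])
  also have "\<dots> = - (\<integral>s. (\<integral>x. T (max 0 s) f x * k x \<partial>\<mu>) \<partial>unif t)"
    using integral_average[OF t f k] by (simp add: L2_inner_def mult.commute)
  also have "\<dots> = (\<integral>s. - L2_inner \<mu> (T (max 0 s) f) k \<partial>unif t)"
    by (simp add: L2_inner_def)
  also have "\<dots> \<le> (\<integral>s. time_form t f / t \<partial>unif t)"
  proof (rule integral_mono')
    interpret U: prob_space "unif t" by (rule prob_space_unif[OF t])
    show "integrable (unif t) (\<lambda>s. time_form t f / t)" by simp
    show "0 \<le> time_form t f / t" using tf0 t by simp
    fix s :: real
    define r where "r = max 0 s"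
    have r: "0 \<le> r" by (simp add: r_def)
    note L2s = bounded_borel_L2[OF f] bounded_borel_L2[OF Tf] bounded_borel_L2[OF T_bounded_borel[OF r f]]
    have "L2_inner \<mu> (T r f) k = (L2_inner \<mu> (T r f) (T t f) - L2_inner \<mu> (T r f) f) / t"
      using L2_inner_scale[of \<mu> "1 / t" "\<lambda>x. T t f x - f x" "T r f"] L2s
      by (simp add: k_def L2_inner_commute[of \<mu> "T r f"] L2_inner_diff)
    also have "\<dots> = (L2_inner \<mu> (T (r + t) f) f - L2_inner \<mu> (T r f) f) / t"
      using T_inner_add[OF r t0 f] by simp
    finally have "- L2_inner \<mu> (T r f) k = (L2_inner \<mu> (T r f) f - L2_inner \<mu> (T (r + t) f) f) / t"
      by (simp add: minus_divide_left)
    also have "\<dots> \<le> time_form t f / t"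
      using increment_le_time_form[OF r t0 f] t by (simp add: divide_right_mono)
    finally show "- L2_inner \<mu> (T (max 0 s) f) k \<le> time_form t f / t" by (simp add: r_def)
  qed
  also have "\<dots> = time_form t f / t"
    using prob_space.prob_space[OF prob_space_unif[OF t]] by simp
  finally show ?thesis .
qed

lemma L2_norm_average_diff_time_form:
  assumes t: "0 < t" and f: "f \<in> bounded_borel"
  shows "L2_norm \<mu> (\<lambda>x. average t f x - f x) \<le> sqrt (2 * time_form t f)"
proof (rule L2_norm_average_diff_le[OF t f])
  fix s assume s: "0 \<le> s" "s < t"
  have "(L2_norm \<mu> (\<lambda>x. T s f x - f x))\<^sup>2 \<le> 2 * time_form t f"
    using L2_norm_T_diff_le[OF s(1) bounded_borel_L2[OF f]] time_form_mono[OF s(1) _ f, of t] s by simp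
  then show "L2_norm \<mu> (\<lambda>x. T s f x - f x) \<le> sqrt (2 * time_form t f)" by (rule real_le_rsqrt)
qed

end

section \<open>Contradiction between a small form and uniform positivity\<close>

context reversible_markov_process
begin

text \<open>A chain \<bar>f\<bar>, H, h, 1 with H the time average of \<bar>f\<bar> and h its
  normalisation; the three gaps are at most sqrt (2 \<kappa>), sqrt (2 \<kappa>) and r. Since
  \<kappa> \<le> 1/8, the norm of H is at least 1/2, so normalising multiplies the form by at most
  4. The absolute value is taken so that h is nonnegative, the square root of a density.\<close>

lemma abs_close_to_1:
  assumes t: "0 < t" "t \<le> 1" and f: "f \<in> bounded_borel" and f1: "L2_norm \<mu> f = 1"
    and le: "time_form t f \<le> \<kappa> * t" and \<kappa>: "\<kappa> \<le> 1 / 8" and r: "0 \<le> r"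
    and info: "\<And>h. h \<in> gen_domain \<mu> T \<Longrightarrow> (\<And>x. 0 \<le> h x) \<Longrightarrow> L2_norm \<mu> h = 1 \<Longrightarrow>
      pre_form \<mu> T h \<le> 4 * \<kappa> \<Longrightarrow> (\<integral>x. \<bar>(h x)\<^sup>2 - 1\<bar> \<partial>\<mu>) \<le> r\<^sup>2"
  shows "L2_norm \<mu> (\<lambda>x. \<bar>f x\<bar> - 1) \<le> 2 * sqrt (2 * \<kappa>) + r"
proof -
  let ?N = "L2_norm \<mu>"
  define G where "G = (\<lambda>x. \<bar>f x\<bar>)"
  have t0: "0 \<le> t" using t by simp
  have G: "G \<in> bounded_borel" unfolding G_def by (rule bounded_borel_abs[OF f])
  have G1: "?N G = 1" by (simp add: G_def f1)
  have "time_form t G \<le> time_form t f"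
    by (intro time_form_contraction t0 bounded_borel_L2 G f) (simp add: G_def abs_triangle_ineq3)
  then have tG: "time_form t G \<le> \<kappa> * t" using le by linarith
  have "0 \<le> time_form t G" by (intro time_form_nonneg t0 bounded_borel_L2 G)
  then have "0 \<le> \<kappa> * t" using tG by linarith
  then have \<kappa>0: "0 \<le> \<kappa>" using t by (simp add: zero_le_mult_iff)
  have "time_form t G \<le> \<kappa> * 1" using tG t \<kappa>0 by (meson mult_left_mono order_trans)
  then have tG1: "sqrt (2 * time_form t G) \<le> sqrt (2 * \<kappa>)" by simp
  define H where "H = average t G"
  have H: "H \<in> bounded_borel" unfolding H_def by (rule average_bounded_borel[OF t(1) G])
  have HG: "?N (\<lambda>x. H x - G x) \<le> sqrt (2 * \<kappa>)"
    using L2_norm_average_diff_time_form[OF t(1) G] tG1 unfolding H_def by linarith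
  have "sqrt (2 * \<kappa>) \<le> sqrt ((1 / 2)\<^sup>2)" using \<kappa> by (intro real_sqrt_le_mono) (simp add: power2_eq_square)
  then have s12: "sqrt (2 * \<kappa>) \<le> 1 / 2" by (simp only: real_sqrt_abs)
  have N1: "\<bar>?N H - 1\<bar> \<le> sqrt (2 * \<kappa>)"
    using L2_norm_diff_le[OF bounded_borel_L2[OF H] bounded_borel_L2[OF G]] HG G1 by simp
  then have N12: "1 / 2 \<le> ?N H" using s12 by linarith
  have H0: "0 \<le> H x" for x unfolding H_def average_def
    by (intro Bochner_Integration.integral_nonneg T_nonneg bounded_borel_measurable[OF G]) (auto simp: G_def)
  have Hg: "H \<in> gen_domain \<mu> T"
    unfolding H_def gen_domain_def using generator_value_average[OF t(1) G] by blast
  have pH: "pre_form \<mu> T H \<le> \<kappa>"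
  proof -
    have "pre_form \<mu> T H \<le> time_form t G / t" unfolding H_def by (rule pre_form_average_le[OF t(1) G])
    also have "\<dots> \<le> \<kappa>" using tG t by (simp add: divide_le_eq)
    finally show ?thesis .
  qed
  define h where "h = (\<lambda>x. (1 / ?N H) * H x)"
  have hg: "h \<in> gen_domain \<mu> T" unfolding h_def by (rule gen_domain_scale[OF Hg])
  have hL: "h \<in> L2 \<mu>" by (rule gen_domain_L2[OF hg])
  have h0: "0 \<le> h x" for x using H0 by (simp add: h_def)
  have h1: "?N h = 1" unfolding h_def L2_norm_scale using N12 by simp
  have "pre_form \<mu> T h = (1 / ?N H)\<^sup>2 * pre_form \<mu> T H" unfolding h_def by (rule pre_form_scale[OF Hg])
  also have "\<dots> \<le> 2\<^sup>2 * \<kappa>"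
  proof (intro mult_mono power_mono)
    show "1 / ?N H \<le> 2" using N12 by (simp add: divide_le_eq)
  qed (use pH pre_form_nonneg[OF Hg] in auto)
  finally have "pre_form \<mu> T h \<le> 4 * \<kappa>" by simp
  from info[OF hg h0 h1 this] have hr: "(\<integral>x. \<bar>(h x)\<^sup>2 - 1\<bar> \<partial>\<mu>) \<le> r\<^sup>2" .
  \<comment> \<open>For h \<ge> 0 one has \<bar>h - 1\<bar> \<le> h + 1, hence (h - 1)^2 \<le>
    \<bar>h^2 - 1\<bar>.\<close>
  have "(?N (\<lambda>x. h x - 1))\<^sup>2 \<le> r\<^sup>2"
  proof -
    have "(\<integral>x. (h x - 1)\<^sup>2 \<partial>\<mu>) \<le> (\<integral>x. \<bar>(h x)\<^sup>2 - 1\<bar> \<partial>\<mu>)"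
    proof (rule integral_mono')
      show "integrable \<mu> (\<lambda>x. \<bar>(h x)\<^sup>2 - 1\<bar>)" using L2_square_integrable[OF hL] by simp
      fix x
      have "(h x - 1)\<^sup>2 = \<bar>h x - 1\<bar> * \<bar>h x - 1\<bar>" by (simp add: power2_eq_square)
      also have "\<dots> \<le> \<bar>h x - 1\<bar> * \<bar>h x + 1\<bar>" using h0[of x] by (intro mult_left_mono) auto
      also have "\<dots> = \<bar>(h x)\<^sup>2 - 1\<bar>" by (simp add: abs_mult[symmetric] algebra_simps power2_eq_square)
      finally show "(h x - 1)\<^sup>2 \<le> \<bar>(h x)\<^sup>2 - 1\<bar>" .
    qed simp
    then show ?thesis using hr by (simp add: L2_norm_power2)
  qed
  then have hN: "?N (\<lambda>x. h x - 1) \<le> r" using r by (rule power2_le_imp_le)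
  have Hh: "?N (\<lambda>x. H x - h x) \<le> sqrt (2 * \<kappa>)"
  proof -
    have "H x - h x = (1 - 1 / ?N H) * H x" for x by (simp add: h_def algebra_simps)
    then have "?N (\<lambda>x. H x - h x) = \<bar>1 - 1 / ?N H\<bar> * ?N H" by (simp add: L2_norm_scale)
    also have "\<dots> = \<bar>(1 - 1 / ?N H) * ?N H\<bar>" by (simp add: abs_mult)
    also have "(1 - 1 / ?N H) * ?N H = ?N H - 1" using N12 by (simp add: left_diff_distrib)
    finally show ?thesis using N1 by simp
  qed
  note L2s = bounded_borel_L2[OF G] bounded_borel_L2[OF H] hL L2_const[of 1]
  have "?N (\<lambda>x. G x - 1) \<le> ?N (\<lambda>x. G x - H x) + (?N (\<lambda>x. H x - h x) + ?N (\<lambda>x. h x - 1))"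
    using L2_norm_triangle3[OF L2s(1,2,4)] L2_norm_triangle3[OF L2s(2,3,4)] by linarith
  then show ?thesis
    using HG Hh hN by (simp add: G_def L2_norm_minus_commute[of \<mu> H])
qed

text \<open>The sign s of f is within \<sigma> of f, and f has mean 0, so both signs have measure at
  least 1/4. Four times the form of the indicator of B is the form of s, at most 2 \<kappa> (\<tau>
  + 1) + 4 \<sigma>^2 at time \<tau>; a quarter of this, averaged over an exponential time of mean
  1, is \<kappa> + \<sigma>^2.\<close>

lemma resolvent_lower_bound:
  assumes t: "0 < t" "t \<le> 1" and f: "f \<in> bounded_borel" and mean: "(\<integral>x. f x \<partial>\<mu>) = 0"
    and le: "time_form t f \<le> \<kappa> * t"
    and \<sigma>: "L2_norm \<mu> (\<lambda>x. \<bar>f x\<bar> - 1) \<le> \<sigma>" "\<sigma> \<le> 1 / 2"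
    and \<delta>: "\<And>A B. A \<in> sets borel \<Longrightarrow> B \<in> sets borel \<Longrightarrow> 1 / 4 \<le> measure \<mu> A \<Longrightarrow> 1 / 4 \<le> measure \<mu> B \<Longrightarrow>
      \<delta> \<le> (\<integral>x. indicator A x * resolvent1 T (indicator B) x \<partial>\<mu>)"
  shows "\<delta> \<le> \<kappa> + \<sigma>\<^sup>2"
proof -
  let ?N = "L2_norm \<mu>"
  note [measurable] = bounded_borel_measurable[OF f]
  define B where "B = {x. f x < 0}"
  have B [measurable]: "B \<in> sets borel" unfolding B_def by measurable
  define s where "s = (\<lambda>x. 1 - 2 * indicator B x :: real)"
  have s: "s \<in> bounded_borel" unfolding s_def
    by (intro bounded_borel_diff bounded_borel_const bounded_borel_scale bounded_borel_indicator B)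
  have sf: "s x - f x = s x * (1 - \<bar>f x\<bar>)" for x
    by (cases "f x < 0") (simp_all add: s_def B_def)
  have s2: "(s x)\<^sup>2 = 1" for x by (auto simp: s_def indicator_def)
  have "?N (\<lambda>x. s x - f x) = ?N (\<lambda>x. \<bar>f x\<bar> - 1)"
    by (simp add: L2_norm_def sf power_mult_distrib s2 power2_commute[of 1])
  then have Nsf: "?N (\<lambda>x. s x - f x) \<le> \<sigma>" using \<sigma> by simp
  have "\<bar>\<integral>x. s x - f x \<partial>\<mu>\<bar> \<le> 1 / 2"
    using abs_integral_le_L2_norm[OF L2_diff[OF bounded_borel_L2[OF s] bounded_borel_L2[OF f]]] Nsf \<sigma> by linarith
  then have "\<bar>\<integral>x. s x \<partial>\<mu>\<bar> \<le> 1 / 2"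
    using mean by (simp add: bounded_borel_integrable s f)
  moreover have "(\<integral>x. s x \<partial>\<mu>) = 1 - 2 * measure \<mu> B"
    unfolding s_def by (simp add: less_top[symmetric])
  ultimately have mB: "1 / 4 \<le> measure \<mu> B" "measure \<mu> B \<le> 3 / 4" by linarith+
  have "measure \<mu> (- B) = 1 - measure \<mu> B"
    using prob_compl[of B] by (simp add: Compl_eq_Diff_UNIV)
  then have mA: "1 / 4 \<le> measure \<mu> (- B)" using mB by simp
  have up: "4 * time_form \<tau> (indicator B) \<le> 2 * (\<kappa> * (\<tau> + 1)) + 4 * \<sigma>\<^sup>2" if \<tau>: "0 \<le> \<tau>" for \<tau>
  proof -
    have "4 * time_form \<tau> (indicator B) = time_form \<tau> (\<lambda>x. 2 * indicator B x)"
      using time_form_scale[OF \<tau> bounded_borel_indicator[OF B], of 2] by simp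
    also have "\<dots> = time_form \<tau> s"
      by (intro time_form_eq_of_abs_eq \<tau> bounded_borel_L2 bounded_borel_scale bounded_borel_indicator B s)
        (simp add: s_def)
    also have "\<dots> = time_form \<tau> (\<lambda>x. f x + (s x - f x))" by simp
    also have "\<dots> \<le> 2 * time_form \<tau> f + 2 * time_form \<tau> (\<lambda>x. s x - f x)"
      by (rule time_form_add_le[OF \<tau> f bounded_borel_diff[OF s f]])
    also have "\<dots> \<le> 2 * (\<kappa> * (\<tau> + 1)) + 2 * (2 * \<sigma>\<^sup>2)"
    proof (intro add_mono mult_left_mono)
      show "time_form \<tau> f \<le> \<kappa> * (\<tau> + 1)" by (rule time_form_le_linear[OF t f le \<tau>])
      have "time_form \<tau> (\<lambda>x. s x - f x) \<le> 2 * (?N (\<lambda>x. s x - f x))\<^sup>2"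
        by (intro time_form_le_L2_norm \<tau> bounded_borel_L2 bounded_borel_diff s f)
      also have "\<dots> \<le> 2 * \<sigma>\<^sup>2" using Nsf by (intro mult_left_mono power_mono) auto
      finally show "time_form \<tau> (\<lambda>x. s x - f x) \<le> 2 * \<sigma>\<^sup>2" .
    qed auto
    finally show ?thesis by simp
  qed
  let ?D = "density lborel (exponential_density 1)"
  interpret D: prob_space ?D by (rule prob_space_exponential_density) simp
  have "distributed ?D lborel (\<lambda>x. x) (exponential_density 1)"
    by (auto simp: distributed_def distr_id2)
  then have ED: "D.expectation (\<lambda>x. x) = 1"
    using D.exponential_distributed_expectation[of 1 "\<lambda>x. x"] by simp
  \<comment> \<open>The integral of a non-integrable function is 0 by convention, so the value 1
    certifies integrability.\<close>
  then have ID: "integrable ?D (\<lambda>x. x)"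
    using not_integrable_integral_eq[of ?D "\<lambda>x. x"] by fastforce
  have AED: "AE \<tau> in ?D. 0 \<le> \<tau>"
    by (subst AE_density) (auto simp: exponential_density_def intro!: AE_I2)
  have "\<delta> \<le> (\<integral>x. indicator (- B) x * resolvent1 T (indicator B) x \<partial>\<mu>)"
    using mA mB B by (intro \<delta>) auto
  also have "\<dots> = (\<integral>\<tau>. \<integral>x. indicator (- B) x * T (max 0 \<tau>) (indicator B) x \<partial>\<mu> \<partial>?D)"
    by (rule integral_indicator_resolvent1) auto
  also have "\<dots> = (\<integral>\<tau>. time_form (max 0 \<tau>) (indicator B) \<partial>?D)"
    by (simp add: time_form_indicator B)
  also have "\<dots> \<le> (\<integral>\<tau>. \<kappa> / 2 * \<tau> + (\<kappa> / 2 + \<sigma>\<^sup>2) \<partial>?D)"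
  proof (rule integral_mono_AE')
    show "integrable ?D (\<lambda>\<tau>. \<kappa> / 2 * \<tau> + (\<kappa> / 2 + \<sigma>\<^sup>2))" using ID by simp
    show "AE \<tau> in ?D. time_form (max 0 \<tau>) (indicator B) \<le> \<kappa> / 2 * \<tau> + (\<kappa> / 2 + \<sigma>\<^sup>2)"
      using AED
    proof eventually_elim
      case (elim \<tau>)
      then show ?case using up[OF elim] by (simp add: max_def algebra_simps)
    qed
    show "AE \<tau> in ?D. 0 \<le> \<kappa> / 2 * \<tau> + (\<kappa> / 2 + \<sigma>\<^sup>2)"
      using AED
    proof eventually_elim
      case (elim \<tau>)
      then show ?case
        using up[OF elim] time_form_nonneg[OF elim bounded_borel_L2[OF bounded_borel_indicator[OF B]]]
        by (simp add: algebra_simps)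
    qed
  qed
  also have "\<dots> = \<kappa> + \<sigma>\<^sup>2"
    using ID ED D.prob_space by (simp add: algebra_simps)
  finally show ?thesis .
qed

lemma uniformly_positive_improving_bound:
  assumes "uniformly_positive_improving \<mu> (resolvent1 T)" "0 < \<epsilon>"
  shows "\<exists>\<delta>>0. \<forall>A B. A \<in> sets borel \<longrightarrow> B \<in> sets borel \<longrightarrow> \<epsilon> \<le> measure \<mu> A \<longrightarrow> \<epsilon> \<le> measure \<mu> B \<longrightarrow>
      \<delta> \<le> (\<integral>x. indicator A x * resolvent1 T (indicator B) x \<partial>\<mu>)"
proof -
  let ?S = "{ereal (\<integral>x. indicator A x * resolvent1 T (indicator B) x \<partial>\<mu>) | A B.
        A \<in> sets \<mu> \<and> B \<in> sets \<mu> \<and> measure \<mu> A \<ge> \<epsilon> \<and> measure \<mu> B \<ge> \<epsilon>}"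
  have "0 < Inf ?S" using assms by (simp add: uniformly_positive_improving_def)
  then obtain \<delta> where \<delta>: "0 < ereal \<delta>" "ereal \<delta> < Inf ?S" using ereal_dense2 by blast
  have "\<delta> \<le> (\<integral>x. indicator A x * resolvent1 T (indicator B) x \<partial>\<mu>)"
    if "A \<in> sets borel" "B \<in> sets borel" "\<epsilon> \<le> measure \<mu> A" "\<epsilon> \<le> measure \<mu> B" for A B
  proof -
    have "Inf ?S \<le> ereal (\<integral>x. indicator A x * resolvent1 T (indicator B) x \<partial>\<mu>)"
      by (rule Inf_lower) (use that in auto)
    with \<delta>(2) have "ereal \<delta> \<le> ereal (\<integral>x. indicator A x * resolvent1 T (indicator B) x \<partial>\<mu>)"
      by (meson less_imp_le order_trans)
    then show ?thesis by simp
  qed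
  then show ?thesis using \<delta>(1) by auto
qed

text \<open>The failure of the bound for a centred, normalised f makes \<bar>f\<bar> close to 1 and
  then the mass exchanged between the two signs too small. The general case follows by centring and
  scaling, under which the form and the variance behave alike. The constant \<kappa> does not depend
  on t, which the passage to t = 0 requires.\<close>

lemma spectral_gap_at_time:
  fixes \<alpha> :: "real \<Rightarrow> ereal"
  assumes upi: "uniformly_positive_improving \<mu> (resolvent1 T)"
    and mono: "mono_on {0..} \<alpha>" and pos: "\<And>r. 0 < r \<Longrightarrow> 0 < \<alpha> r"
    and info: "\<And>\<nu>. \<nu> \<in> space (prob_algebra borel) \<Longrightarrow> \<alpha> (tv_norm \<nu> \<mu>) \<le> fisher_info \<mu> T \<nu>"
  shows "\<exists>\<kappa>>0. \<forall>f \<in> bounded_borel. \<forall>t. 0 < t \<and> t \<le> 1 \<longrightarrow> \<kappa> * t * Var \<mu> f \<le> time_form t f"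
proof -
  obtain \<delta> where \<delta>0: "0 < \<delta>" and \<delta>: "\<And>A B. A \<in> sets borel \<Longrightarrow> B \<in> sets borel \<Longrightarrow>
      1 / 4 \<le> measure \<mu> A \<Longrightarrow> 1 / 4 \<le> measure \<mu> B \<Longrightarrow>
      \<delta> \<le> (\<integral>x. indicator A x * resolvent1 T (indicator B) x \<partial>\<mu>)"
    using uniformly_positive_improving_bound[OF upi, of "1 / 4"] by auto
  \<comment> \<open>The bound 1/2 keeps both signs at measure at least 1/4; \<sigma>^2 \<le>
    \<delta> / 4 leaves room for \<kappa> + \<sigma>^2 < \<delta>.\<close>
  define \<sigma> where "\<sigma> = min (1 / 2) (sqrt \<delta> / 2)"
  have \<sigma>: "0 < \<sigma>" "\<sigma> \<le> 1 / 2" using \<delta>0 by (auto simp: \<sigma>_def)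
  have "\<sigma>\<^sup>2 \<le> (sqrt \<delta> / 2)\<^sup>2" using \<sigma> by (intro power_mono) (auto simp: \<sigma>_def)
  then have \<sigma>\<delta>: "\<sigma>\<^sup>2 \<le> \<delta> / 4" using \<delta>0 by (simp add: power_divide)
  define r where "r = \<sigma> / 2"
  have r: "0 < r" using \<sigma> by (simp add: r_def)
  \<comment> \<open>\<alpha> may be infinite at r^2, so a finite positive level below it is
    chosen.\<close>
  obtain z where z: "0 < ereal z" "ereal z < \<alpha> (r\<^sup>2)" using pos[of "r\<^sup>2"] r ereal_dense2 by force
  \<comment> \<open>\<kappa> \<le> z / 4 keeps the form of the normalised average, at most 4
    \<kappa>, below \<alpha> (r^2); \<kappa> \<le> \<sigma>^2 / 32 gives 2 sqrt (2 \<kappa>) \<le>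
    \<sigma> / 2, so that adding r = \<sigma> / 2 yields \<sigma>.\<close>
  define \<kappa> where "\<kappa> = min (z / 4) (\<sigma>\<^sup>2 / 32)"
  have \<kappa>0: "0 < \<kappa>" using z \<sigma> by (simp add: \<kappa>_def)
  have "\<sigma>\<^sup>2 \<le> (1 / 2)\<^sup>2" using \<sigma> by (intro power_mono) auto
  then have \<kappa>8: "\<kappa> \<le> 1 / 8" by (simp add: \<kappa>_def power2_eq_square)
  have "sqrt (2 * \<kappa>) \<le> sqrt ((\<sigma> / 4)\<^sup>2)"
    by (intro real_sqrt_le_mono) (simp add: \<kappa>_def power_divide)
  then have s\<kappa>: "2 * sqrt (2 * \<kappa>) \<le> \<sigma> / 2" using \<sigma> by simp
  have close: "(\<integral>x. \<bar>(h x)\<^sup>2 - 1\<bar> \<partial>\<mu>) \<le> r\<^sup>2"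
    if h: "h \<in> gen_domain \<mu> T" "\<And>x. 0 \<le> h x" "L2_norm \<mu> h = 1" "pre_form \<mu> T h \<le> 4 * \<kappa>" for h
  proof (rule ccontr)
    define \<nu> where "\<nu> = density \<mu> (\<lambda>x. ennreal ((h x)\<^sup>2))"
    note \<nu> = square_density_prob[OF h(1-3), folded \<nu>_def] fisher_info_square_density[OF h(1-3), folded \<nu>_def]
      tv_norm_square_density[OF h(1-3), folded \<nu>_def]
    assume "\<not> (\<integral>x. \<bar>(h x)\<^sup>2 - 1\<bar> \<partial>\<mu>) \<le> r\<^sup>2"
    then have "r\<^sup>2 \<le> tv_norm \<nu> \<mu>" using \<nu>(3) by simp
    then have "\<alpha> (r\<^sup>2) \<le> \<alpha> (tv_norm \<nu> \<mu>)"
      using tv_norm_nonneg[OF \<nu>(1)] by (intro mono_onD[OF mono]) auto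
    also have "\<dots> \<le> ereal (pre_form \<mu> T h)" using info[OF \<nu>(1)] \<nu>(2) by simp
    also have "\<dots> \<le> ereal z" using h(4) by (simp add: \<kappa>_def min_def split: if_splits)
    finally show False using z(2) by simp
  qed
  have gap1: "\<kappa> * t \<le> time_form t f"
    if f: "f \<in> bounded_borel" and mean: "(\<integral>x. f x \<partial>\<mu>) = 0" and f1: "L2_norm \<mu> f = 1" and t: "0 < t" "t \<le> 1" for f t
  proof (rule ccontr)
    assume "\<not> \<kappa> * t \<le> time_form t f"
    then have le: "time_form t f \<le> \<kappa> * t" by simp
    have "L2_norm \<mu> (\<lambda>x. \<bar>f x\<bar> - 1) \<le> 2 * sqrt (2 * \<kappa>) + r"
      by (rule abs_close_to_1[OF t f f1 le \<kappa>8 _ close]) (use r in simp)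
    then have n: "L2_norm \<mu> (\<lambda>x. \<bar>f x\<bar> - 1) \<le> \<sigma>" using s\<kappa> by (simp add: r_def)
    have "\<delta> \<le> \<kappa> + \<sigma>\<^sup>2" by (rule resolvent_lower_bound[OF t f mean le n \<sigma>(2) \<delta>])
    moreover have "\<kappa> \<le> \<sigma>\<^sup>2 / 32" by (simp add: \<kappa>_def)
    ultimately show False using \<sigma>\<delta> \<delta>0 by linarith
  qed
  have "\<kappa> * t * Var \<mu> f \<le> time_form t f" if f: "f \<in> bounded_borel" and t: "0 < t" "t \<le> 1" for f t
  proof (cases "Var \<mu> f = 0")
    case True
    then show ?thesis using t f by (simp add: time_form_nonneg bounded_borel_L2)
  next
    case False
    define m where "m = (\<integral>x. f x \<partial>\<mu>)"
    define v where "v = sqrt (Var \<mu> f)"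
    have v: "0 < v" "v\<^sup>2 = Var \<mu> f" using False Var_nonneg[of f] by (auto simp: v_def)
    define g where "g = (\<lambda>x. f x - m)"
    have g: "g \<in> bounded_borel" unfolding g_def by (intro bounded_borel_diff f bounded_borel_const)
    have Ng: "L2_norm \<mu> g = v" by (simp add: v_def Var_def L2_norm_def g_def m_def)
    have t0: "0 \<le> t" using t by simp
    let ?k = "\<lambda>x. (1 / v) * g x"
    have "\<kappa> * t \<le> time_form t ?k"
    proof (rule gap1[OF _ _ _ t])
      show "?k \<in> bounded_borel" by (rule bounded_borel_scale[OF g])
      show "(\<integral>x. ?k x \<partial>\<mu>) = 0" using bounded_borel_integrable[OF f] by (simp add: g_def m_def)
      show "L2_norm \<mu> ?k = 1" unfolding L2_norm_scale Ng using v by simp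
    qed
    also have "time_form t ?k = time_form t g / v\<^sup>2"
      using time_form_scale[OF t0 g, of "1 / v"] by (simp add: power_divide)
    also have "time_form t g = time_form t f"
      by (intro time_form_eq_of_abs_eq t0 bounded_borel_L2 f g) (simp add: g_def)
    finally have "\<kappa> * t \<le> time_form t f / v\<^sup>2" .
    moreover have "0 < v\<^sup>2" using v(1) by simp
    ultimately show ?thesis by (simp add: pos_le_divide_eq v(2))
  qed
  then show ?thesis using \<kappa>0 by auto
qed

text \<open>Elements of the domain may be unbounded. Truncations at level n have a smaller
  finite-time form by contraction, and their variances converge, so the gap extends to g; dividing
  by t and letting t tend to 0 brings in the generator.\<close>

lemma poincare_of_gap_at_time:
  assumes \<kappa>: "0 < \<kappa>"
    and gap: "\<And>f t. f \<in> bounded_borel \<Longrightarrow> 0 < t \<Longrightarrow> t \<le> 1 \<Longrightarrow> \<kappa> * t * Var \<mu> f \<le> time_form t f"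
  shows "poincare \<mu> T (1 / \<kappa>)"
  unfolding poincare_def
proof (intro conjI ballI)
  show "0 \<le> 1 / \<kappa>" using \<kappa> by simp
  fix g assume gg: "g \<in> gen_domain \<mu> T"
  have g: "g \<in> L2 \<mu>" by (rule gen_domain_L2[OF gg])
  note [measurable] = L2_borel[OF g]
  define c where "c n x = max (- real n) (min (real n) (g x))" for n x
  have c: "c n \<in> bounded_borel" for n
    by (rule bounded_borelI[of _ "real n"]) (auto simp: c_def[abs_def])
  have cg: "\<bar>c n x - c n y\<bar> \<le> \<bar>g x - g y\<bar>" for n x y by (simp add: c_def max_def min_def)
  have lim: "(\<lambda>n. L2_norm \<mu> (\<lambda>x. c n x - g x)) \<longlonglongrightarrow> 0"
  proof -
    have "(\<lambda>n. \<integral>x. (c n x - g x)\<^sup>2 \<partial>\<mu>) \<longlonglongrightarrow> (\<integral>x. 0 \<partial>\<mu>)"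
    proof (rule integral_dominated_convergence[where w="\<lambda>x. (g x)\<^sup>2"])
      show "integrable \<mu> (\<lambda>x. (g x)\<^sup>2)" by (rule L2_square_integrable[OF g])
      show "(\<lambda>x. (c n x - g x)\<^sup>2) \<in> borel_measurable \<mu>" for n
        using bounded_borel_measurable[OF c, of n] by simp
      show "AE x in \<mu>. (\<lambda>n. (c n x - g x)\<^sup>2) \<longlonglongrightarrow> 0"
      proof (rule AE_I2)
        fix x
        obtain N where N: "\<bar>g x\<bar> \<le> real N" using real_arch_simple by blast
        show "(\<lambda>n. (c n x - g x)\<^sup>2) \<longlonglongrightarrow> 0"
        proof (rule tendsto_eventually, rule eventually_sequentiallyI[of N])
          fix n assume "N \<le> n"
          then have "\<bar>g x\<bar> \<le> real n" using N by simp
          then show "(c n x - g x)\<^sup>2 = 0" by (simp add: c_def abs_le_iff)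
        qed
      qed
      show "AE x in \<mu>. norm ((c n x - g x)\<^sup>2) \<le> (g x)\<^sup>2" for n
      proof (rule AE_I2)
        fix x
        have "\<bar>c n x - g x\<bar> \<le> \<bar>g x\<bar>" by (simp add: c_def max_def min_def)
        then show "norm ((c n x - g x)\<^sup>2) \<le> (g x)\<^sup>2" by (simp add: abs_le_square_iff)
      qed
    qed simp_all
    then have "(\<lambda>n. sqrt (\<integral>x. (c n x - g x)\<^sup>2 \<partial>\<mu>)) \<longlonglongrightarrow> sqrt 0"
      by (intro tendsto_real_sqrt) simp
    then show ?thesis by (simp add: L2_norm_def)
  qed
  have "\<kappa> * Var \<mu> g \<le> time_form t g / t" if t: "0 < t" "t \<le> 1" for t
  proof -
    have "\<kappa> * t * Var \<mu> (c n) \<le> time_form t g" for n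
      using gap[OF c t, of n] time_form_contraction[OF _ bounded_borel_L2[OF c] g cg, of t n] t by simp
    moreover have "(\<lambda>n. \<kappa> * t * Var \<mu> (c n)) \<longlonglongrightarrow> \<kappa> * t * Var \<mu> g"
      by (intro tendsto_intros Var_tendsto bounded_borel_L2 c g lim)
    ultimately have "\<kappa> * t * Var \<mu> g \<le> time_form t g"
      by (intro LIMSEQ_le_const2) auto
    then show ?thesis using t by (simp add: le_divide_eq mult_ac)
  qed
  then have "\<forall>\<^sub>F t in at_right 0. \<kappa> * Var \<mu> g \<le> time_form t g / t"
    unfolding eventually_at_right_field by (intro exI[of _ 1]) auto
  then have "\<kappa> * Var \<mu> g \<le> pre_form \<mu> T g"
    by (intro tendsto_lowerbound[OF pre_form_tendsto[OF gg]]) auto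
  then show "Var \<mu> g \<le> 1 / \<kappa> * pre_form \<mu> T g" using \<kappa> by (simp add: le_divide_eq mult.commute)
qed

lemma poincare_of_information_inequality:
  fixes \<alpha> :: "real \<Rightarrow> ereal"
  assumes "uniformly_positive_improving \<mu> (resolvent1 T)"
    and "mono_on {0..} \<alpha>" and "\<And>r. 0 < r \<Longrightarrow> 0 < \<alpha> r"
    and "\<And>\<nu>. \<nu> \<in> space (prob_algebra borel) \<Longrightarrow> \<alpha> (tv_norm \<nu> \<mu>) \<le> fisher_info \<mu> T \<nu>"
  shows "\<exists>c. poincare \<mu> T c"
  using spectral_gap_at_time[OF assms] poincare_of_gap_at_time by blast

end

context stationary_ergodic_markov_process
begin

text \<open>The rate function is r^2 / b, since total variation is twice the trivial Wasserstein
  distance and its square is at most 4 b times the information. Raising c to b = max c 1 makes the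
  division meaningful also for c = 0.\<close>

lemma W1_information_inequality:
  assumes P: "poincare \<mu> T c"
  shows "\<exists>\<alpha> :: real \<Rightarrow> ereal. left_cont_increasing \<alpha> \<and> \<alpha> 0 = 0 \<and> (\<forall>r>0. \<alpha> r > 0) \<and>
    (\<forall>\<nu> \<in> space (prob_algebra borel). \<alpha> (enn2real (W1 trivial_metric \<nu> \<mu>)) \<le> fisher_info \<mu> T \<nu>)"
proof -
  define b where "b = max c 1"
  have b: "0 < b" and Pb: "poincare \<mu> T b" using poincare_mono[OF P, of b] by (auto simp: b_def)
  define \<alpha> where "\<alpha> r = ereal (r\<^sup>2 / b)" for r
  have "mono_on {0..} \<alpha>"
    unfolding \<alpha>_def using b by (intro mono_onI) (auto intro!: divide_right_mono power_mono)
  moreover have "continuous (at_left r) \<alpha>" for r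
    unfolding \<alpha>_def[abs_def] continuous_within using b by (intro tendsto_intros) auto
  moreover have "\<alpha> (enn2real (W1 trivial_metric \<nu> \<mu>)) \<le> fisher_info \<mu> T \<nu>"
    if \<nu>: "\<nu> \<in> space (prob_algebra borel)" for \<nu>
  proof (cases "fisher_info \<mu> T \<nu> = \<infinity>")
    case False
    then have ac: "absolutely_continuous \<mu> \<nu>" and I: "fisher_info \<mu> T \<nu> = ereal (real_of_ereal (fisher_info \<mu> T \<nu>))"
      by (auto simp: fisher_info_def Let_def split: if_splits)
    obtain i where i: "fisher_info \<mu> T \<nu> = ereal i" using I by blast
    have "(tv_norm \<nu> \<mu>)\<^sup>2 \<le> 4 * b * i"
      using tv_norm_le_fisher_info[OF Pb \<nu>] by (simp add: i info_scale_def)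
    then have "(tv_norm \<nu> \<mu> / 2)\<^sup>2 / b \<le> i"
      using b by (simp add: power_divide divide_le_eq mult_ac)
    then show ?thesis by (simp add: \<alpha>_def W1_trivial_eq[OF \<nu> ac] i)
  qed simp
  ultimately show ?thesis
    using b by (intro exI[of _ \<alpha>]) (auto simp: left_cont_increasing_def \<alpha>_def zero_ereal_def)
qed

end

theorem theorem3p1:
  fixes F :: "'w measure"
    and P :: "'x::polish_space \<Rightarrow> 'w measure"
    and X :: "real \<Rightarrow> 'w \<Rightarrow> 'x"
    and \<mu> :: "'x measure"
  assumes "stationary_ergodic_markov_process F P X \<mu>"
  shows
    "(\<forall>c. poincare \<mu> (transition P X) c \<longrightarrow>
        (\<forall>\<nu> \<in> space (prob_algebra borel).
           ereal ((tv_norm \<nu> \<mu>)\<^sup>2) \<le> info_scale (4 * c) (fisher_info \<mu> (transition P X) \<nu>)) \<and>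
        (\<forall>\<beta> \<in> space (prob_algebra borel). \<forall>u \<in> borel_measurable borel. \<forall>t>0. \<forall>r>0.
           absolutely_continuous \<mu> \<beta> \<and> (\<lambda>x. enn2real (RN_deriv \<mu> \<beta> x)) \<in> L2 \<mu> \<and>
           bounded (range u) \<longrightarrow>
           measure (\<beta> \<bind> P)
             {\<omega> \<in> space F. 1 / t * (LINT s:{0..t}|lborel. u (X s \<omega>)) - (\<integral>x. u x \<partial>\<mu>) \<ge> r}
           \<le> L2_norm \<mu> (\<lambda>x. enn2real (RN_deriv \<mu> \<beta> x)) * deviation_bound c (oscillation u) t r))
     \<and>
     (reversible \<mu> (transition P X) \<and>
      uniformly_positive_improving \<mu> (resolvent1 (transition P X)) \<longrightarrow>
        (\<forall>\<alpha> :: real \<Rightarrow> ereal. left_cont_increasing \<alpha> \<and> (\<forall>r>0. \<alpha> r > 0) \<and>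
           (\<forall>\<nu> \<in> space (prob_algebra borel).
              \<alpha> (tv_norm \<nu> \<mu>) \<le> fisher_info \<mu> (transition P X) \<nu>) \<longrightarrow>
           (\<exists>c. poincare \<mu> (transition P X) c)))
     \<and>
     (reversible \<mu> (transition P X) \<and>
      uniformly_positive_improving \<mu> (resolvent1 (transition P X)) \<longrightarrow>
        (\<exists>\<alpha> :: real \<Rightarrow> ereal. left_cont_increasing \<alpha> \<and> \<alpha> 0 = 0 \<and> (\<forall>r>0. \<alpha> r > 0) \<and>
           (\<forall>\<nu> \<in> space (prob_algebra borel).
              \<alpha> (enn2real (W1 trivial_metric \<nu> \<mu>)) \<le> fisher_info \<mu> (transition P X) \<nu>))
        \<longleftrightarrow> (\<exists>c. poincare \<mu> (transition P X) c))"
proof -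
  interpret stationary_ergodic_markov_process F P X \<mu> by fact
  \<comment> \<open>The factor d treats both converses at once: d = 1 for total variation, d = 1/2
    for the trivial Wasserstein distance. Rescaling the argument preserves monotonicity and
    positivity of \<alpha>.\<close>
  have converse: "\<exists>c. poincare \<mu> T c"
    if rev: "reversible \<mu> T" and upi: "uniformly_positive_improving \<mu> (resolvent1 T)"
      and \<alpha>: "left_cont_increasing \<alpha>" "\<forall>r>0. \<alpha> r > 0"
      and info: "\<forall>\<nu> \<in> space (prob_algebra borel). \<alpha> (d * tv_norm \<nu> \<mu>) \<le> fisher_info \<mu> T \<nu>"
      and d: "0 < d" for \<alpha> :: "real \<Rightarrow> ereal" and d :: real
  proof -
    interpret reversible_markov_process F P X \<mu> by unfold_locales fact
    show ?thesis
    proof (rule poincare_of_information_inequality[OF upi, of "\<lambda>r. \<alpha> (d * r)"])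
      have "mono_on {0..} \<alpha>" using \<alpha>(1) by (simp add: left_cont_increasing_def)
      then show "mono_on {0..} (\<lambda>r. \<alpha> (d * r))" using d by (auto simp: mono_on_def)
    qed (use \<alpha>(2) info d in auto)
  qed
  \<comment> \<open>If \<nu> is not absolutely continuous, its information is infinite and the bound
    is void; otherwise the distance is exactly half the total variation.\<close>
  have half: "\<alpha> (1 / 2 * tv_norm \<nu> \<mu>) \<le> fisher_info \<mu> T \<nu>"
    if \<nu>: "\<nu> \<in> space (prob_algebra borel)" and le: "\<alpha> (enn2real (W1 trivial_metric \<nu> \<mu>)) \<le> fisher_info \<mu> T \<nu>"
    for \<alpha> :: "real \<Rightarrow> ereal" and \<nu>
  proof (cases "absolutely_continuous \<mu> \<nu>")
    case True
    then show ?thesis using le by (simp add: W1_trivial_eq[OF \<nu>])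
  next
    case False
    then show ?thesis by (simp add: fisher_info_def)
  qed
  show ?thesis
  proof (intro conjI allI impI ballI)
    fix c and \<nu> :: "'x measure" assume "poincare \<mu> T c" "\<nu> \<in> space (prob_algebra borel)"
    then show "ereal ((tv_norm \<nu> \<mu>)\<^sup>2) \<le> info_scale (4 * c) (fisher_info \<mu> T \<nu>)"
      by (rule tv_norm_le_fisher_info)
  next
    fix c t r :: real and \<beta> :: "'x measure" and u :: "'x \<Rightarrow> real"
    assume "poincare \<mu> T c" "\<beta> \<in> space (prob_algebra borel)" "u \<in> borel_measurable borel" "0 < t" "0 < r"
      "absolutely_continuous \<mu> \<beta> \<and> (\<lambda>x. enn2real (RN_deriv \<mu> \<beta> x)) \<in> L2 \<mu> \<and> bounded (range u)"
    then show "measure (\<beta> \<bind> P)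
             {\<omega> \<in> space F. 1 / t * (LINT s:{0..t}|lborel. u (X s \<omega>)) - (\<integral>x. u x \<partial>\<mu>) \<ge> r}
           \<le> L2_norm \<mu> (\<lambda>x. enn2real (RN_deriv \<mu> \<beta> x)) * deviation_bound c (oscillation u) t r"
      by (intro deviation_inequality) auto
  next
    fix \<alpha> :: "real \<Rightarrow> ereal"
    assume "reversible \<mu> T \<and> uniformly_positive_improving \<mu> (resolvent1 T)"
      "left_cont_increasing \<alpha> \<and> (\<forall>r>0. \<alpha> r > 0) \<and>
        (\<forall>\<nu> \<in> space (prob_algebra borel). \<alpha> (tv_norm \<nu> \<mu>) \<le> fisher_info \<mu> T \<nu>)"
    then show "\<exists>c. poincare \<mu> T c" by (intro converse[of \<alpha> 1]) auto
  next
    assume *: "reversible \<mu> T \<and> uniformly_positive_improving \<mu> (resolvent1 T)"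
    show "(\<exists>\<alpha> :: real \<Rightarrow> ereal. left_cont_increasing \<alpha> \<and> \<alpha> 0 = 0 \<and> (\<forall>r>0. \<alpha> r > 0) \<and>
           (\<forall>\<nu> \<in> space (prob_algebra borel). \<alpha> (enn2real (W1 trivial_metric \<nu> \<mu>)) \<le> fisher_info \<mu> T \<nu>))
        \<longleftrightarrow> (\<exists>c. poincare \<mu> T c)"
    proof
      assume "\<exists>\<alpha> :: real \<Rightarrow> ereal. left_cont_increasing \<alpha> \<and> \<alpha> 0 = 0 \<and> (\<forall>r>0. \<alpha> r > 0) \<and>
           (\<forall>\<nu> \<in> space (prob_algebra borel). \<alpha> (enn2real (W1 trivial_metric \<nu> \<mu>)) \<le> fisher_info \<mu> T \<nu>)"
      then obtain \<alpha> :: "real \<Rightarrow> ereal" where \<alpha>: "left_cont_increasing \<alpha>" "\<forall>r>0. \<alpha> r > 0"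
        "\<forall>\<nu> \<in> space (prob_algebra borel). \<alpha> (enn2real (W1 trivial_metric \<nu> \<mu>)) \<le> fisher_info \<mu> T \<nu>"
        by blast
      have "\<forall>\<nu> \<in> space (prob_algebra borel). \<alpha> (1 / 2 * tv_norm \<nu> \<mu>) \<le> fisher_info \<mu> T \<nu>"
        using half \<alpha>(3) by blast
      then show "\<exists>c. poincare \<mu> T c" using * \<alpha>(1,2) by (intro converse[of \<alpha> "1 / 2"]) auto
    qed (use W1_information_inequality in blast)
  qed
qed

end
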